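(* Let $1<p<\infty$, $w\in W_p$, let $A$ satisfy the structural hypotheses listed in the context with this weight $w$, and let $f=w$ in $\Omega$. Assume that $\gamma\in C(\overline\Omega)$ is positive and that there exists $\delta>0$ such that $0<\gamma(x)\le1$ for every $x\in\Omega_\delta$. Then the problem $$-\mathrm{div}(A(x,\nabla u))=f(x)u^{-\gamma(x)}\ \text{in }\Omega,\quad u>0\ \text{in }\Omega,\quad u=0\ \text{on }\partial\Omega$$ admits a weak solution in $W_0^{1,p}(\Omega,w)$.
   Context: Setting: $\Omega\subset\mathbb{R}^N$ is a bounded smooth domain, $N\ge 2$, $1<p<\infty$. For $\delta>0$, $\Omega_\delta=\{x\in\Omega:\mathrm{dist}(x,\partial\Omega)<\delta\}$. $p$-admissible weights: $w\in W_p$ means $w\in L^1_{\mathrm{loc}}(\mathbb{R}^N)$, $0<w<\infty$ a.e. in $\mathbb{R}^N$, and, with $\mu(E)=\int_E w\,dx$ and $d\mu=w\,dx$: (i) there is a constant $C_\mu>0$ with $\mu(2B)\le C_\mu\,\mu(B)$ for every ball $B\subset\mathbb{R}^N$; (ii) if $D$ is open and $\{\phi_i\}\subset C^\infty(D)$ satisfies $\int_D|\phi_i|^p\,d\mu\to0$ and $\int_D|\nabla\phi_i-v|^p\,d\mu\to0$ for a vector-valued measurable $v\in L^p(D,w)$, then $v=0$; (iii) there are constants $\kappa>1$, $C_1>0$ with $\big(\frac1{\mu(B)}\int_B|\phi|^{\kappa p}d\mu\big)^{\frac1{\kappa p}}\le C_1 r\big(\frac1{\mu(B)}\int_B|\nabla\phi|^p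 d\mu\big)^{\frac1p}$ for every ball $B=B(x_0,r)$ and $\phi\in C_c^\infty(B)$; (iv) there is a constant $C_2>0$ with $\int_B|\phi-\phi_B|^p d\mu\le C_2r^p\int_B|\nabla\phi|^pd\mu$ for every ball $B=B(x_0,r)$ and bounded $\phi\in C^\infty(B)$, where $\phi_B=\frac1{\mu(B)}\int_B\phi\,d\mu$. Weighted spaces: $L^p(\Omega,w)$ has norm $(\int_\Omega|u|^pw\,dx)^{1/p}$; $W^{1,p}(\Omega,w)$ is the class of measurable $u$ with $\|u\|_{1,p,w}=(\int_\Omega|u|^pw\,dx+\int_\Omega|\nabla u|^pw\,dx)^{1/p}<\infty$; $W^{1,p}_{\mathrm{loc}}(\Omega,w)$ consists of $u$ with $u\in W^{1,p}(\Omega',w)$ for all $\Omega'\Subset\Omega$; $W_0^{1,p}(\Omega,w)$ is the closure of $C_c^\infty(\Omega)$ in $\|\cdot\|_{1,p,w}$. The gradient is understood as in the standard theory of $p$-admissible weights: $\nabla u$ is the (unique, by (ii)) $L^p(\cdot,w)$-limit of $\nabla\phi_i$ for smooth $\phi_i\to u$ in $L^p(\cdot,w)$. Hypotheses on $A$: $A:\Omega\times\mathbb{R}^N\to\mathbb{R}^N$ is measurable in $x$ for every $\xi$ and continuous in $\xi$ for a.e. $x$, and for a.e. $x\in\Omega$ and every $\xi\in\mathbb{R}^N$: $|A(x,\xi)|\le\beta w(x)|\xi|^{p-1}$ for some constant $\beta>0$; $A(x,\xi)\cdot\xi\ge\alpha w(x)|\xi|^p$ for some constant $\alpha>0$; $\langle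 A(x,\xi_1)-A(x,\xi_2),\xi_1-\xi_2\rangle>0$ for all $\xi_1\ne\xi_2$ in $\mathbb{R}^N$; $A(x,\lambda\xi)=\lambda|\lambda|^{p-2}A(x,\xi)$ for all $\lambda\in\mathbb{R}\setminus\{0\}$. Weak solution: a function $u\in W^{1,p}_{\mathrm{loc}}(\Omega,w)$ with $u>0$ in $\Omega$ such that for every $\omega\Subset\Omega$ there is a constant $c(\omega)>0$ with $u\ge c(\omega)$ a.e. in $\omega$; for every $\phi\in C_c^1(\Omega)$, $\int_\Omega A(x,\nabla u)\cdot\nabla\phi\,dx=\int_\Omega f(x)u^{-\gamma(x)}\phi\,dx$; and $u=0$ on $\partial\Omega$ in the sense that $u^\theta\in W_0^{1,p}(\Omega,w)$ for some $\theta\ge1$. *)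

theory Defs
  imports "HOL-Analysis.Analysis"
begin

text \<open>Throughout, $\mathbb{R}^N$ is an arbitrary type \<open>'a::euclidean_space\<close> with \<open>N = DIM('a)\<close>, and
  functions defined on a subset of $\mathbb{R}^N$ are total functions whose values outside that subset
  are irrelevant. ``Measurable'' and ``almost everywhere'' refer to Lebesgue measure.\<close>

subsection \<open>Smooth functions and smooth domains\<close>

definition grad :: "('a::euclidean_space \<Rightarrow> real) \<Rightarrow> 'a \<Rightarrow> 'a" where
  "grad f x = (\<Sum>b\<in>Basis. frechet_derivative f (at x) b *\<^sub>R b)"

text \<open>The class $C^k(S)$. Only meant for open \<open>S\<close>, since derivatives are taken in the full space.\<close>

primrec Ck_on :: "nat \<Rightarrow> 'a::euclidean_space set \<Rightarrow> ('a \<Rightarrow> real) \<Rightarrow> bool" where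
  "Ck_on 0 S f \<longleftrightarrow> continuous_on S f"
| "Ck_on (Suc k) S f \<longleftrightarrow>
     (\<forall>x\<in>S. f differentiable (at x)) \<and>
     (\<forall>b\<in>Basis. Ck_on k S (\<lambda>x. frechet_derivative f (at x) b))"

definition smooth_on :: "'a::euclidean_space set \<Rightarrow> ('a \<Rightarrow> real) \<Rightarrow> bool" where
  "smooth_on S f \<longleftrightarrow> (\<forall>k. Ck_on k S f)"

text \<open>$C_c^k(S)$ and $C_c^\infty(S)$; the functions are extended by zero to the whole space.\<close>

definition compactly_supported_in :: "'a::euclidean_space set \<Rightarrow> ('a \<Rightarrow> real) \<Rightarrow> bool" where
  "compactly_supported_in S f \<longleftrightarrow> (\<exists>K. compact K \<and> K \<subseteq> S \<and> (\<forall>x. x \<notin> K \<longrightarrow> f x = 0))"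

definition Cck :: "nat \<Rightarrow> 'a::euclidean_space set \<Rightarrow> ('a \<Rightarrow> real) set" where
  "Cck k S = {f. Ck_on k UNIV f \<and> compactly_supported_in S f}"

definition Cc_smooth :: "'a::euclidean_space set \<Rightarrow> ('a \<Rightarrow> real) set" where
  "Cc_smooth S = {f. smooth_on UNIV f \<and> compactly_supported_in S f}"

definition compactly_inside :: "'a::euclidean_space set \<Rightarrow> 'a set \<Rightarrow> bool" (infix "\<Subset>" 50) where
  "D \<Subset> \<Omega> \<longleftrightarrow> compact (closure D) \<and> closure D \<subseteq> \<Omega>"

text \<open>Near each boundary point the domain is the part of a ball lying strictly above the graph of a
  smooth function over a hyperplane orthogonal to a unit vector \<open>e\<close>. The function \<open>g\<close> is only ever
  evaluated at points of that hyperplane: \<open>x - (x \<bullet> e) *\<^sub>R e\<close> is the orthogonal projection of \<open>x\<close>.\<close>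

definition smooth_boundary :: "'a::euclidean_space set \<Rightarrow> bool" where
  "smooth_boundary \<Omega> \<longleftrightarrow>
     (\<forall>x0\<in>frontier \<Omega>. \<exists>r>0. \<exists>e g. norm e = 1 \<and> smooth_on UNIV g \<and>
        \<Omega> \<inter> ball x0 r = {x \<in> ball x0 r. x \<bullet> e > g (x - (x \<bullet> e) *\<^sub>R e)})"

definition bounded_smooth_domain :: "'a::euclidean_space set \<Rightarrow> bool" where
  "bounded_smooth_domain \<Omega> \<longleftrightarrow>
     \<Omega> \<noteq> {} \<and> open \<Omega> \<and> connected \<Omega> \<and> bounded \<Omega> \<and> smooth_boundary \<Omega>"

definition boundary_strip :: "'a::euclidean_space set \<Rightarrow> real \<Rightarrow> 'a set" where
  "boundary_strip \<Omega> \<delta> = {x \<in> \<Omega>. infdist x (frontier \<Omega>) < \<delta>}"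

subsection \<open>Admissible weights\<close>

text \<open>A weight is positive and finite only almost everywhere; it is represented by a real-valued
  function, which may be nonpositive on a null set (there \<open>ennreal\<close> truncates to \<open>0\<close>).\<close>

definition wmeasure :: "('a::euclidean_space \<Rightarrow> real) \<Rightarrow> 'a measure" where
  "wmeasure w = density lebesgue (\<lambda>x. ennreal (w x))"

text \<open>$\int_D |u|^p \, d\mu$ as an extended nonnegative number, for scalar or vector-valued \<open>u\<close>.\<close>

definition Lp_energy ::
  "real \<Rightarrow> ('a::euclidean_space \<Rightarrow> real) \<Rightarrow> 'a set \<Rightarrow> ('a \<Rightarrow> 'b::euclidean_space) \<Rightarrow> ennreal" where
  "Lp_energy p w D u = (\<integral>\<^sup>+x\<in>D. ennreal (norm (u x) powr p) \<partial>wmeasure w)"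

definition Lp ::
  "real \<Rightarrow> ('a::euclidean_space \<Rightarrow> real) \<Rightarrow> 'a set \<Rightarrow> ('a \<Rightarrow> 'b::euclidean_space) set" where
  "Lp p w D = {u \<in> borel_measurable (lebesgue_on D). Lp_energy p w D u < \<infinity>}"

definition waverage ::
  "('a::euclidean_space \<Rightarrow> real) \<Rightarrow> 'a set \<Rightarrow> ('a \<Rightarrow> real) \<Rightarrow> real" where
  "waverage w B f = (1 / measure (wmeasure w) B) * (LINT x:B|wmeasure w. f x)"

definition doubling_weight :: "('a::euclidean_space \<Rightarrow> real) \<Rightarrow> bool" where
  "doubling_weight w \<longleftrightarrow>
     (\<exists>C>0. \<forall>x r. r > 0 \<longrightarrow>
        emeasure (wmeasure w) (ball x (2 * r)) \<le> ennreal C * emeasure (wmeasure w) (ball x r))"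

definition gradient_uniqueness :: "real \<Rightarrow> ('a::euclidean_space \<Rightarrow> real) \<Rightarrow> bool" where
  "gradient_uniqueness p w \<longleftrightarrow>
     (\<forall>D (\<phi> :: nat \<Rightarrow> 'a \<Rightarrow> real) (v :: 'a \<Rightarrow> 'a).
        open D \<longrightarrow> (\<forall>i. smooth_on D (\<phi> i)) \<longrightarrow> v \<in> Lp p w D \<longrightarrow>
        (\<lambda>i. Lp_energy p w D (\<phi> i)) \<longlonglongrightarrow> 0 \<longrightarrow>
        (\<lambda>i. Lp_energy p w D (\<lambda>x. grad (\<phi> i) x - v x)) \<longlonglongrightarrow> 0 \<longrightarrow>
        (AE x in lebesgue. x \<in> D \<longrightarrow> v x = 0))"

definition weighted_sobolev_ineq :: "real \<Rightarrow> ('a::euclidean_space \<Rightarrow> real) \<Rightarrow> bool" where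
  "weighted_sobolev_ineq p w \<longleftrightarrow>
     (\<exists>\<kappa>>1. \<exists>C>0. \<forall>x0 r. r > 0 \<longrightarrow> (\<forall>\<phi>\<in>Cc_smooth (ball x0 r).
        (waverage w (ball x0 r) (\<lambda>x. \<bar>\<phi> x\<bar> powr (\<kappa> * p))) powr (1 / (\<kappa> * p))
        \<le> C * r * (waverage w (ball x0 r) (\<lambda>x. norm (grad \<phi> x) powr p)) powr (1 / p)))"

definition weighted_poincare_ineq :: "real \<Rightarrow> ('a::euclidean_space \<Rightarrow> real) \<Rightarrow> bool" where
  "weighted_poincare_ineq p w \<longleftrightarrow>
     (\<exists>C>0. \<forall>x0 r \<phi>. r > 0 \<longrightarrow> smooth_on (ball x0 r) \<phi> \<longrightarrow> bounded (\<phi> ` ball x0 r) \<longrightarrow>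
        Lp_energy p w (ball x0 r) (\<lambda>x. \<phi> x - waverage w (ball x0 r) \<phi>)
        \<le> ennreal (C * r powr p) * Lp_energy p w (ball x0 r) (grad \<phi>))"

definition p_admissible :: "real \<Rightarrow> ('a::euclidean_space \<Rightarrow> real) \<Rightarrow> bool" where
  "p_admissible p w \<longleftrightarrow>
     w \<in> borel_measurable lebesgue \<and>
     (\<forall>K. compact K \<longrightarrow> set_integrable lebesgue K w) \<and>
     (AE x in lebesgue. 0 < w x) \<and>
     doubling_weight w \<and> gradient_uniqueness p w \<and>
     weighted_sobolev_ineq p w \<and> weighted_poincare_ineq p w"

subsection \<open>Weighted Sobolev spaces\<close>

text \<open>\<open>v\<close> is the gradient of \<open>u\<close> on the open set \<open>D\<close>: an $L^p(D,w)$-limit of gradients of smooth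
  functions converging to \<open>u\<close> in $L^p(D,w)$. By \<open>gradient_uniqueness\<close>, \<open>v\<close> is determined almost
  everywhere in \<open>D\<close> when \<open>w\<close> is admissible.\<close>

definition has_wgradient ::
  "real \<Rightarrow> ('a::euclidean_space \<Rightarrow> real) \<Rightarrow> 'a set \<Rightarrow> ('a \<Rightarrow> real) \<Rightarrow> ('a \<Rightarrow> 'a) \<Rightarrow> bool" where
  "has_wgradient p w D u v \<longleftrightarrow>
     u \<in> Lp p w D \<and> v \<in> Lp p w D \<and>
     (\<exists>\<phi> :: nat \<Rightarrow> 'a \<Rightarrow> real. (\<forall>i. smooth_on D (\<phi> i)) \<and>
        (\<lambda>i. Lp_energy p w D (\<lambda>x. \<phi> i x - u x)) \<longlonglongrightarrow> 0 \<and>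
        (\<lambda>i. Lp_energy p w D (\<lambda>x. grad (\<phi> i) x - v x)) \<longlonglongrightarrow> 0)"

definition W1p :: "real \<Rightarrow> ('a::euclidean_space \<Rightarrow> real) \<Rightarrow> 'a set \<Rightarrow> ('a \<Rightarrow> real) set" where
  "W1p p w \<Omega> = {u. \<exists>v. has_wgradient p w \<Omega> u v}"

definition W1p_loc :: "real \<Rightarrow> ('a::euclidean_space \<Rightarrow> real) \<Rightarrow> 'a set \<Rightarrow> ('a \<Rightarrow> real) set" where
  "W1p_loc p w \<Omega> = {u. \<forall>D. open D \<longrightarrow> D \<Subset> \<Omega> \<longrightarrow> u \<in> W1p p w D}"

definition has_wgradient_loc ::
  "real \<Rightarrow> ('a::euclidean_space \<Rightarrow> real) \<Rightarrow> 'a set \<Rightarrow> ('a \<Rightarrow> real) \<Rightarrow> ('a \<Rightarrow> 'a) \<Rightarrow> bool" where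
  "has_wgradient_loc p w \<Omega> u v \<longleftrightarrow> (\<forall>D. open D \<longrightarrow> D \<Subset> \<Omega> \<longrightarrow> has_wgradient p w D u v)"

text \<open>The closure of $C_c^\infty(\Omega)$ in $W^{1,p}(\Omega,w)$; convergence in norm is expressed
  through the $p$-th power of the norm.\<close>

definition W1p_0 :: "real \<Rightarrow> ('a::euclidean_space \<Rightarrow> real) \<Rightarrow> 'a set \<Rightarrow> ('a \<Rightarrow> real) set" where
  "W1p_0 p w \<Omega> = {u. \<exists>v. has_wgradient p w \<Omega> u v \<and>
     (\<exists>\<phi> :: nat \<Rightarrow> 'a \<Rightarrow> real. (\<forall>i. \<phi> i \<in> Cc_smooth \<Omega>) \<and>
        (\<lambda>i. Lp_energy p w \<Omega> (\<lambda>x. \<phi> i x - u x)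
             + Lp_energy p w \<Omega> (\<lambda>x. grad (\<phi> i) x - v x)) \<longlonglongrightarrow> 0)}"

subsection \<open>The operator and weak solutions\<close>

definition structural_hypotheses ::
  "real \<Rightarrow> ('a::euclidean_space \<Rightarrow> real) \<Rightarrow> 'a set \<Rightarrow> ('a \<Rightarrow> 'a \<Rightarrow> 'a) \<Rightarrow> bool" where
  "structural_hypotheses p w \<Omega> A \<longleftrightarrow>
     (\<forall>\<xi>. (\<lambda>x. A x \<xi>) \<in> borel_measurable (lebesgue_on \<Omega>)) \<and>
     (AE x in lebesgue. x \<in> \<Omega> \<longrightarrow> continuous_on UNIV (A x)) \<and>
     (\<exists>\<beta>>0. AE x in lebesgue. x \<in> \<Omega> \<longrightarrow>
        (\<forall>\<xi>. norm (A x \<xi>) \<le> \<beta> * w x * norm \<xi> powr (p - 1))) \<and>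
     (\<exists>\<alpha>>0. AE x in lebesgue. x \<in> \<Omega> \<longrightarrow>
        (\<forall>\<xi>. A x \<xi> \<bullet> \<xi> \<ge> \<alpha> * w x * norm \<xi> powr p)) \<and>
     (AE x in lebesgue. x \<in> \<Omega> \<longrightarrow>
        (\<forall>\<xi>1 \<xi>2. \<xi>1 \<noteq> \<xi>2 \<longrightarrow> (A x \<xi>1 - A x \<xi>2) \<bullet> (\<xi>1 - \<xi>2) > 0)) \<and>
     (AE x in lebesgue. x \<in> \<Omega> \<longrightarrow>
        (\<forall>\<xi> t. t \<noteq> 0 \<longrightarrow> A x (t *\<^sub>R \<xi>) = (t * \<bar>t\<bar> powr (p - 2)) *\<^sub>R A x \<xi>))"

text \<open>Integrability of both integrands is required explicitly because the Bochner integral of a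
  non-integrable function is \<open>0\<close> by convention.\<close>

definition weak_solution ::
  "real \<Rightarrow> ('a::euclidean_space \<Rightarrow> real) \<Rightarrow> 'a set \<Rightarrow> ('a \<Rightarrow> 'a \<Rightarrow> 'a)
    \<Rightarrow> ('a \<Rightarrow> real) \<Rightarrow> ('a \<Rightarrow> real) \<Rightarrow> ('a \<Rightarrow> real) \<Rightarrow> bool" where
  "weak_solution p w \<Omega> A f \<gamma> u \<longleftrightarrow>
     u \<in> W1p_loc p w \<Omega> \<and>
     (\<forall>x\<in>\<Omega>. u x > 0) \<and>
     (\<forall>D. D \<Subset> \<Omega> \<longrightarrow> (\<exists>c>0. AE x in lebesgue. x \<in> D \<longrightarrow> u x \<ge> c)) \<and>
     (\<exists>v. has_wgradient_loc p w \<Omega> u v \<and>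
        (\<forall>\<phi>\<in>Cck 1 \<Omega>.
           set_integrable lebesgue \<Omega> (\<lambda>x. A x (v x) \<bullet> grad \<phi> x) \<and>
           set_integrable lebesgue \<Omega> (\<lambda>x. f x * u x powr (- \<gamma> x) * \<phi> x) \<and>
           (LINT x:\<Omega>|lebesgue. A x (v x) \<bullet> grad \<phi> x)
             = (LINT x:\<Omega>|lebesgue. f x * u x powr (- \<gamma> x) * \<phi> x))) \<and>
     (\<exists>\<theta>\<ge>1. (\<lambda>x. u x powr \<theta>) \<in> W1p_0 p w \<Omega>)"

end

theory Submission
  imports Defs
begin

text \<open>Write \<open>A = w a\<close> and let \<open>V\<close> be the closure of the pairs \<open>(\<phi>, \<nabla>\<phi>)\<close>,
  \<open>\<phi>\<close> smooth with compact support, in $L^p(\Omega, w\,dx)$. For each \<open>n\<close> the problem with the bounded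
  right-hand side $w\,(u^+ + 1/(n+1))^{-\gamma}$ is governed by a monotone operator on \<open>V\<close>, because the
  right-hand side decreases in \<open>u\<close>; it is solved by a variational inequality on a large ball. The
  solutions $u_n$ are nonnegative and increase with \<open>n\<close> by comparison, and $u_0$ is bounded below on
  compact sets by De Giorgi iteration. Since \<open>\<gamma> \<le> 1\<close> near the boundary, testing with $u_n$ bounds
  $u_n^{1-\gamma}$ by $1 + u_n$ there and hence bounds $u_n$ in \<open>V\<close>. Minty's trick passes to the limit.

  Weak compactness enters only through uniform convexity: limits are taken along convex combinations
  of the $u_n$. The finite intersection property needed for the variational inequality is a
  symmetric zero-sum game, so no fixed point theorem is used.\<close>

section \<open>Pointwise inequalities for powers of norms\<close>

text \<open>Gradients of convex combinations do not commute with the nonlinear field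
  \<open>a\<close>, so the equations cannot be averaged directly. Monotonicity replaces the field at
  u_n by the field at a fixed competitor U + t N; then u_n enters linearly, and a linear inequality
  survives midpoints and strong limits. The competitor minus u_n is t N plus U - u_n. As u_n lies
  below U, the product of U - u_n with the positive source is dropped, so the singular term is only
  ever integrated where the test function lives and u_0 is bounded below. Functions are paired with
  their gradients because the zeroth-order term and the principal part then form a single monotone
  field \<open>T n\<close>. Dividing by the weight gives growth and coercivity constant coefficients
  and puts the weight into a finite measure. The abstract half uses only this measure and a closed
  space of pairs that is stable under truncation and satisfies a Sobolev inequality.\<close>

lemma norm_add_powr_le:
  fixes a b :: "'e::real_normed_vector"
  assumes "0 \<le> p"
  shows "norm (a + b) powr p \<le> 2 powr p * (norm a powr p + norm b powr p)"
proof -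
  define m where "m = max (norm a) (norm b)"
  have "norm (a + b) \<le> 2 * m"
    using norm_triangle_ineq[of a b] unfolding m_def by linarith
  then have "norm (a + b) powr p \<le> (2 * m) powr p"
    using assms by (intro powr_mono2) auto
  also have "\<dots> = 2 powr p * m powr p" by (simp add: powr_mult m_def)
  also have "m powr p \<le> norm a powr p + norm b powr p"
    by (simp add: m_def max_def)
  finally show ?thesis by simp
qed

lemma norm_diff_powr_le:
  fixes a b :: "'e::real_normed_vector"
  assumes "0 \<le> p"
  shows "norm (a - b) powr p \<le> 2 powr p * (norm a powr p + norm b powr p)"
  using norm_add_powr_le[OF assms, of a "- b"] by simp

text \<open>Young's inequality without sharp constants: comparing \<open>s\<close> with
  \<open>t powr (p - 1)\<close> decides which of the two powers alone dominates the product.\<close>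

lemma mult_le_powr_add_powr:
  fixes s t :: real
  assumes "1 < p" "0 \<le> s" "0 \<le> t"
  shows "s * t \<le> s powr (p / (p - 1)) + t powr p"
proof (cases "s \<le> t powr (p - 1)")
  case True
  then have "s * t \<le> t powr (p - 1) * t powr 1"
    using assms by (intro mult_mono) auto
  also have "\<dots> = t powr p" by (simp only: powr_add[symmetric]) simp
  finally show ?thesis using powr_ge_zero[of s "p / (p - 1)"] by linarith
next
  case False
  then have "(t powr (p - 1)) powr (1 / (p - 1)) \<le> s powr (1 / (p - 1))"
    using assms by (intro powr_mono2) auto
  then have "t \<le> s powr (1 / (p - 1))"
    using assms by (simp add: powr_powr)
  then have "s * t \<le> s powr 1 * s powr (1 / (p - 1))"
    using assms by (intro mult_mono) auto
  also have "\<dots> = s powr (1 + 1 / (p - 1))" by (simp only: powr_add)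
  also have "1 + 1 / (p - 1) = p / (p - 1)" using assms by (simp add: field_simps)
  finally show ?thesis using powr_ge_zero[of t p] by linarith
qed

text \<open>Above the threshold \<open>h\<close> the factor (t / h)^(p - 1) is at least 1. The free
  \<open>h\<close> later gives L^1 bounds on a finite measure space and, with exponent
  \<open>\<kappa>\<close>, the passage from Sobolev to Poincare.\<close>

lemma le_add_powr:
  fixes t h :: real
  assumes "1 < p" "0 \<le> t" "0 < h"
  shows "t \<le> h + h powr (1 - p) * t powr p"
proof (cases "t \<le> h")
  case True then show ?thesis by (intro add_increasing2) auto
next
  case False
  then have "h powr (p - 1) \<le> t powr (p - 1)" using assms by (intro powr_mono2) auto
  then have "1 \<le> h powr (1 - p) * t powr (p - 1)"
    using assms by (simp add: powr_minus_divide[of h "p - 1", simplified] field_simps)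
  then have "t * 1 \<le> t * (h powr (1 - p) * t powr (p - 1))"
    using assms by (intro mult_left_mono) auto
  also have "\<dots> = h powr (1 - p) * (t powr (p - 1) * t powr 1)" using assms by simp
  also have "t powr (p - 1) * t powr 1 = t powr p" by (simp only: powr_add[symmetric]) simp
  finally show ?thesis using assms by simp
qed

text \<open>Young's inequality with the small factor \<open>e\<close> on the power of
  \<open>m\<close>: when \<open>m\<close> is the gradient norm of a solution, that term is absorbed
  by coercivity.\<close>

lemma powr_mult_le_add:
  fixes m t e :: real
  assumes "1 < p" "0 \<le> m" "0 \<le> t" "0 < e"
  shows "m powr (p - 1) * t \<le> e * m powr p + e powr (1 - p) * t powr p"
proof (cases "t \<le> e * m")
  case True
  then have "m powr (p - 1) * t \<le> m powr (p - 1) * (e * m)" by (intro mult_left_mono) auto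
  also have "\<dots> = e * (m powr (p - 1) * m powr 1)" using assms by simp
  also have "m powr (p - 1) * m powr 1 = m powr p" by (simp only: powr_add[symmetric]) simp
  finally show ?thesis by (simp add: add_increasing2)
next
  case False
  then have "m \<le> t / e" using assms by (simp add: field_simps)
  then have "m powr (p - 1) * t \<le> (t / e) powr (p - 1) * t"
    using assms by (intro mult_right_mono powr_mono2) auto
  also have "\<dots> = e powr (- (p - 1)) * (t powr (p - 1) * t powr 1)"
    unfolding powr_minus_divide using assms by (simp add: powr_divide)
  also have "t powr (p - 1) * t powr 1 = t powr p" by (simp only: powr_add[symmetric]) simp
  finally have "m powr (p - 1) * t \<le> e powr (1 - p) * t powr p" by simp
  then show ?thesis using assms by (intro add_increasing) auto
qed

text \<open>Power minus tangent has a derivative with the sign of x - m, hence a strict minimum at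
  \<open>m\<close>. Continuity up to 0 admits \<open>x = 0\<close>, where the derivative formula is
  not invoked.\<close>

lemma powr_tangent_less:
  fixes x m :: real
  assumes p: "1 < p" and "0 \<le> x" "0 < m" "x \<noteq> m"
  shows "m powr p + p * m powr (p - 1) * (x - m) < x powr p"
proof -
  define f where "f = (\<lambda>x::real. x powr p - p * m powr (p - 1) * x)"
  have der: "(f has_real_derivative p * (x powr (p - 1) - m powr (p - 1))) (at x)" if "x > 0" for x
    unfolding f_def using that
    by (auto intro!: derivative_eq_intros simp: algebra_simps)
  have cont: "continuous_on {0..} f"
    unfolding f_def using p by (intro continuous_intros continuous_on_powr') auto
  have "f m < f x"
  proof (cases "x < m")
    case True
    show ?thesis
    proof (rule DERIV_neg_imp_decreasing_open[OF True])
      fix y assume "x < y" "y < m"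
      with \<open>0 \<le> x\<close> p show "\<exists>z. (f has_real_derivative z) (at y) \<and> z < 0"
        by (intro exI[of _ "p * (y powr (p - 1) - m powr (p - 1))"] conjI der)
          (auto intro!: mult_pos_neg powr_less_mono2)
    qed (use cont \<open>0 \<le> x\<close> in \<open>auto intro: continuous_on_subset\<close>)
  next
    case False
    then have "m < x" using assms by simp
    then show ?thesis
    proof (rule DERIV_pos_imp_increasing_open)
      fix y assume "m < y" "y < x"
      with \<open>0 < m\<close> p show "\<exists>z. (f has_real_derivative z) (at y) \<and> z > 0"
        by (intro exI[of _ "p * (y powr (p - 1) - m powr (p - 1))"] conjI der)
          (auto intro!: mult_pos_pos powr_less_mono2)
    qed (use cont \<open>0 < m\<close> in \<open>auto intro: continuous_on_subset\<close>)
  qed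
  then show ?thesis by (simp add: f_def algebra_simps)
qed

lemma powr_tangent_le:
  fixes x m :: real
  assumes "1 < p" "0 \<le> x" "0 \<le> m"
  shows "m powr p + p * m powr (p - 1) * (x - m) \<le> x powr p"
  using powr_tangent_less[of p x m] assms by (cases "x = m"; cases "m = 0") auto

lemma norm_powr_convex:
  fixes a b :: "'e::real_normed_vector"
  assumes p: "1 < p" and t: "0 \<le> t" "t \<le> 1"
  shows "norm ((1 - t) *\<^sub>R a + t *\<^sub>R b) powr p \<le> (1 - t) * norm a powr p + t * norm b powr p"
proof -
  define m where "m = (1 - t) * norm a + t * norm b"
  have m0: "0 \<le> m" unfolding m_def using t by simp
  have "norm ((1 - t) *\<^sub>R a + t *\<^sub>R b) \<le> m"
    unfolding m_def using t norm_triangle_ineq[of "(1 - t) *\<^sub>R a" "t *\<^sub>R b"] by simp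
  then have "norm ((1 - t) *\<^sub>R a + t *\<^sub>R b) powr p \<le> m powr p"
    using p by (intro powr_mono2) auto
  \<comment> \<open>\<open>m\<close> is the weighted mean of the two norms, so the weighted linear
    parts of the two tangents at \<open>m\<close> cancel.\<close>
  also have "\<dots> = (1 - t) * (m powr p + p * m powr (p - 1) * (norm a - m))
      + t * (m powr p + p * m powr (p - 1) * (norm b - m))"
    unfolding m_def by (simp add: algebra_simps)
  also have "\<dots> \<le> (1 - t) * norm a powr p + t * norm b powr p"
    using t p m0 by (intro add_mono mult_left_mono powr_tangent_le) auto
  finally show ?thesis .
qed

text \<open>Strictness has two sources: the parallelogram law for equal norms, which is why an inner
  product is assumed, and strict convexity of the power for different norms.\<close>

lemma norm_powr_midpoint_less:
  fixes a b :: "'e::real_inner"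
  assumes p: "1 < p" and "a \<noteq> b"
  shows "norm ((1/2) *\<^sub>R (a + b)) powr p < (norm a powr p + norm b powr p) / 2"
proof (cases "norm a = norm b")
  case True
  have "(norm (a + b))\<^sup>2 + (norm (a - b))\<^sup>2 = 2 * (norm a)\<^sup>2 + 2 * (norm b)\<^sup>2"
    by (simp add: power2_norm_eq_inner inner_add inner_diff inner_commute)
  moreover have "(norm (a - b))\<^sup>2 > 0" using assms by simp
  ultimately have "(norm (a + b))\<^sup>2 < (2 * norm a)\<^sup>2" using True by (simp add: power2_eq_square)
  then have "norm (a + b) < 2 * norm a" by (rule power2_less_imp_less) auto
  then have "norm ((1/2) *\<^sub>R (a + b)) powr p < norm a powr p"
    using p by (intro powr_less_mono2) auto
  then show ?thesis using True by simp
next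
  case False
  define m where "m = (norm a + norm b) / 2"
  have m: "0 < m" "norm a \<noteq> m" "norm b \<noteq> m"
    using False \<open>a \<noteq> b\<close> by (auto simp: m_def field_simps add_pos_nonneg add_nonneg_pos)
      (metis add_nonneg_pos add_pos_nonneg norm_ge_zero zero_less_norm_iff)
  have "norm ((1/2) *\<^sub>R (a + b)) \<le> m"
    unfolding m_def using norm_triangle_ineq[of a b] by simp
  then have "norm ((1/2) *\<^sub>R (a + b)) powr p \<le> m powr p"
    using p by (intro powr_mono2) auto
  moreover have "2 * m powr p < norm a powr p + norm b powr p"
  proof -
    have "p * m powr (p - 1) * (norm a - m) + p * m powr (p - 1) * (norm b - m)
        = p * m powr (p - 1) * (norm a + norm b - 2 * m)" by (simp add: algebra_simps)
    also have "\<dots> = 0" by (simp add: m_def)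
    finally show ?thesis
      using powr_tangent_less[of p "norm a" m] powr_tangent_less[of p "norm b" m] p m by force
  qed
  ultimately show ?thesis by argo
qed

definition convexity_defect :: "real \<Rightarrow> 'e::real_normed_vector \<Rightarrow> 'e \<Rightarrow> real" where
  "convexity_defect p a b =
     (norm a powr p + norm b powr p) / 2 - norm ((1/2) *\<^sub>R (a + b)) powr p"

lemma convexity_defect_nonneg:
  fixes a b :: "'e::real_normed_vector"
  assumes p: "1 < p"
  shows "0 \<le> convexity_defect p a b"
  using norm_powr_convex[OF p, of "1/2" a b] by (simp add: convexity_defect_def scaleR_add_right)

text \<open>Uniform convexity in a form replacing Clarkson's inequalities: by homogeneity it suffices
  to find \<open>C\<close> on the compact set where \<open>norm a powr p + norm b powr p = 1\<close>.\<close>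

lemma uniform_convexity:
  assumes p: "1 < p" and e: "0 < e"
  obtains C where "0 \<le> C"
    "\<And>a b::'e::euclidean_space. norm (a - b) powr p
       \<le> e * (norm a powr p + norm b powr p) + C * convexity_defect p a b"
proof -
  define N where "N = (\<lambda>z::'e\<times>'e. norm (fst z) powr p + norm (snd z) powr p)"
  define d where "d = (\<lambda>z::'e\<times>'e. norm (fst z - snd z) powr p)"
  define D where "D = (\<lambda>z::'e\<times>'e. convexity_defect p (fst z) (snd z))"
  define S where "S = {z. N z = 1 \<and> d z \<ge> e}"
  have cont: "continuous_on UNIV N" "continuous_on UNIV d" "continuous_on UNIV D"
    unfolding N_def d_def D_def convexity_defect_def using p
    by (auto intro!: continuous_intros continuous_on_powr')
  have "closed S" unfolding S_def
    by (intro closed_Collect_conj closed_Collect_eq closed_Collect_le cont continuous_intros)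
  moreover have "S \<subseteq> cball 0 1 \<times> cball 0 1"
  proof
    fix z assume "z \<in> S"
    then have "norm (fst z) powr p + norm (snd z) powr p = 1"
      by (simp add: S_def N_def)
    then have "norm (fst z) powr p \<le> 1 powr p" "norm (snd z) powr p \<le> 1 powr p"
      using powr_ge_zero[of "norm (fst z)" p] powr_ge_zero[of "norm (snd z)" p] by (simp_all del: powr_ge_zero)
    then have "norm (fst z) \<le> 1" "norm (snd z) \<le> 1"
      using p powr_less_mono2[of p 1 "norm (fst z)"] powr_less_mono2[of p 1 "norm (snd z)"]
      by (force simp: not_le[symmetric])+
    then show "z \<in> cball 0 1 \<times> cball 0 1" by (cases z) auto
  qed
  ultimately have S: "compact S"
    by (metis bounded_Times bounded_cball bounded_subset compact_eq_bounded_closed)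
  have D0: "D z \<ge> 0" for z
    using convexity_defect_nonneg[OF p] by (simp add: D_def)
  have Dpos: "D z > 0" if "z \<in> S" for z
  proof -
    have "fst z \<noteq> snd z" using that e by (auto simp: S_def d_def)
    then show ?thesis using norm_powr_midpoint_less[OF p] by (simp add: D_def convexity_defect_def)
  qed
  \<comment> \<open>The defect is continuous and positive on the compact set \<open>S\<close>, so it
    has a positive minimum there; if \<open>S\<close> is empty, any constant serves.\<close>
  obtain c where c: "c > 0" "\<And>z. z \<in> S \<Longrightarrow> D z \<ge> c"
  proof (cases "S = {}")
    case True then show ?thesis using that[of 1] by auto
  next
    case False
    obtain z where "z \<in> S" "\<forall>y\<in>S. D z \<le> D y"
      using continuous_attains_inf[OF S False continuous_on_subset[OF cont(3)]] by auto
    then show ?thesis using that[of "D z"] Dpos by auto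
  qed
  \<comment> \<open>On \<open>S\<close> the power of the difference is at most 2 powr p, because
    \<open>N\<close> equals 1, while the defect is at least \<open>c\<close>.\<close>
  define C where "C = 2 powr p / c"
  have C: "0 \<le> C" using c by (simp add: C_def)
  have "norm (a - b) powr p \<le> e * (norm a powr p + norm b powr p) + C * convexity_defect p a b" for a b :: 'e
  proof (cases "a = 0 \<and> b = 0")
    case True then show ?thesis using p by (simp add: convexity_defect_def)
  next
    case False
    define r where "r = norm a powr p + norm b powr p"
    have r: "r > 0" unfolding r_def using False
      by (metis add_nonneg_pos add_pos_nonneg norm_eq_zero powr_ge_zero powr_gt_zero)
    define s where "s = r powr (1 / p)"
    have s: "s > 0" "s powr p = r" using r p by (auto simp: s_def powr_powr)
    \<comment> \<open>Scaling by \<open>inverse s\<close>, with \<open>s powr p = r\<close>, puts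
      the pair on the level set where \<open>N\<close> is 1; all terms are homogeneous of degree
      \<open>p\<close>.\<close>
    define z where "z = (inverse s *\<^sub>R a, inverse s *\<^sub>R b)"
    have sc: "norm (inverse s *\<^sub>R x) powr p = inverse r * norm x powr p" for x :: 'e
      using s(1) by (simp add: powr_mult s(2)[symmetric] inverse_powr)
    have Nz: "N z = 1" using r
      by (simp only: N_def z_def fst_conv snd_conv sc distrib_left[symmetric] r_def[symmetric]) simp
    have dz: "d z = inverse r * norm (a - b) powr p"
      by (simp only: d_def z_def fst_conv snd_conv sc scaleR_diff_right[symmetric])
    have Dz: "D z = inverse r * convexity_defect p a b"
    proof -
      have "(1/2) *\<^sub>R (fst z + snd z) = inverse s *\<^sub>R ((1/2) *\<^sub>R (a + b))"
        by (simp add: z_def scaleR_add_right)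
      moreover have "norm (fst z) powr p = inverse r * norm a powr p"
        "norm (snd z) powr p = inverse r * norm b powr p"
        unfolding z_def fst_conv snd_conv by (rule sc)+
      ultimately show ?thesis unfolding D_def convexity_defect_def
        by (simp only: sc) (simp only: algebra_simps add_divide_distrib times_divide_eq_right)
    qed
    have "d z \<le> e + C * D z"
    proof (cases "d z < e")
      case True then show ?thesis using C D0[of z] by (simp add: add_increasing2)
    next
      case False
      then have "z \<in> S" using Nz by (simp add: S_def)
      then have "C * D z \<ge> C * c" using c C by (intro mult_left_mono) auto
      moreover have "C * c = 2 powr p" using c by (simp add: C_def)
      moreover have "d z \<le> 2 powr p * N z"
        unfolding d_def N_def using norm_diff_powr_le[of p] p by simp
      ultimately show ?thesis using Nz e by simp
    qed
    then have "r * d z \<le> r * (e + C * D z)" using r by simp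
    moreover have "r * d z = norm (a - b) powr p" using r by (simp add: dz)
    moreover have "r * (e + C * D z) = e * r + C * convexity_defect p a b"
      using r by (simp add: Dz distrib_left)
    ultimately show ?thesis by (simp add: r_def)
  qed
  then show ?thesis using that C by blast
qed

section \<open>The spaces $L^p$ of vector-valued functions\<close>

definition Lspace :: "'a measure \<Rightarrow> real \<Rightarrow> ('a \<Rightarrow> 'e::euclidean_space) set" where
  "Lspace M p = {F \<in> borel_measurable M. integrable M (\<lambda>x. norm (F x) powr p)}"

definition energy :: "'a measure \<Rightarrow> real \<Rightarrow> ('a \<Rightarrow> 'e::euclidean_space) \<Rightarrow> real" where
  "energy M p F = (\<integral>x. norm (F x) powr p \<partial>M)"

lemma integral_Fatou_bound:
  fixes f :: "nat \<Rightarrow> 'a \<Rightarrow> real"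
  assumes int: "\<And>n. integrable M (f n)" and nonneg: "\<And>n x. 0 \<le> f n x"
    and g: "g \<in> borel_measurable M" and g0: "\<And>x. 0 \<le> g x"
    and lim: "AE x in M. (\<lambda>n. f n x) \<longlonglongrightarrow> g x"
    and bd: "eventually (\<lambda>n. (\<integral>x. f n x \<partial>M) \<le> C) sequentially"
  shows "integrable M g \<and> (\<integral>x. g x \<partial>M) \<le> C"
proof -
  obtain n where "(\<integral>x. f n x \<partial>M) \<le> C" using bd by (auto simp: eventually_sequentially)
  moreover have "0 \<le> (\<integral>x. f n x \<partial>M)" by (intro Bochner_Integration.integral_nonneg nonneg)
  ultimately have C: "0 \<le> C" by linarith
  have "(\<integral>\<^sup>+x. ennreal (g x) \<partial>M) = (\<integral>\<^sup>+x. liminf (\<lambda>n. ennreal (f n x)) \<partial>M)"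
  proof (rule nn_integral_cong_AE, use lim in eventually_elim)
    fix x assume "(\<lambda>n. f n x) \<longlonglongrightarrow> g x"
    then have "(\<lambda>n. ennreal (f n x)) \<longlonglongrightarrow> ennreal (g x)" by (intro tendsto_ennrealI)
    then show "ennreal (g x) = liminf (\<lambda>n. ennreal (f n x))"
      by (simp add: lim_imp_Liminf)
  qed
  also have "\<dots> \<le> liminf (\<lambda>n. \<integral>\<^sup>+x. ennreal (f n x) \<partial>M)"
    using int by (intro nn_integral_liminf) auto
  also have "\<dots> \<le> limsup (\<lambda>n. \<integral>\<^sup>+x. ennreal (f n x) \<partial>M)" by (intro Liminf_le_Limsup) auto
  also have "\<dots> \<le> ennreal C"
  proof (rule Limsup_bounded, use bd in eventually_elim)
    fix n assume "(\<integral>x. f n x \<partial>M) \<le> C"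
    then show "(\<integral>\<^sup>+x. ennreal (f n x) \<partial>M) \<le> ennreal C"
      using int nonneg by (subst nn_integral_eq_integral) (auto intro: ennreal_leI)
  qed
  finally have le: "(\<integral>\<^sup>+x. ennreal (g x) \<partial>M) \<le> ennreal C" .
  then have "integrable M g"
    using g g0 by (intro integrableI_nonneg) (auto simp: le_less_trans)
  moreover have "(\<integral>x. g x \<partial>M) \<le> C"
    using le C g0 nn_integral_eq_integral[OF \<open>integrable M g\<close>] by (auto simp: Bochner_Integration.integral_nonneg)
  ultimately show ?thesis by blast
qed

lemma LspaceD:
  assumes "F \<in> Lspace M p"
  shows Lspace_measurable: "F \<in> borel_measurable M"
    and Lspace_integrable: "integrable M (\<lambda>x. norm (F x) powr p)"
  using assms by (auto simp: Lspace_def)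

lemma energy_nonneg: "0 \<le> energy M p F"
  by (simp add: energy_def)

lemma Lspace_dominated:
  fixes F :: "'a \<Rightarrow> 'e::euclidean_space" and G :: "'a \<Rightarrow> 'f::euclidean_space"
  assumes "F \<in> borel_measurable M" "G \<in> Lspace M p" "0 \<le> p" "AE x in M. norm (F x) \<le> norm (G x)"
  shows "F \<in> Lspace M p" "energy M p F \<le> energy M p G"
proof -
  have ae: "AE x in M. norm (F x) powr p \<le> norm (G x) powr p"
    using assms(4) by eventually_elim (auto intro: powr_mono2 assms)
  have "integrable M (\<lambda>x. norm (F x) powr p)"
    by (rule Bochner_Integration.integrable_bound[OF Lspace_integrable[OF assms(2)]])
      (use ae assms(1) in auto)
  then show "F \<in> Lspace M p" using assms(1) by (simp add: Lspace_def)
  show "energy M p F \<le> energy M p G" unfolding energy_def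
    by (rule integral_mono_AE) (use ae Lspace_integrable[OF assms(2)] \<open>integrable M _\<close> in auto)
qed

lemma Lspace_scaleR:
  assumes "F \<in> Lspace M p"
  shows "(\<lambda>x. c *\<^sub>R F x) \<in> Lspace M p"
    and "energy M p (\<lambda>x. c *\<^sub>R F x) = \<bar>c\<bar> powr p * energy M p F"
  using LspaceD[OF assms] by (auto simp: Lspace_def energy_def powr_mult)

lemma Lspace_add:
  assumes "F \<in> Lspace M p" "G \<in> Lspace M p" "0 \<le> p"
  shows "(\<lambda>x. F x + G x) \<in> Lspace M p"
    and "energy M p (\<lambda>x. F x + G x) \<le> 2 powr p * (energy M p F + energy M p G)"
proof -
  note [measurable] = Lspace_measurable[OF assms(1)] Lspace_measurable[OF assms(2)]
  have i: "integrable M (\<lambda>x. 2 powr p * (norm (F x) powr p + norm (G x) powr p))"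
    using Lspace_integrable[OF assms(1)] Lspace_integrable[OF assms(2)] by simp
  have j: "integrable M (\<lambda>x. norm (F x + G x) powr p)"
    by (rule Bochner_Integration.integrable_bound[OF i]) (auto intro!: norm_add_powr_le assms)
  then show "(\<lambda>x. F x + G x) \<in> Lspace M p" by (simp add: Lspace_def)
  have "energy M p (\<lambda>x. F x + G x) \<le> (\<integral>x. 2 powr p * (norm (F x) powr p + norm (G x) powr p) \<partial>M)"
    unfolding energy_def by (rule integral_mono[OF j i]) (rule norm_add_powr_le[OF assms(3)])
  also have "\<dots> = 2 powr p * (energy M p F + energy M p G)"
    using Lspace_integrable[OF assms(1)] Lspace_integrable[OF assms(2)] by (simp add: energy_def)
  finally show "energy M p (\<lambda>x. F x + G x) \<le> 2 powr p * (energy M p F + energy M p G)" .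
qed

lemma energy_uminus: "energy M p (\<lambda>x. - F x) = energy M p F"
  by (simp add: energy_def)

lemma borel_measurable_fst [measurable (raw)]:
  fixes f :: "'a \<Rightarrow> 'b::topological_space \<times> 'c::topological_space"
  assumes "f \<in> borel_measurable M" shows "(\<lambda>x. fst (f x)) \<in> borel_measurable M"
  by (rule measurable_compose[OF assms borel_measurable_continuous_onI]) (intro continuous_intros)

lemma borel_measurable_snd [measurable (raw)]:
  fixes f :: "'a \<Rightarrow> 'b::topological_space \<times> 'c::topological_space"
  assumes "f \<in> borel_measurable M" shows "(\<lambda>x. snd (f x)) \<in> borel_measurable M"
  by (rule measurable_compose[OF assms borel_measurable_continuous_onI]) (intro continuous_intros)

lemma Lspace_norm: "F \<in> Lspace M p \<Longrightarrow> (\<lambda>x. norm (F x)) \<in> Lspace M p"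
  by (auto simp: Lspace_def)

lemma norm_fst_snd_le:
  fixes z :: "'b::real_normed_vector \<times> 'c::real_normed_vector"
  shows "norm (fst z) \<le> norm z" "norm (snd z) \<le> norm z"
  using norm_fst_le[of "fst z" "snd z"] norm_snd_le[of "snd z" "fst z"] by simp_all

lemma norm_Pair_mono:
  assumes "norm a \<le> norm (fst z)" "norm b \<le> norm (snd z)"
  shows "norm (a, b) \<le> norm z"
  unfolding norm_prod_def using assms by (auto intro!: real_sqrt_le_mono add_mono power_mono)

lemma Lspace_fst:
  fixes Z :: "'a \<Rightarrow> 'b::euclidean_space \<times> 'c::euclidean_space"
  assumes "Z \<in> Lspace M p" "0 \<le> p"
  shows "(\<lambda>x. fst (Z x)) \<in> Lspace M p" "energy M p (\<lambda>x. fst (Z x)) \<le> energy M p Z"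
  by (rule Lspace_dominated[OF borel_measurable_fst[OF Lspace_measurable[OF assms(1)]] assms];
      intro AE_I2 norm_fst_snd_le)+

lemma Lspace_snd:
  fixes Z :: "'a \<Rightarrow> 'b::euclidean_space \<times> 'c::euclidean_space"
  assumes "Z \<in> Lspace M p" "0 \<le> p"
  shows "(\<lambda>x. snd (Z x)) \<in> Lspace M p" "energy M p (\<lambda>x. snd (Z x)) \<le> energy M p Z"
  by (rule Lspace_dominated[OF borel_measurable_snd[OF Lspace_measurable[OF assms(1)]] assms];
      intro AE_I2 norm_fst_snd_le)+

lemma one_over_Suc_tendsto_0: "(\<lambda>n. 1 / real (Suc n)) \<longlonglongrightarrow> 0"
  using LIMSEQ_inverse_real_of_nat by (simp add: inverse_eq_divide)

lemma Lspace_uminus: "F \<in> Lspace M p \<Longrightarrow> (\<lambda>x. - F x) \<in> Lspace M p"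
  using Lspace_scaleR(1)[of F M p "-1"] by simp

lemma Lspace_diff:
  assumes "F \<in> Lspace M p" "G \<in> Lspace M p" "0 \<le> p"
  shows "(\<lambda>x. F x - G x) \<in> Lspace M p"
    and "energy M p (\<lambda>x. F x - G x) \<le> 2 powr p * (energy M p F + energy M p G)"
  using Lspace_add[OF assms(1) Lspace_uminus[OF assms(2)] assms(3)] by (simp_all add: energy_uminus)

lemma energy_triangle:
  assumes "F \<in> Lspace M p" "G \<in> Lspace M p" "H \<in> Lspace M p" "0 \<le> p"
  shows "energy M p (\<lambda>x. F x - H x)
    \<le> 2 powr p * (energy M p (\<lambda>x. F x - G x) + energy M p (\<lambda>x. G x - H x))"
  using Lspace_add(2)[OF Lspace_diff(1)[OF assms(1,2,4)] Lspace_diff(1)[OF assms(2,3,4)] assms(4)]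
  by simp

lemma energy_tendsto_0_le:
  assumes "\<And>n. f n \<le> c * g n" "(\<And>n. 0 \<le> f n)" "g \<longlonglongrightarrow> (0::real)"
  shows "f \<longlonglongrightarrow> (0::real)"
proof (rule tendsto_sandwich[where f="\<lambda>_. 0" and h="\<lambda>n. c * g n"])
  show "(\<lambda>n. c * g n) \<longlonglongrightarrow> 0" using tendsto_mult_left[OF assms(3), of c] by simp
qed (use assms in auto)

section \<open>Convergence, completeness and duality in L^p over a finite measure\<close>

locale finite_Lp = finite_measure M for M :: "'a measure" +
  fixes p :: real
  assumes p: "1 < p"
begin

lemma p_nonneg: "0 \<le> p"
  using p by simp

lemma Lspace_const: "(\<lambda>x. c) \<in> Lspace M p"
  by (simp add: Lspace_def)

lemma Lspace_bounded:
  assumes "F \<in> borel_measurable M" "AE x in M. norm (F x) \<le> B"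
  shows "F \<in> Lspace M p"
proof (rule Lspace_dominated(1)[OF assms(1) Lspace_const[of B] p_nonneg])
  show "AE x in M. norm (F x) \<le> norm B" using assms(2) by eventually_elim auto
qed

lemma AE_convergent_subsequence:
  assumes F: "\<And>n. F n \<in> Lspace M p" and G: "G \<in> Lspace M p"
    and lim: "(\<lambda>n. energy M p (\<lambda>x. F n x - G x)) \<longlonglongrightarrow> 0"
  obtains r :: "nat \<Rightarrow> nat" where "strict_mono r" "AE x in M. (\<lambda>n. F (r n) x) \<longlonglongrightarrow> G x"
proof -
  have "integrable M (\<lambda>x. norm (F n x - G x) powr p)" for n
    using Lspace_integrable[OF Lspace_diff(1)[OF F G p_nonneg]] .
  then obtain r :: "nat \<Rightarrow> nat" where r: "strict_mono r"
    "AE x in M. (\<lambda>n. norm (F (r n) x - G x) powr p) \<longlonglongrightarrow> 0"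
    using tendsto_L1_AE_subseq[of M "\<lambda>n x. norm (F n x - G x) powr p"] lim
    by (auto simp: energy_def)
  have "AE x in M. (\<lambda>n. F (r n) x) \<longlonglongrightarrow> G x"
    using r(2)
  proof eventually_elim
    fix x assume "(\<lambda>n. norm (F (r n) x - G x) powr p) \<longlonglongrightarrow> 0"
    then have "(\<lambda>n. (norm (F (r n) x - G x) powr p) powr (1 / p)) \<longlonglongrightarrow> 0 powr (1 / p)"
      using p by (intro tendsto_powr') auto
    then have "(\<lambda>n. norm (F (r n) x - G x)) \<longlonglongrightarrow> 0" using p by (simp add: powr_powr)
    then show "(\<lambda>n. F (r n) x) \<longlonglongrightarrow> G x" by (simp add: tendsto_norm_zero_iff LIM_zero_iff)
  qed
  with r(1) show ?thesis by (rule that)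
qed

lemma energy_dominated_convergence:
  fixes F :: "nat \<Rightarrow> 'a \<Rightarrow> 'e::euclidean_space" and W :: "'a \<Rightarrow> 'f::euclidean_space"
  assumes F: "\<And>n. F n \<in> borel_measurable M" and G: "G \<in> borel_measurable M"
    and lim: "AE x in M. (\<lambda>n. F n x) \<longlonglongrightarrow> G x"
    and W: "W \<in> Lspace M p" and bd: "\<And>n. AE x in M. norm (F n x) \<le> norm (W x)"
  shows "(\<lambda>n. energy M p (\<lambda>x. F n x - G x)) \<longlonglongrightarrow> 0"
proof -
  note [measurable] = F G
  have "AE x in M. \<forall>n. norm (F n x) \<le> norm (W x)" using bd by (simp add: AE_all_countable)
  then have Gle: "AE x in M. norm (G x) \<le> norm (W x)"
    using lim
    by eventually_elim (metis (no_types, lifting) LIMSEQ_le_const2 tendsto_norm)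
  have "(\<lambda>n. \<integral>x. norm (F n x - G x) powr p \<partial>M) \<longlonglongrightarrow> (\<integral>x. 0 \<partial>M)"
  proof (rule integral_dominated_convergence)
    show "integrable M (\<lambda>x. 2 powr p * (norm (W x) powr p + norm (W x) powr p))"
      using Lspace_integrable[OF W] by simp
    show "AE x in M. (\<lambda>n. norm (F n x - G x) powr p) \<longlonglongrightarrow> 0"
      using lim
    proof eventually_elim
      fix x assume "(\<lambda>n. F n x) \<longlonglongrightarrow> G x"
      then have "(\<lambda>n. norm (F n x - G x)) \<longlonglongrightarrow> 0" by (simp add: LIM_zero tendsto_norm_zero)
      then have "(\<lambda>n. norm (F n x - G x) powr p) \<longlonglongrightarrow> 0 powr p"
        using p by (intro tendsto_powr') auto
      then show "(\<lambda>n. norm (F n x - G x) powr p) \<longlonglongrightarrow> 0" by simp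
    qed
    show "AE x in M. norm (norm (F n x - G x) powr p)
        \<le> 2 powr p * (norm (W x) powr p + norm (W x) powr p)" for n
      using bd[of n] Gle
    proof eventually_elim
      fix x assume *: "norm (F n x) \<le> norm (W x)" "norm (G x) \<le> norm (W x)"
      have "norm (F n x - G x) powr p \<le> 2 powr p * (norm (F n x) powr p + norm (G x) powr p)"
        by (rule norm_diff_powr_le[OF p_nonneg])
      also have "\<dots> \<le> 2 powr p * (norm (W x) powr p + norm (W x) powr p)"
        using * p by (intro mult_left_mono add_mono powr_mono2) auto
      finally show "norm (norm (F n x - G x) powr p)
        \<le> 2 powr p * (norm (W x) powr p + norm (W x) powr p)" by simp
    qed
  qed measurable
  then show ?thesis by (simp add: energy_def)
qed

lemma energy_Fatou:
  assumes F: "\<And>n. F n \<in> Lspace M p" and G: "G \<in> borel_measurable M"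
    and lim: "AE x in M. (\<lambda>n. F n x) \<longlonglongrightarrow> G x"
    and bd: "eventually (\<lambda>n. energy M p (F n) \<le> C) sequentially"
  shows "G \<in> Lspace M p" "energy M p G \<le> C"
proof -
  note [measurable] = G
  have "AE x in M. (\<lambda>n. norm (F n x) powr p) \<longlonglongrightarrow> norm (G x) powr p"
    using lim by eventually_elim (use p in \<open>auto intro!: tendsto_powr' tendsto_norm\<close>)
  then have "integrable M (\<lambda>x. norm (G x) powr p) \<and> (\<integral>x. norm (G x) powr p \<partial>M) \<le> C"
    using bd by (intro integral_Fatou_bound[of M "\<lambda>n x. norm (F n x) powr p"])
      (auto simp: energy_def intro: Lspace_integrable F)
  then show "G \<in> Lspace M p" "energy M p G \<le> C" by (auto simp: Lspace_def energy_def)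
qed

text \<open>The increments along a rapidly Cauchy subsequence are summed in L^1 rather than in L^p:
  over a finite measure \<open>le_add_powr\<close> turns energies into integrals of norms. This
  gives a limit almost everywhere, and Fatou's lemma gives convergence in energy.\<close>

theorem Lspace_complete:
  fixes F :: "nat \<Rightarrow> 'a \<Rightarrow> 'e::euclidean_space"
  assumes F: "\<And>n. F n \<in> Lspace M p"
    and cauchy: "\<And>e. e > 0 \<Longrightarrow> \<exists>N. \<forall>m\<ge>N. \<forall>n\<ge>N. energy M p (\<lambda>x. F m x - F n x) < e"
  obtains G where "G \<in> Lspace M p" "(\<lambda>n. energy M p (\<lambda>x. F n x - G x)) \<longlonglongrightarrow> 0"
proof -
  note [measurable] = Lspace_measurable[OF F]
  define c where "c = (\<lambda>k::nat. ((1/2) ^ k) powr p)"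
  have c: "c k > 0" for k by (simp add: c_def)
  have "\<exists>r. \<forall>k. (\<forall>m\<ge>r k. \<forall>n\<ge>r k. energy M p (\<lambda>x. F m x - F n x) < c k) \<and> r k < r (Suc k)"
  proof (rule dependent_nat_choice)
    show "\<exists>x. \<forall>m\<ge>x. \<forall>n\<ge>x. energy M p (\<lambda>z. F m z - F n z) < c 0" using cauchy[OF c] .
    fix x k
    obtain N where "\<forall>m\<ge>N. \<forall>n\<ge>N. energy M p (\<lambda>z. F m z - F n z) < c (Suc k)"
      using cauchy[OF c] by blast
    then show "\<exists>y. (\<forall>m\<ge>y. \<forall>n\<ge>y. energy M p (\<lambda>z. F m z - F n z) < c (Suc k)) \<and> x < y"
      by (intro exI[of _ "max N (Suc x)"]) auto
  qed
  then obtain r where r: "\<And>k m n. m \<ge> r k \<Longrightarrow> n \<ge> r k \<Longrightarrow> energy M p (\<lambda>x. F m x - F n x) < c k"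
    and mono: "\<And>k. r k < r (Suc k)" by blast
  have sm: "strict_mono r" using mono by (simp add: strict_mono_Suc_iff)
  define d where "d = (\<lambda>k x. norm (F (r (Suc k)) x - F (r k) x))"
  have [measurable]: "d k \<in> borel_measurable M" for k unfolding d_def by measurable
  have dk: "(\<integral>\<^sup>+x. ennreal (d k x) \<partial>M) \<le> ennreal ((1/2)^k * (measure M (space M) + 1))" for k
  proof -
    \<comment> \<open>\<open>c k\<close> is h powr p, so h powr (1 - p) times the energy is at most
      \<open>h\<close>, and the integrals of the increments are dominated by a geometric
      series.\<close>
    define h :: real where "h = (1/2)^k"
    have h: "h > 0" by (simp add: h_def)
    have i: "integrable M (\<lambda>x. d k x powr p)"
      using Lspace_integrable[OF Lspace_diff(1)[OF F F p_nonneg]] by (simp add: d_def)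
    then have i2: "integrable M (\<lambda>x. h + h powr (1 - p) * d k x powr p)" by simp
    have "(\<integral>\<^sup>+x. ennreal (d k x) \<partial>M) \<le> (\<integral>\<^sup>+x. ennreal (h + h powr (1 - p) * d k x powr p) \<partial>M)"
      using p h by (intro nn_integral_mono ennreal_leI le_add_powr) (auto simp: d_def)
    also have "\<dots> = ennreal (\<integral>x. h + h powr (1 - p) * d k x powr p \<partial>M)"
      by (intro nn_integral_eq_integral i2) (use h in auto)
    also have "(\<integral>x. h + h powr (1 - p) * d k x powr p \<partial>M)
        = h * measure M (space M) + h powr (1 - p) * energy M p (\<lambda>x. F (r (Suc k)) x - F (r k) x)"
      using i by (simp add: energy_def d_def)
    also have "\<dots> \<le> h * measure M (space M) + h powr (1 - p) * h powr p"
      using r[of k "r (Suc k)" "r k"] mono[of k]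
      by (intro add_left_mono mult_left_mono) (auto simp: c_def h_def less_imp_le)
    also have "h powr (1 - p) * h powr p = h" using h by (simp flip: powr_add)
    also have "h * measure M (space M) + h = h * (measure M (space M) + 1)" by (simp add: algebra_simps)
    finally show ?thesis by (simp add: h_def ennreal_leI)
  qed
  have "(\<integral>\<^sup>+x. (\<Sum>k. ennreal (d k x)) \<partial>M) = (\<Sum>k. \<integral>\<^sup>+x. ennreal (d k x) \<partial>M)"
    by (intro nn_integral_suminf) auto
  also have "\<dots> \<le> (\<Sum>k. ennreal ((1/2)^k * (measure M (space M) + 1)))"
    by (intro suminf_le dk) auto
  also have "\<dots> = ennreal (\<Sum>k. (1/2)^k * (measure M (space M) + 1))"
    by (rule suminf_ennreal2) (auto intro!: summable_mult2 summable_geometric)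
  also have "\<dots> < \<infinity>" by simp
  finally have "(\<integral>\<^sup>+x. (\<Sum>k. ennreal (d k x)) \<partial>M) \<noteq> \<infinity>" by simp
  then have "AE x in M. (\<Sum>k. ennreal (d k x)) \<noteq> \<infinity>"
    by (intro nn_integral_noteq_infinite) measurable
  then have conv: "AE x in M. convergent (\<lambda>k. F (r k) x)"
  proof eventually_elim
    fix x assume "(\<Sum>k. ennreal (d k x)) \<noteq> \<infinity>"
    then have "summable (\<lambda>k. d k x)"
      by (intro summable_suminf_not_top) (auto simp: d_def)
    then have "summable (\<lambda>k. F (r (Suc k)) x - F (r k) x)"
      unfolding d_def by (rule summable_norm_cancel)
    then have "convergent (\<lambda>n. \<Sum>k<n. F (r (Suc k)) x - F (r k) x)"
      by (simp add: summable_iff_convergent)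
    then have "convergent (\<lambda>n. F (r n) x - F (r 0) x)" by (simp only: sum_lessThan_telescope[of "\<lambda>k. F (r k) x"])
    then have "convergent (\<lambda>n. (F (r n) x - F (r 0) x) + F (r 0) x)"
      by (intro convergent_add convergent_const)
    then show "convergent (\<lambda>k. F (r k) x)" by simp
  qed
  define G where "G = (\<lambda>x. lim (\<lambda>k. F (r k) x))"
  have [measurable]: "G \<in> borel_measurable M" unfolding G_def by measurable
  have lim: "AE x in M. (\<lambda>k. F (r k) x) \<longlonglongrightarrow> G x"
    using conv by eventually_elim (simp add: G_def convergent_LIMSEQ_iff)
  \<comment> \<open>Fatou's lemma is applied along \<open>r\<close> with \<open>n\<close> fixed,
    which gives the rate for the whole sequence and not only for the subsequence.\<close>
  have near: "(\<lambda>x. F n x - G x) \<in> Lspace M p \<and> energy M p (\<lambda>x. F n x - G x) \<le> c k"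
    if "n \<ge> r k" for n k
  proof -
    have "AE x in M. (\<lambda>j. F n x - F (r j) x) \<longlonglongrightarrow> F n x - G x"
      using lim by eventually_elim (intro tendsto_intros)
    moreover have "eventually (\<lambda>j. energy M p (\<lambda>x. F n x - F (r j) x) \<le> c k) sequentially"
      using eventually_ge_at_top[of k]
    proof eventually_elim
      fix j assume "k \<le> j"
      then have "r k \<le> r j" using sm by (simp add: strict_mono_less_eq)
      then show "energy M p (\<lambda>x. F n x - F (r j) x) \<le> c k" using r[OF that] by (simp add: less_imp_le)
    qed
    ultimately show ?thesis
      using energy_Fatou[of "\<lambda>j x. F n x - F (r j) x" "\<lambda>x. F n x - G x" "c k"]
        Lspace_diff(1)[OF F F p_nonneg] by auto
  qed
  have "G \<in> Lspace M p"
    using Lspace_diff(1)[OF F[of "r 0"] conjunct1[OF near[of 0 "r 0"]] p_nonneg] by simp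
  moreover have "(\<lambda>n. energy M p (\<lambda>x. F n x - G x)) \<longlonglongrightarrow> 0"
  proof (rule LIMSEQ_I)
    fix e :: real assume "e > 0"
    have "(\<lambda>k. ((1/2::real)^k) powr p) \<longlonglongrightarrow> 0 powr p"
      using p by (intro tendsto_powr' LIMSEQ_realpow_zero) auto
    then have "eventually (\<lambda>k. c k < e) sequentially"
      unfolding c_def using \<open>e > 0\<close> by (intro order_tendstoD(2)) auto
    then obtain k where k: "c k < e" by (auto simp: eventually_sequentially)
    show "\<exists>N. \<forall>n\<ge>N. norm (energy M p (\<lambda>x. F n x - G x) - 0) < e"
    proof (intro exI allI impI)
      fix n assume "n \<ge> r k"
      then show "norm (energy M p (\<lambda>x. F n x - G x) - 0) < e"
        using near[of k n] k energy_nonneg[of M p "\<lambda>x. F n x - G x"] by auto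
    qed
  qed
  ultimately show ?thesis by (rule that)
qed

text \<open>Young's inequality, after scaling one factor by \<open>d\<close> and the other by 1 / d,
  stands in for Hoelder's inequality; \<open>d\<close> stays free so that the first term can be made
  small before the second.\<close>

lemma pairing_bound:
  assumes g: "g \<in> Lspace M (p / (p - 1))" and Z: "Z \<in> Lspace M p" and d: "0 < d"
  shows "integrable M (\<lambda>x. g x \<bullet> Z x)"
    and "\<bar>\<integral>x. g x \<bullet> Z x \<partial>M\<bar>
      \<le> d powr (p / (p - 1)) * energy M (p / (p - 1)) g + d powr (- p) * energy M p Z"
proof -
  let ?q = "p / (p - 1)"
  note [measurable] = Lspace_measurable[OF g] Lspace_measurable[OF Z]
  have i: "integrable M (\<lambda>x. d powr ?q * norm (g x) powr ?q + d powr (- p) * norm (Z x) powr p)"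
    using Lspace_integrable[OF g] Lspace_integrable[OF Z] by simp
  have b: "norm (g x \<bullet> Z x) \<le> d powr ?q * norm (g x) powr ?q + d powr (- p) * norm (Z x) powr p" for x
  proof -
    have "norm (g x \<bullet> Z x) \<le> norm (g x) * norm (Z x)" by (simp add: Cauchy_Schwarz_ineq2)
    also have "\<dots> = (d * norm (g x)) * (norm (Z x) / d)" using d by simp
    also have "\<dots> \<le> (d * norm (g x)) powr ?q + (norm (Z x) / d) powr p"
      using d p by (intro mult_le_powr_add_powr) auto
    also have "\<dots> = d powr ?q * norm (g x) powr ?q + d powr (- p) * norm (Z x) powr p"
      using d by (simp add: powr_mult powr_divide powr_minus field_simps)
    finally show ?thesis .
  qed
  show j: "integrable M (\<lambda>x. g x \<bullet> Z x)"
    by (rule Bochner_Integration.integrable_bound[OF i]) (measurable, intro AE_I2 order_trans[OF b], simp only: real_norm_def abs_ge_self)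
  have "\<bar>\<integral>x. g x \<bullet> Z x \<partial>M\<bar> \<le> (\<integral>x. norm (g x \<bullet> Z x) \<partial>M)"
    using integral_norm_bound[of M "\<lambda>x. g x \<bullet> Z x"] by simp
  also have "\<dots> \<le> (\<integral>x. d powr ?q * norm (g x) powr ?q + d powr (- p) * norm (Z x) powr p \<partial>M)"
    using b j i by (intro integral_mono) auto
  also have "\<dots> = d powr ?q * energy M ?q g + d powr (- p) * energy M p Z"
    using Lspace_integrable[OF g] Lspace_integrable[OF Z] by (simp add: energy_def)
  finally show "\<bar>\<integral>x. g x \<bullet> Z x \<partial>M\<bar> \<le> d powr ?q * energy M ?q g + d powr (- p) * energy M p Z" .
qed

lemma pairing_integrable:
  assumes "g \<in> Lspace M (p / (p - 1))" "Z \<in> Lspace M p"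
  shows "integrable M (\<lambda>x. g x \<bullet> Z x)"
  using pairing_bound(1)[OF assms, of 1] by simp

lemma pairing_tendsto:
  assumes g: "g \<in> Lspace M (p / (p - 1))" and Z: "\<And>n. Z n \<in> Lspace M p" and Y: "Y \<in> Lspace M p"
    and lim: "(\<lambda>n. energy M p (\<lambda>x. Z n x - Y x)) \<longlonglongrightarrow> 0"
  shows "(\<lambda>n. \<integral>x. g x \<bullet> Z n x \<partial>M) \<longlonglongrightarrow> (\<integral>x. g x \<bullet> Y x \<partial>M)"
proof (rule LIMSEQ_I)
  fix e :: real assume e: "e > 0"
  let ?q = "p / (p - 1)"
  define E where "E = energy M ?q g"
  have E: "0 \<le> E" by (simp add: E_def energy_nonneg)
  \<comment> \<open>The term with \<open>g\<close> becomes e E / (2 (E + 1)), which is below e / 2;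
    for this fixed \<open>d\<close> the other term tends to 0.\<close>
  define d where "d = (e / (2 * (E + 1))) powr (1 / ?q)"
  have d: "d > 0" using e E by (simp add: d_def)
  have dq: "d powr ?q = e / (2 * (E + 1))" using p e E by (simp add: d_def powr_powr)
  have "e * E < e * (E + 1)" using e by simp
  then have dE: "d powr ?q * E < e / 2"
    unfolding dq using E by (simp add: field_simps)
  have "(\<lambda>n. d powr (- p) * energy M p (\<lambda>x. Z n x - Y x)) \<longlonglongrightarrow> d powr (- p) * 0"
    by (intro tendsto_intros lim)
  then have "eventually (\<lambda>n. d powr (- p) * energy M p (\<lambda>x. Z n x - Y x) < e / 2) sequentially"
    using e by (intro order_tendstoD(2)) auto
  then obtain N where N: "\<And>n. n \<ge> N \<Longrightarrow> d powr (- p) * energy M p (\<lambda>x. Z n x - Y x) < e / 2"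
    by (auto simp: eventually_sequentially)
  show "\<exists>N. \<forall>n\<ge>N. norm ((\<integral>x. g x \<bullet> Z n x \<partial>M) - (\<integral>x. g x \<bullet> Y x \<partial>M)) < e"
  proof (intro exI allI impI)
    fix n assume "n \<ge> N"
    have "(\<integral>x. g x \<bullet> Z n x \<partial>M) - (\<integral>x. g x \<bullet> Y x \<partial>M) = (\<integral>x. g x \<bullet> (Z n x - Y x) \<partial>M)"
      using pairing_integrable[OF g Z] pairing_integrable[OF g Y] by (simp add: inner_diff_right)
    then show "norm ((\<integral>x. g x \<bullet> Z n x \<partial>M) - (\<integral>x. g x \<bullet> Y x \<partial>M)) < e"
      using pairing_bound(2)[OF g Lspace_diff(1)[OF Z Y p_nonneg] d, of n] N[OF \<open>n \<ge> N\<close>] dE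
      by (simp add: E_def)
  qed
qed

end

section \<open>Monotone operators and variational inequalities\<close>

context finite_Lp
begin

text \<open>This replaces weak compactness of bounded sets in the reflexive space $L^p$: elements of
  nearly minimal energy in larger and larger finite intersections form a Cauchy sequence, by
  uniform convexity.\<close>

theorem finite_intersection_property:
  fixes K :: "('a \<Rightarrow> 'e::euclidean_space) set" and H :: "'i \<Rightarrow> ('a \<Rightarrow> 'e) set"
  assumes K: "K \<subseteq> Lspace M p"
    and midK: "\<And>X Y. X \<in> K \<Longrightarrow> Y \<in> K \<Longrightarrow> (\<lambda>x. (1/2) *\<^sub>R (X x + Y x)) \<in> K"
    and bd: "\<And>X. X \<in> K \<Longrightarrow> energy M p X \<le> R"
    and midH: "\<And>i X Y. i \<in> I \<Longrightarrow> X \<in> H i \<Longrightarrow> Y \<in> H i \<Longrightarrow> (\<lambda>x. (1/2) *\<^sub>R (X x + Y x)) \<in> H i"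
    and ne: "\<And>F. finite F \<Longrightarrow> F \<subseteq> I \<Longrightarrow> \<exists>X\<in>K. \<forall>i\<in>F. X \<in> H i"
  obtains U where "U \<in> Lspace M p"
    "\<And>i. i \<in> I \<Longrightarrow> \<exists>Y. (\<forall>n::nat. Y n \<in> K \<inter> H i) \<and> (\<lambda>n. energy M p (\<lambda>x. Y n x - U x)) \<longlonglongrightarrow> 0"
proof -
  define E where "E = (energy M p :: ('a \<Rightarrow> 'e) \<Rightarrow> real)"
  define C where "C = (\<lambda>F. {X \<in> K. \<forall>i\<in>F. X \<in> H i})"
  define mm where "mm = (\<lambda>F. Inf (E ` C F))"
  define Fs where "Fs = {F. finite F \<and> F \<subseteq> I}"
  \<comment> \<open>The infimum of the energy grows with the finite set of constraints.
    Near-minimizers are sought for sets whose infimum is close to the supremum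
    \<open>m\<close>.\<close>
  define m where "m = Sup (mm ` Fs)"
  have CK: "C F \<subseteq> K" for F by (auto simp: C_def)
  have Cne: "C F \<noteq> {}" if "F \<in> Fs" for F using ne[of F] that by (auto simp: C_def Fs_def)
  have bb: "bdd_below (E ` X)" for X by (intro bdd_belowI[of _ 0]) (auto simp: E_def energy_nonneg)
  have mmle: "mm F \<le> E X" if "X \<in> C F" for X F
    unfolding mm_def using that bb by (intro cInf_lower) auto
  have mmR: "mm F \<le> R" if F: "F \<in> Fs" for F
  proof -
    obtain X where "X \<in> C F" using Cne[OF F] by blast
    then show ?thesis using mmle[of X F] bd[of X] CK[of F] by (force simp: E_def)
  qed
  have ba: "bdd_above (mm ` Fs)" using mmR by (intro bdd_aboveI[of _ R]) auto
  have mm_m: "mm F \<le> m" if "F \<in> Fs" for F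
    unfolding m_def using that ba by (intro cSup_upper) auto
  have mmono: "mm F \<le> mm F'" if "F \<subseteq> F'" "F' \<in> Fs" for F F'
    unfolding mm_def using that Cne[of F'] bb
    by (intro cInf_superset_mono) (auto simp: C_def)
  define e where "e = (\<lambda>n. 1 / real (Suc n))"
  have e: "e n > 0" for n by (simp add: e_def)
  have emono: "e k \<le> e n" if "n \<le> k" for n k using that by (simp add: e_def field_simps)
  have elim: "e \<longlonglongrightarrow> 0" unfolding e_def by (rule one_over_Suc_tendsto_0)
  have "{} \<in> Fs" by (simp add: Fs_def)
  then have "\<exists>F\<in>Fs. m - e n < mm F" for n
    using less_cSup_iff[of "mm ` Fs" "m - e n"] ba e[of n] by (auto simp: m_def)
  then obtain Fn where Fn: "\<And>n. Fn n \<in> Fs" "\<And>n. m - e n < mm (Fn n)" by metis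
  \<comment> \<open>Unions turn the sets \<open>Fn k\<close> into an increasing chain along which
    the minimal energies still exceed \<open>m - e n\<close>.\<close>
  define G where "G = (\<lambda>n::nat. \<Union>k\<le>n. Fn k)"
  have G: "G n \<in> Fs" for n using Fn(1) by (auto simp: G_def Fs_def)
  have Gmono: "G n \<subseteq> G k" if "n \<le> k" for n k using that unfolding G_def by (intro UN_mono) auto
  have Gm: "m - e n < mm (G n)" for n
    using Fn(2)[of n] mmono[OF _ G, of "Fn n" n] by (force simp: G_def)
  have ex: "\<exists>X\<in>C F. E X < m + e n" if F: "F \<in> Fs" for F n
  proof -
    have "Inf (E ` C F) < m + e n" using mm_m[OF F] e[of n] by (simp add: mm_def)
    then show ?thesis using cInf_lessD[of "E ` C F"] Cne[OF F] by auto
  qed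
  have close: "\<exists>N. \<forall>n\<ge>N. \<forall>X\<in>C (G n). \<forall>Y\<in>C (G n). E X < m + e n \<longrightarrow> E Y < m + e n \<longrightarrow>
      energy M p (\<lambda>x. X x - Y x) < d" if d: "d > 0" for d
  proof -
    \<comment> \<open>The part of the uniform convexity estimate carried by the two energies, each
      at most \<open>R\<close>, then costs at most d / 2.\<close>
    define d' where "d' = d / (4 * (\<bar>R\<bar> + 1))"
    have d': "d' > 0" using d by (simp add: d'_def)
    obtain B where B: "0 \<le> B" "\<And>a b::'e. norm (a - b) powr p
       \<le> d' * (norm a powr p + norm b powr p) + B * convexity_defect p a b"
      using uniform_convexity[OF p d'] by blast
    have "(\<lambda>n. 2 * B * e n) \<longlonglongrightarrow> 2 * B * 0" by (intro tendsto_intros elim)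
    then have "eventually (\<lambda>n. 2 * B * e n < d / 2) sequentially"
      using d by (intro order_tendstoD(2)) auto
    then obtain N where N: "\<And>n. n \<ge> N \<Longrightarrow> 2 * B * e n < d / 2" by (auto simp: eventually_sequentially)
    show ?thesis
    proof (intro exI allI impI ballI)
      fix n X Y assume n: "N \<le> n" and X: "X \<in> C (G n)" and Y: "Y \<in> C (G n)"
        and EX: "E X < m + e n" and EY: "E Y < m + e n"
      let ?Z = "\<lambda>x. (1/2) *\<^sub>R (X x + Y x)"
      have XK: "X \<in> K" "Y \<in> K" using X Y by (auto simp: C_def)
      then have XL: "X \<in> Lspace M p" "Y \<in> Lspace M p" using K by auto
      have Z: "?Z \<in> C (G n)" using X Y midK midH G[of n] by (auto simp: C_def Fs_def subset_iff)
      then have ZL: "?Z \<in> Lspace M p" using CK K by auto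
      note ints = Lspace_integrable[OF XL(1)] Lspace_integrable[OF XL(2)] Lspace_integrable[OF ZL]
        Lspace_integrable[OF Lspace_diff(1)[OF XL p_nonneg]]
      have idef: "integrable M (\<lambda>x. convexity_defect p (X x) (Y x))"
        unfolding convexity_defect_def using ints by auto
      let ?D = "\<integral>x. convexity_defect p (X x) (Y x) \<partial>M"
      have "energy M p (\<lambda>x. X x - Y x) \<le> (\<integral>x. d' * (norm (X x) powr p + norm (Y x) powr p)
          + B * convexity_defect p (X x) (Y x) \<partial>M)"
        unfolding energy_def using ints idef by (intro integral_mono B) auto
      also have "\<dots> = d' * (E X + E Y) + B * ?D"
        using ints idef by (simp add: E_def energy_def)
      finally have "energy M p (\<lambda>x. X x - Y x) \<le> d' * (E X + E Y) + B * ?D" .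
      \<comment> \<open>Both endpoints have energy below \<open>m + e n\<close>; their midpoint
        satisfies the same constraints, so its energy exceeds \<open>m - e n\<close>.\<close>
      moreover have "?D \<le> 2 * e n"
      proof -
        define z where "z = E ?Z"
        have "mm (G n) \<le> z" unfolding z_def by (rule mmle[OF Z])
        moreover have "?D = (E X + E Y) / 2 - z"
          using ints by (simp add: convexity_defect_def E_def energy_def z_def)
        ultimately show ?thesis using EX EY Gm[of n] by argo
      qed
      then have "B * ?D \<le> B * (2 * e n)" using B(1) by (rule mult_left_mono)
      moreover have "d' * (E X + E Y) \<le> d' * (2 * (\<bar>R\<bar> + 1))"
        using bd[OF XK(1)] bd[OF XK(2)] d' by (intro mult_left_mono) (auto simp: E_def)
      moreover have "d' * (2 * (\<bar>R\<bar> + 1)) = d / 2" by (simp add: d'_def field_simps)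
      moreover have "B * (2 * e n) < d / 2" using N[OF n] by (simp add: mult_ac)
      ultimately show "energy M p (\<lambda>x. X x - Y x) < d" by linarith
    qed
  qed
  obtain x where x: "\<And>n. x n \<in> C (G n)" "\<And>n. E (x n) < m + e n"
  proof -
    have "\<forall>n. \<exists>X. X \<in> C (G n) \<and> E X < m + e n" using ex[OF G] by blast
    then show ?thesis using that by metis
  qed
  have xL: "x n \<in> Lspace M p" for n using x(1) CK K by blast
  have Cmono: "C F' \<subseteq> C F" if "F \<subseteq> F'" for F F' using that by (auto simp: C_def)
  obtain U where U: "U \<in> Lspace M p" "(\<lambda>n. energy M p (\<lambda>z. x n z - U z)) \<longlonglongrightarrow> 0"
  proof (rule Lspace_complete[of x, OF xL])
    fix d :: real assume "d > 0"
    then obtain N where N: "\<forall>n\<ge>N. \<forall>X\<in>C (G n). \<forall>Y\<in>C (G n). E X < m + e n \<longrightarrow> E Y < m + e n \<longrightarrow>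
      energy M p (\<lambda>x. X x - Y x) < d" using close by blast
    have "x k \<in> C (G N) \<and> E (x k) < m + e N" if "k \<ge> N" for k
      using x(1)[of k] x(2)[of k] Cmono[OF Gmono[OF that]] emono[OF that] by auto
    then show "\<exists>N. \<forall>m\<ge>N. \<forall>n\<ge>N. energy M p (\<lambda>z. x m z - x n z) < d"
      using N by (intro exI[of _ N]) auto
  qed auto
  show ?thesis
  proof (rule that[OF U(1)])
    fix i assume i: "i \<in> I"
    \<comment> \<open>Adding the single constraint \<open>i\<close> yields near-minimizers that
      still lie in \<open>C (G n)\<close>. By \<open>close\<close> they approach the sequence
      \<open>x\<close>, so the same limit \<open>U\<close> serves every \<open>i\<close>.\<close>
    have "insert i (G n) \<in> Fs" for n using G[of n] i by (auto simp: Fs_def)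
    then obtain y where y: "\<And>n. y n \<in> C (insert i (G n))" "\<And>n. E (y n) < m + e n"
    proof -
      assume Fs: "\<And>n. insert i (G n) \<in> Fs"
      have "\<forall>n. \<exists>X. X \<in> C (insert i (G n)) \<and> E X < m + e n" using ex[OF Fs] by blast
      then show ?thesis using that by metis
    qed
    have yL: "y n \<in> Lspace M p" for n using y(1) CK K by blast
    have "(\<lambda>n. energy M p (\<lambda>z. y n z - x n z)) \<longlonglongrightarrow> 0"
    proof (rule LIMSEQ_I)
      fix d :: real assume "d > 0"
      then obtain N where N: "\<forall>n\<ge>N. \<forall>X\<in>C (G n). \<forall>Y\<in>C (G n). E X < m + e n \<longrightarrow> E Y < m + e n \<longrightarrow>
        energy M p (\<lambda>x. X x - Y x) < d" using close by blast
      have "y n \<in> C (G n)" for n using y(1) Cmono[of "G n" "insert i (G n)"] by auto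
      then show "\<exists>N. \<forall>n\<ge>N. norm (energy M p (\<lambda>z. y n z - x n z) - 0) < d"
        using N x y by (intro exI[of _ N]) (auto simp: energy_nonneg)
    qed
    then have "(\<lambda>n. energy M p (\<lambda>z. y n z - x n z) + energy M p (\<lambda>z. x n z - U z)) \<longlonglongrightarrow> 0 + 0"
      by (intro tendsto_add U)
    then have "(\<lambda>n. energy M p (\<lambda>z. y n z - U z)) \<longlonglongrightarrow> 0"
      by (intro energy_tendsto_0_le[OF energy_triangle[OF yL xL U(1) p_nonneg]]) (auto simp: energy_nonneg)
    moreover have "y n \<in> K \<inter> H i" for n using y(1)[of n] by (auto simp: C_def)
    ultimately show "\<exists>Y. (\<forall>n::nat. Y n \<in> K \<inter> H i) \<and> (\<lambda>n. energy M p (\<lambda>x. Y n x - U x)) \<longlonglongrightarrow> 0"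
      by blast
  qed
qed

end

text \<open>Dyadic convex combinations suffice: each property needed of them (membership in a convex
  set, linear inequalities, energy bounds) is proved by induction from its midpoint case.\<close>

inductive_set midpoint_hull :: "('a \<Rightarrow> 'e::real_vector) set \<Rightarrow> ('a \<Rightarrow> 'e) set" for S where
  base: "X \<in> S \<Longrightarrow> X \<in> midpoint_hull S"
| mid: "X \<in> midpoint_hull S \<Longrightarrow> Y \<in> midpoint_hull S \<Longrightarrow> (\<lambda>x. (1/2) *\<^sub>R (X x + Y x)) \<in> midpoint_hull S"

context finite_Lp
begin

lemma energy_midpoint_le:
  assumes "X \<in> Lspace M p" "Y \<in> Lspace M p"
  shows "(\<lambda>x. (1/2) *\<^sub>R (X x + Y x)) \<in> Lspace M p"
    and "energy M p (\<lambda>x. (1/2) *\<^sub>R (X x + Y x)) \<le> (energy M p X + energy M p Y) / 2"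
proof -
  show Z: "(\<lambda>x. (1/2) *\<^sub>R (X x + Y x)) \<in> Lspace M p"
    by (intro Lspace_scaleR(1) Lspace_add(1) assms p_nonneg)
  have "energy M p (\<lambda>x. (1/2) *\<^sub>R (X x + Y x)) \<le> (\<integral>x. (norm (X x) powr p + norm (Y x) powr p) / 2 \<partial>M)"
    unfolding energy_def
    using Lspace_integrable[OF Z] Lspace_integrable[OF assms(1)] Lspace_integrable[OF assms(2)]
      convexity_defect_nonneg[OF p]
    by (intro integral_mono) (auto simp: convexity_defect_def)
  also have "\<dots> = (energy M p X + energy M p Y) / 2"
    using Lspace_integrable[OF assms(1)] Lspace_integrable[OF assms(2)] by (simp add: energy_def)
  finally show "energy M p (\<lambda>x. (1/2) *\<^sub>R (X x + Y x)) \<le> (energy M p X + energy M p Y) / 2" .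
qed

text \<open>A substitute for a weakly convergent subsequence in the spirit of Mazur's lemma: one and
  the same \<open>U\<close> is a strong limit of combinations of every tail. The hulls of finitely
  many tails always share a term of the sequence.\<close>

theorem bounded_sequence_midpoint_limit:
  fixes X :: "nat \<Rightarrow> 'a \<Rightarrow> 'e::euclidean_space"
  assumes X: "\<And>n. X n \<in> Lspace M p" and bd: "\<And>n. energy M p (X n) \<le> R"
  obtains U where "U \<in> Lspace M p"
    "\<And>n. \<exists>Y. (\<forall>k::nat. Y k \<in> midpoint_hull (X ` {n..})) \<and> (\<lambda>k. energy M p (\<lambda>x. Y k x - U x)) \<longlonglongrightarrow> 0"
proof -
  let ?H = "\<lambda>n. midpoint_hull (X ` {n..})"
  have hull: "Z \<in> Lspace M p \<and> energy M p Z \<le> R" if "Z \<in> ?H 0" for Z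
    using that
  proof induction
    case (mid Y Z) then show ?case using energy_midpoint_le[of Y Z] by auto
  qed (use X bd in auto)
  have fin: "\<exists>Z\<in>?H 0. \<forall>n\<in>F. Z \<in> ?H n" if "finite F" for F :: "nat set"
  proof (intro bexI ballI)
    let ?k = "Max (insert 0 F)"
    show "X ?k \<in> ?H 0" by (auto intro: midpoint_hull.base)
    show "X ?k \<in> ?H n" if "n \<in> F" for n
      using that \<open>finite F\<close> by (auto intro!: midpoint_hull.base)
  qed
  obtain U where "U \<in> Lspace M p" and
    "\<And>n. n \<in> UNIV \<Longrightarrow> \<exists>Y. (\<forall>k::nat. Y k \<in> ?H 0 \<inter> ?H n) \<and> (\<lambda>k. energy M p (\<lambda>x. Y k x - U x)) \<longlonglongrightarrow> 0"
    by (rule finite_intersection_property[of "?H 0" R UNIV ?H])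
      (use hull fin in \<open>auto intro: midpoint_hull.mid\<close>)
  then show ?thesis by (intro that[of U]) blast+
qed

end

text \<open>Iterating $\lambda \mapsto (1-\tau)\lambda + \tau c / \sum c$ with \<open>c\<close> the vector of
  violations and $\tau = 1/(k+1)$ keeps the sum of squared violations below \<open>B / k\<close>; this gives
  an approximate optimal strategy of a symmetric zero-sum game without any fixed point theorem.\<close>

lemma approximate_symmetric_game:
  fixes m :: "'i \<Rightarrow> 'i \<Rightarrow> real"
  assumes S: "finite S" "S \<noteq> {}"
    and m: "\<And>i j. i \<in> S \<Longrightarrow> j \<in> S \<Longrightarrow> 0 \<le> m i j + m j i"
    and e: "0 < e"
  obtains l where "\<And>j. j \<in> S \<Longrightarrow> 0 \<le> l j" "sum l S = 1"
    "\<And>i. i \<in> S \<Longrightarrow> - e \<le> (\<Sum>j\<in>S. l j * m i j)"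
proof -
  define b where "b = (\<Sum>i\<in>S. \<Sum>j\<in>S. \<bar>m i j\<bar>)"
  have b: "\<bar>m i j\<bar> \<le> b" if "i \<in> S" "j \<in> S" for i j
  proof -
    have "\<bar>m i j\<bar> \<le> (\<Sum>j\<in>S. \<bar>m i j\<bar>)" using S that by (intro member_le_sum) auto
    also have "\<dots> \<le> b" unfolding b_def
      using S that by (intro member_le_sum) (auto intro: sum_nonneg)
    finally show ?thesis .
  qed
  \<comment> \<open>\<open>B\<close> bounds the sum of squared violations of any strategy; it starts
    the induction and controls the quadratic remainder of each step.\<close>
  define B where "B = real (card S) * b\<^sup>2"
  define c where "c = (\<lambda>l i. max 0 (- (\<Sum>j\<in>S. l j * m i j)))"
  define \<Phi> where "\<Phi> = (\<lambda>l. \<Sum>i\<in>S. (c l i)\<^sup>2)"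
  have avg: "(\<Sum>j\<in>S. l j * m i j)\<^sup>2 \<le> b\<^sup>2" if "i \<in> S" "\<forall>j\<in>S. 0 \<le> l j" "sum l S = 1" for l i
  proof -
    have "\<bar>\<Sum>j\<in>S. l j * m i j\<bar> \<le> (\<Sum>j\<in>S. l j * b)"
      using that b by (intro order_trans[OF sum_abs] sum_mono) (auto simp: abs_mult intro!: mult_left_mono)
    also have "\<dots> = b" using that by (simp flip: sum_distrib_right)
    finally show ?thesis by (intro abs_le_square_iff[THEN iffD1]) auto
  qed
  have step: "\<exists>l. (\<forall>j\<in>S. 0 \<le> l j) \<and> sum l S = 1 \<and> \<Phi> l \<le> B / real (Suc k)" for k
  proof (induction k)
    case 0
    obtain s where s: "s \<in> S" using S by blast
    define l where "l = (\<lambda>j. if j = s then 1 else 0 :: real)"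
    have l: "\<forall>j\<in>S. 0 \<le> l j" "sum l S = 1" using S s by (auto simp: l_def)
    have "\<Phi> l \<le> (\<Sum>i\<in>S. b\<^sup>2)" unfolding \<Phi>_def
    proof (intro sum_mono)
      fix i assume "i \<in> S"
      have "(c l i)\<^sup>2 \<le> (\<Sum>j\<in>S. l j * m i j)\<^sup>2" by (simp add: c_def max_def)
      then show "(c l i)\<^sup>2 \<le> b\<^sup>2" using avg[OF \<open>i \<in> S\<close> l] by linarith
    qed
    then show ?case using l by (intro exI[of _ l]) (auto simp: B_def)
  next
    case (Suc k)
    then obtain l where l: "\<forall>j\<in>S. 0 \<le> l j" "sum l S = 1" "\<Phi> l \<le> B / real (Suc k)" by blast
    define s where "s = (\<Sum>i\<in>S. c l i)"
    have c0: "0 \<le> c l i" for i by (simp add: c_def)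
    show ?case
    proof (cases "s = 0")
      case True
      then have "\<forall>i\<in>S. c l i = 0" using c0 S by (simp add: s_def sum_nonneg_eq_0_iff)
      then have "\<Phi> l = 0" by (simp add: \<Phi>_def)
      moreover have "0 \<le> B" by (simp add: B_def)
      ultimately show ?thesis using l by (intro exI[of _ l]) simp
    next
      case False
      then have s: "s > 0" using c0 by (metis s_def sum_nonneg less_eq_real_def)
      \<comment> \<open>This weight solves the recursion exactly: (1 - t)^2 / (k + 1) + t^2 = 1 / (k
        + 2).\<close>
      define t where "t = 1 / real (Suc (Suc k))"
      have t: "0 < t" "t \<le> 1" by (auto simp: t_def)
      define q where "q = (\<lambda>j. c l j / s)"
      have q: "\<forall>j\<in>S. 0 \<le> q j" "sum q S = 1"
        using s c0 by (auto simp: q_def s_def simp flip: sum_divide_distrib)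
      define l' where "l' = (\<lambda>j. (1 - t) * l j + t * q j)"
      define d where "d = (\<lambda>i. \<Sum>j\<in>S. q j * m i j)"
      have l': "\<forall>j\<in>S. 0 \<le> l' j" "sum l' S = 1"
        using l q t by (auto simp: l'_def sum.distrib simp flip: sum_distrib_left)
      have "(c l' i)\<^sup>2 \<le> ((1 - t) * c l i - t * d i)\<^sup>2" for i
      proof -
        have "(\<Sum>j\<in>S. l' j * m i j) = (\<Sum>j\<in>S. (1 - t) * (l j * m i j) + t * (q j * m i j))"
          by (intro sum.cong) (auto simp: l'_def algebra_simps)
        then have "(\<Sum>j\<in>S. l' j * m i j) = (1 - t) * (\<Sum>j\<in>S. l j * m i j) + t * d i"
          by (simp only: sum.distrib d_def sum_distrib_left)
        moreover have "(1 - t) * (- (\<Sum>j\<in>S. l j * m i j)) \<le> (1 - t) * c l i"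
          using t by (intro mult_left_mono) (auto simp: c_def)
        ultimately have "c l' i \<le> max 0 ((1 - t) * c l i - t * d i)"
          by (simp add: c_def algebra_simps del: max.absorb1 max.absorb2 max.absorb3 max.absorb4)
        then have "\<bar>c l' i\<bar> \<le> \<bar>(1 - t) * c l i - t * d i\<bar>" using c_def by auto
        then show ?thesis by (simp only: abs_le_square_iff)
      qed
      then have "\<Phi> l' \<le> (\<Sum>i\<in>S. ((1 - t) * c l i - t * d i)\<^sup>2)"
        unfolding \<Phi>_def by (intro sum_mono) auto
      also have "\<dots> = (1 - t)\<^sup>2 * \<Phi> l - 2 * (1 - t) * t * (\<Sum>i\<in>S. c l i * d i) + t\<^sup>2 * (\<Sum>i\<in>S. (d i)\<^sup>2)"
        unfolding \<Phi>_def sum_distrib_left sum_subtractf[symmetric] sum.distrib[symmetric]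
        by (intro sum.cong) (auto simp: power2_eq_square algebra_simps)
      also have "\<dots> \<le> (1 - t)\<^sup>2 * (B / real (Suc k)) - 0 + t\<^sup>2 * B"
      proof (intro add_mono diff_mono mult_left_mono l)
        \<comment> \<open>Since \<open>q\<close> is proportional to the violations, the cross term
          is a positive multiple of the quadratic form of \<open>m\<close> at \<open>q\<close>. Only
          the symmetric part of \<open>m\<close> contributes, and it is nonnegative by
          assumption.\<close>
        have "(\<Sum>i\<in>S. c l i * d i) = s * (\<Sum>i\<in>S. \<Sum>j\<in>S. q i * q j * m i j)"
          unfolding d_def sum_distrib_left
          using s by (intro sum.cong) (auto simp: q_def)
        moreover have "(\<Sum>i\<in>S. \<Sum>j\<in>S. q i * q j * m i j) = (\<Sum>i\<in>S. \<Sum>j\<in>S. q i * q j * m j i)"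
          by (subst sum.swap) (simp add: mult.commute)
        then have "2 * (\<Sum>i\<in>S. \<Sum>j\<in>S. q i * q j * m i j) = (\<Sum>i\<in>S. \<Sum>j\<in>S. q i * q j * (m i j + m j i))"
          by (simp add: distrib_left sum.distrib)
        moreover have "\<dots> \<ge> 0" using q m by (intro sum_nonneg mult_nonneg_nonneg) auto
        ultimately show "0 \<le> 2 * (1 - t) * t * (\<Sum>i\<in>S. c l i * d i)" using s t by simp
        have "(\<Sum>i\<in>S. (d i)\<^sup>2) \<le> (\<Sum>i\<in>S. b\<^sup>2)"
          using q unfolding d_def by (intro sum_mono avg) auto
        then show "(\<Sum>i\<in>S. (d i)\<^sup>2) \<le> B" by (simp add: B_def)
      qed auto
      also have "\<dots> = B / real (Suc (Suc k))"
      proof -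
        define r where "r = real (Suc k)"
        have r: "r > 0" "t = 1 / (r + 1)" by (auto simp: r_def t_def add_ac)
        then have "1 - t = r * t" by (simp add: field_simps)
        then have "(1 - t)\<^sup>2 = r\<^sup>2 * t\<^sup>2" by (simp only: power_mult_distrib)
        then have "(1 - t)\<^sup>2 * (B / r) - 0 + t\<^sup>2 * B = t * B * (t * (r + 1))"
          using r(1) by (simp add: power2_eq_square algebra_simps)
        also have "t * (r + 1) = 1" using r by simp
        finally have "(1 - t)\<^sup>2 * (B / real (Suc k)) - 0 + t\<^sup>2 * B = B * t" by (simp only: r_def) simp
        then show ?thesis by (simp add: t_def)
      qed
      finally show ?thesis using l' by blast
    qed
  qed
  obtain k where k: "B / e\<^sup>2 < real k" using reals_Archimedean2 by blast
  obtain l where l: "\<forall>j\<in>S. 0 \<le> l j" "sum l S = 1" "\<Phi> l \<le> B / real (Suc k)" using step by blast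
  have "B < real k * e\<^sup>2" using k e by (simp add: pos_divide_less_eq)
  also have "\<dots> \<le> real (Suc k) * e\<^sup>2" by (intro mult_right_mono) auto
  finally have "B / real (Suc k) < e\<^sup>2" by (simp add: pos_divide_less_eq mult.commute del: of_nat_Suc)
  then have \<Phi>: "\<Phi> l < e\<^sup>2" using l(3) by linarith
  show ?thesis
  proof (rule that[of l])
    fix i assume i: "i \<in> S"
    have "(c l i)\<^sup>2 \<le> \<Phi> l" unfolding \<Phi>_def using i S by (intro member_le_sum) auto
    then have "(c l i)\<^sup>2 < e\<^sup>2" using \<Phi> by linarith
    then have "c l i < e" by (rule power2_less_imp_less) (use e in simp)
    then show "- e \<le> (\<Sum>j\<in>S. l j * m i j)" by (simp add: c_def)
  qed (use l in auto)
qed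

lemma convex_combination_mem:
  fixes K :: "('a \<Rightarrow> 'e::real_vector) set"
  assumes conv: "\<And>X Y t. X \<in> K \<Longrightarrow> Y \<in> K \<Longrightarrow> 0 \<le> t \<Longrightarrow> t \<le> 1 \<Longrightarrow> (\<lambda>x. (1 - t) *\<^sub>R X x + t *\<^sub>R Y x) \<in> K"
    and S: "finite S" "S \<noteq> {}"
    and W: "\<And>i. i \<in> S \<Longrightarrow> W i \<in> K" and l: "\<And>i. i \<in> S \<Longrightarrow> 0 \<le> l i" "sum l S = (1::real)"
  shows "(\<lambda>x. \<Sum>i\<in>S. l i *\<^sub>R W i x) \<in> K"
  using S W l
proof (induction S arbitrary: l rule: finite_ne_induct)
  case (singleton i) then show ?case by simp
next
  case (insert i F)
  define s where "s = sum l F"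
  have li: "l i = 1 - s" using insert by (simp add: s_def)
  have s: "0 \<le> s" "s \<le> 1" using insert.prems(2)[of i] insert.prems(2) li by (auto simp: s_def intro: sum_nonneg)
  show ?case
  proof (cases "s = 0")
    case True
    then have "\<forall>j\<in>F. l j = 0"
      using insert.prems insert.hyps by (simp add: s_def sum_nonneg_eq_0_iff)
    then have "(\<lambda>x. \<Sum>j\<in>insert i F. l j *\<^sub>R W j x) = W i"
      using insert.hyps li True by simp
    then show ?thesis using insert.prems by simp
  next
    case False
    have "(\<lambda>x. \<Sum>j\<in>F. (l j / s) *\<^sub>R W j x) \<in> K"
      using insert.prems False s by (intro insert.IH) (auto simp: s_def simp flip: sum_divide_distrib)
    then have "(\<lambda>x. (1 - s) *\<^sub>R W i x + s *\<^sub>R (\<Sum>j\<in>F. (l j / s) *\<^sub>R W j x)) \<in> K"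
      using insert.prems s by (intro conv) auto
    moreover have "s *\<^sub>R (\<Sum>j\<in>F. (l j / s) *\<^sub>R W j x) = (\<Sum>j\<in>F. l j *\<^sub>R W j x)" for x
      using False by (simp add: scaleR_sum_right)
    ultimately show ?thesis using insert.hyps li by simp
  qed
qed

text \<open>The conditions are imposed at every point; exceptional null sets are repaired before the
  locale is instantiated. The growth bound contains 1 + norm z, not norm z alone, to admit a bounded
  zeroth-order term.\<close>

locale monotone_operator = finite_Lp M p for M :: "'a measure" and p +
  fixes T :: "'a \<Rightarrow> 'e::euclidean_space \<Rightarrow> 'e" and c :: real
  assumes T_measurable: "\<And>Z. Z \<in> borel_measurable M \<Longrightarrow> (\<lambda>x. T x (Z x)) \<in> borel_measurable M"
    and T_continuous: "\<And>x. continuous_on UNIV (T x)"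
    and T_growth: "\<And>x z. norm (T x z) \<le> c * (1 + norm z) powr (p - 1)"
    and T_monotone: "\<And>x y z. 0 \<le> (T x y - T x z) \<bullet> (y - z)"
begin

lemma c_nonneg: "0 \<le> c"
proof -
  have "0 \<le> norm (T undefined 0)" by simp
  also have "\<dots> \<le> c" using T_growth[of undefined 0] by simp
  finally show ?thesis .
qed

lemma T_Lspace:
  assumes Z: "Z \<in> Lspace M p"
  shows "(\<lambda>x. T x (Z x)) \<in> Lspace M (p / (p - 1))"
proof -
  let ?q = "p / (p - 1)"
  have m: "(\<lambda>x. T x (Z x)) \<in> borel_measurable M"
    by (intro T_measurable Lspace_measurable[OF Z])
  have "(\<lambda>x. 1 + norm (Z x)) \<in> Lspace M p"
    by (intro Lspace_add(1) Lspace_const p_nonneg Lspace_norm Z)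
  then have i: "integrable M (\<lambda>x. c powr ?q * (1 + norm (Z x)) powr p)"
    using Lspace_integrable by fastforce
  have "norm (T x (Z x)) powr ?q \<le> c powr ?q * (1 + norm (Z x)) powr p" for x
  proof -
    have "norm (T x (Z x)) powr ?q \<le> (c * (1 + norm (Z x)) powr (p - 1)) powr ?q"
      using p by (intro powr_mono2 T_growth) auto
    also have "\<dots> = c powr ?q * (1 + norm (Z x)) powr p"
      using c_nonneg p by (simp add: powr_mult powr_powr)
    finally show ?thesis .
  qed
  then have "integrable M (\<lambda>x. norm (T x (Z x)) powr ?q)"
    using m by (intro Bochner_Integration.integrable_bound[OF i]) auto
  then show ?thesis using m by (simp add: Lspace_def)
qed

lemma T_pairing_integrable:
  assumes "Z \<in> Lspace M p" "Y \<in> Lspace M p"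
  shows "integrable M (\<lambda>x. T x (Z x) \<bullet> Y x)"
  by (intro pairing_integrable T_Lspace assms)

text \<open>Continuity along segments is all that Minty's argument needs; with the parameters
  bounded by 1 the integrands have a common integrable majorant.\<close>

lemma T_hemicontinuous:
  assumes U: "U \<in> Lspace M p" and V: "V \<in> Lspace M p"
    and t: "t \<longlonglongrightarrow> 0" "\<And>n. \<bar>t n\<bar> \<le> 1"
  shows "(\<lambda>n. \<integral>x. T x (U x + t n *\<^sub>R V x) \<bullet> V x \<partial>M) \<longlonglongrightarrow> (\<integral>x. T x (U x) \<bullet> V x \<partial>M)"
proof (rule integral_dominated_convergence)
  note [measurable] = Lspace_measurable[OF U] Lspace_measurable[OF V]
  note [measurable (raw)] = T_measurable
  define h where "h = (\<lambda>x. 1 + (norm (U x) + norm (V x)))"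
  have "h \<in> Lspace M p" unfolding h_def
    by (intro Lspace_add(1) Lspace_const p_nonneg Lspace_norm U V)
  moreover have h0: "h x \<ge> 1" for x by (simp add: h_def)
  then have "norm (h x) = h x" for x by (smt (verit) real_norm_def)
  ultimately show "integrable M (\<lambda>x. c * h x powr p)"
    using Lspace_integrable[of h M p] by simp
  show "AE x in M. (\<lambda>n. T x (U x + t n *\<^sub>R V x) \<bullet> V x) \<longlonglongrightarrow> T x (U x) \<bullet> V x"
  proof (rule AE_I2)
    fix x
    have "(\<lambda>n. U x + t n *\<^sub>R V x) \<longlonglongrightarrow> U x + 0 *\<^sub>R V x" by (intro tendsto_intros t)
    then have "(\<lambda>n. T x (U x + t n *\<^sub>R V x)) \<longlonglongrightarrow> T x (U x)"
      using T_continuous[of x] by (intro continuous_on_tendsto_compose[OF T_continuous]) auto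
    then show "(\<lambda>n. T x (U x + t n *\<^sub>R V x) \<bullet> V x) \<longlonglongrightarrow> T x (U x) \<bullet> V x"
      by (intro tendsto_intros)
  qed
  show "AE x in M. norm (T x (U x + t n *\<^sub>R V x) \<bullet> V x) \<le> c * h x powr p" for n
  proof (rule AE_I2)
    fix x
    have "norm (t n *\<^sub>R V x) \<le> norm (V x)" using t(2)[of n] by (simp add: mult_left_le_one_le)
    then have le: "1 + norm (U x + t n *\<^sub>R V x) \<le> h x"
      using norm_triangle_ineq[of "U x" "t n *\<^sub>R V x"] by (simp add: h_def)
    have "norm (T x (U x + t n *\<^sub>R V x) \<bullet> V x) \<le> norm (T x (U x + t n *\<^sub>R V x)) * norm (V x)"
      by (simp add: Cauchy_Schwarz_ineq2)
    also have "\<dots> \<le> (c * (1 + norm (U x + t n *\<^sub>R V x)) powr (p - 1)) * h x"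
      using T_growth[of x] c_nonneg by (intro mult_mono) (auto simp: h_def)
    also have "\<dots> \<le> (c * h x powr (p - 1)) * h x"
      using le p c_nonneg h0[of x] by (intro mult_right_mono mult_left_mono powr_mono2) auto
    also have "\<dots> = c * (h x powr (p - 1) * h x powr 1)" using h0[of x] by simp
    also have "h x powr (p - 1) * h x powr 1 = h x powr p" by (simp only: powr_add[symmetric]) simp
    finally show "norm (T x (U x + t n *\<^sub>R V x) \<bullet> V x) \<le> c * h x powr p" .
  qed
qed (use Lspace_measurable[OF U] Lspace_measurable[OF V] in \<open>auto intro!: borel_measurable_inner T_measurable\<close>)

lemma T_monotone_integral:
  assumes "Y \<in> Lspace M p" "Z \<in> Lspace M p"
  shows "(\<integral>x. T x (Z x) \<bullet> (Y x - Z x) \<partial>M) \<le> (\<integral>x. T x (Y x) \<bullet> (Y x - Z x) \<partial>M)"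
proof (rule integral_mono)
  fix x show "T x (Z x) \<bullet> (Y x - Z x) \<le> T x (Y x) \<bullet> (Y x - Z x)"
    using T_monotone[of x "Y x" "Z x"] by (simp add: inner_diff_left)
qed (use assms in \<open>auto intro!: T_pairing_integrable Lspace_diff(1) p_nonneg\<close>)

text \<open>In Minty's form the unknown appears only linearly: one seeks \<open>U\<close> with
  \<open>P W U\<close> nonnegative for all \<open>W\<close>. For finitely many \<open>W\<close> an
  approximate optimal strategy of the game with payoff \<open>P\<close> works up to an error, and
  the finite intersection property supplies a common \<open>U\<close>.\<close>

theorem variational_inequality:
  assumes K: "K \<subseteq> Lspace M p" "K \<noteq> {}"
    and conv: "\<And>X Y t. X \<in> K \<Longrightarrow> Y \<in> K \<Longrightarrow> 0 \<le> t \<Longrightarrow> t \<le> 1 \<Longrightarrow> (\<lambda>x. (1 - t) *\<^sub>R X x + t *\<^sub>R Y x) \<in> K"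
    and bd: "\<And>X. X \<in> K \<Longrightarrow> energy M p X \<le> R"
    and closed: "\<And>Y U. (\<And>n::nat. Y n \<in> K) \<Longrightarrow> U \<in> Lspace M p \<Longrightarrow>
       (\<lambda>n. energy M p (\<lambda>x. Y n x - U x)) \<longlonglongrightarrow> 0 \<Longrightarrow> U \<in> K"
  obtains U where "U \<in> K" "\<And>W. W \<in> K \<Longrightarrow> 0 \<le> (\<integral>x. T x (U x) \<bullet> (W x - U x) \<partial>M)"
proof -
  define P where "P = (\<lambda>W Z. \<integral>x. T x (W x) \<bullet> (W x - Z x) \<partial>M)"
  \<comment> \<open>The game is solved only approximately, so each constraint carries a slack
    \<open>e\<close>; the slacks are removed after the limit.\<close>
  define I where "I = {(W, e). W \<in> K \<and> (e::real) > 0}"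
  define H where "H = (\<lambda>(W, e). {Z \<in> K. P W Z \<ge> - e})"
  have int: "integrable M (\<lambda>x. T x (W x) \<bullet> Z x)" if "W \<in> K" "Z \<in> K" for W Z
    using that K by (intro T_pairing_integrable) auto
  have P_alt: "P W Z = (\<integral>x. T x (W x) \<bullet> W x \<partial>M) - (\<integral>x. T x (W x) \<bullet> Z x \<partial>M)" if "W \<in> K" "Z \<in> K" for W Z
    unfolding P_def using int that by (simp add: inner_diff_right)
  have mid: "(\<lambda>x. (1/2) *\<^sub>R (X x + Y x)) \<in> K" if "X \<in> K" "Y \<in> K" for X Y
    using conv[OF that, of "1/2"] by (simp add: scaleR_add_right)
  have fin: "\<exists>X\<in>K. \<forall>i\<in>F. X \<in> H i" if F: "finite F" "F \<subseteq> I" for F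
  proof (cases "F = {}")
    case True then show ?thesis using K(2) by auto
  next
    case False
    define e where "e = Min (snd ` F)"
    have e: "e > 0" unfolding e_def using F False by (subst Min_gr_iff) (auto simp: I_def)
    have FK: "fst i \<in> K" if "i \<in> F" for i using that F by (auto simp: I_def)
    \<comment> \<open>Monotonicity of \<open>T\<close> is exactly the sign condition required of the
      game.\<close>
    have "0 \<le> P (fst i) (fst j) + P (fst j) (fst i)" if "i \<in> F" "j \<in> F" for i j
    proof -
      let ?X = "fst i" and ?Y = "fst j"
      have L: "?X \<in> Lspace M p" "?Y \<in> Lspace M p"
        using K(1) FK[OF that(1)] FK[OF that(2)] by (meson subsetD)+
      have "P ?Y ?X = - (\<integral>x. T x (?Y x) \<bullet> (?X x - ?Y x) \<partial>M)"
        unfolding P_def Bochner_Integration.integral_minus[symmetric]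
        by (intro Bochner_Integration.integral_cong) (auto simp: inner_diff_right)
      then show ?thesis using T_monotone_integral[OF L] by (simp add: P_def)
    qed
    then obtain l where l: "\<And>j. j \<in> F \<Longrightarrow> 0 \<le> l j" "sum l F = 1"
      "\<And>i. i \<in> F \<Longrightarrow> - e \<le> (\<Sum>j\<in>F. l j * P (fst i) (fst j))"
      using approximate_symmetric_game[OF F(1) False, of "\<lambda>i j. P (fst i) (fst j)" e] e by blast
    define Z where "Z = (\<lambda>x. \<Sum>j\<in>F. l j *\<^sub>R fst j x)"
    have ZK: "Z \<in> K" unfolding Z_def
      by (rule convex_combination_mem[OF conv F(1) False]) (use l FK in auto)
    have "Z \<in> H i" if i: "i \<in> F" for i
    proof -
      let ?W = "fst i"
      \<comment> \<open>\<open>P ?W\<close> is affine in its second argument and the weights sum to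
        1, so the payoff at the mixture is the average payoff.\<close>
      have "(\<integral>x. T x (?W x) \<bullet> Z x \<partial>M) = (\<integral>x. (\<Sum>j\<in>F. l j * (T x (?W x) \<bullet> fst j x)) \<partial>M)"
        unfolding Z_def by (intro Bochner_Integration.integral_cong) (auto simp: inner_sum_right)
      also have "\<dots> = (\<Sum>j\<in>F. l j * (\<integral>x. T x (?W x) \<bullet> fst j x \<partial>M))"
        using int[OF FK[OF i] FK] by (subst Bochner_Integration.integral_sum) auto
      finally have "P ?W Z = (\<Sum>j\<in>F. l j * P ?W (fst j))"
        using P_alt[OF FK[OF i] ZK] P_alt[OF FK[OF i] FK] l(2)
        by (simp add: right_diff_distrib sum_subtractf flip: sum_distrib_right)
      then have "- e \<le> P ?W Z" using l(3)[OF i] by simp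
      moreover have "e \<le> snd i" unfolding e_def using F i by auto
      ultimately show ?thesis using ZK by (auto simp: H_def split_beta)
    qed
    then show ?thesis using ZK by blast
  qed
  have midH: "(\<lambda>x. (1/2) *\<^sub>R (X x + Y x)) \<in> H i" if "i \<in> I" "X \<in> H i" "Y \<in> H i" for i X Y
  proof -
    obtain W e where i: "i = (W, e)" by (cases i)
    have K': "W \<in> K" "X \<in> K" "Y \<in> K" "P W X \<ge> - e" "P W Y \<ge> - e"
      using that by (auto simp: i I_def H_def)
    have "P W (\<lambda>x. (1/2) *\<^sub>R (X x + Y x)) = (P W X + P W Y) / 2"
      using P_alt[OF K'(1) mid[OF K'(2,3)]] P_alt[OF K'(1,2)] P_alt[OF K'(1,3)] int[OF K'(1,2)] int[OF K'(1,3)]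
      by (simp add: inner_add_right field_simps)
    then show ?thesis using K' mid by (simp add: i H_def)
  qed
  obtain U where U: "U \<in> Lspace M p" and
    lim: "\<And>i. i \<in> I \<Longrightarrow> \<exists>Y. (\<forall>n::nat. Y n \<in> K \<inter> H i) \<and> (\<lambda>n. energy M p (\<lambda>x. Y n x - U x)) \<longlonglongrightarrow> 0"
    by (rule finite_intersection_property[of K R I H, OF K(1) mid bd midH fin]) blast+
  have UK: "U \<in> K"
  proof -
    obtain W where "W \<in> K" using K(2) by blast
    then have "(W, 1) \<in> I" by (simp add: I_def)
    then show ?thesis using lim closed U by blast
  qed
  have P0: "0 \<le> P W U" if W: "W \<in> K" for W
  proof (rule field_le_epsilon)
    fix e :: real assume "e > 0"
    then have "(W, e) \<in> I" using W by (simp add: I_def)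
    then obtain Y where Y: "\<And>n::nat. Y n \<in> K \<inter> H (W, e)"
      "(\<lambda>n. energy M p (\<lambda>x. Y n x - U x)) \<longlonglongrightarrow> 0" using lim by blast
    have "(\<lambda>n. P W (Y n)) \<longlonglongrightarrow> P W U"
      using P_alt[OF W] Y(1) UK K W
        pairing_tendsto[OF T_Lspace[of W] _ U Y(2)] by (auto intro!: tendsto_diff simp: subset_iff)
    moreover have "P W (Y n) \<ge> - e" for n using Y(1)[of n] by (simp add: H_def)
    ultimately have "P W U \<ge> - e" by (intro LIMSEQ_le_const) auto
    then show "0 \<le> P W U + e" by simp
  qed
  have "0 \<le> (\<integral>x. T x (U x) \<bullet> (W x - U x) \<partial>M)" if W: "W \<in> K" for W
  proof -
    \<comment> \<open>Return from Minty's form: the competitor U + t (W - U) produces a factor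
      \<open>t\<close> that cancels, and hemicontinuity lets \<open>t\<close> tend to 0.\<close>
    define t where "t = (\<lambda>n. 1 / real (Suc n))"
    have t: "0 < t n" "t n \<le> 1" for n by (auto simp: t_def)
    have tl: "t \<longlonglongrightarrow> 0" unfolding t_def by (rule one_over_Suc_tendsto_0)
    let ?V = "\<lambda>x. W x - U x"
    have V: "?V \<in> Lspace M p" using W K U by (intro Lspace_diff(1) p_nonneg) auto
    have "0 \<le> (\<integral>x. T x (U x + t n *\<^sub>R ?V x) \<bullet> ?V x \<partial>M)" for n
    proof -
      have "(\<lambda>x. (1 - t n) *\<^sub>R U x + t n *\<^sub>R W x) \<in> K"
        using t[of n] by (intro conv UK W) auto
      also have "(\<lambda>x. (1 - t n) *\<^sub>R U x + t n *\<^sub>R W x) = (\<lambda>x. U x + t n *\<^sub>R ?V x)"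
        by (simp add: algebra_simps)
      finally have "0 \<le> P (\<lambda>x. U x + t n *\<^sub>R ?V x) U" by (rule P0)
      then show ?thesis using t(1)[of n] by (simp add: P_def zero_le_mult_iff)
    qed
    moreover have "(\<lambda>n. \<integral>x. T x (U x + t n *\<^sub>R ?V x) \<bullet> ?V x \<partial>M) \<longlonglongrightarrow> (\<integral>x. T x (U x) \<bullet> ?V x \<partial>M)"
      using t by (intro T_hemicontinuous U V tl) (auto simp: abs_of_pos)
    ultimately show ?thesis by (intro LIMSEQ_le_const) auto
  qed
  with UK show ?thesis by (rule that)
qed

end

section \<open>An abstract Sobolev space closed under truncation\<close>

text \<open>De Giorgi's lemma, proved through the bound d r^j: the ratio \<open>r\<close> balances
  the growth of b^j against the surplus exponent \<open>\<kappa> - 1\<close>. The threshold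
  \<open>d\<close> depends only on \<open>C\<close>, \<open>b\<close> and \<open>\<kappa>\<close>,
  so the level of truncation can be chosen after it.\<close>

lemma fast_geometric_convergence:
  assumes "0 \<le> C" "1 < b" "1 < \<kappa>"
  obtains d where "0 < d"
    "\<And>Y::nat\<Rightarrow>real. (\<And>j. 0 \<le> Y j) \<Longrightarrow> (\<And>j. Y (Suc j) \<le> C * b ^ j * Y j powr \<kappa>) \<Longrightarrow> Y 0 \<le> d \<Longrightarrow> Y \<longlonglongrightarrow> 0"
proof -
  define r where "r = b powr (- 1 / (\<kappa> - 1))"
  have "r < b powr 0" unfolding r_def using assms by (intro powr_less_mono) auto
  then have r: "0 < r" "r < 1" using assms by (auto simp: r_def)
  have br: "b * r powr (\<kappa> - 1) = 1"
  proof -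
    have "- 1 / (\<kappa> - 1) * (\<kappa> - 1) = - 1" using assms by simp
    then have "r powr (\<kappa> - 1) = b powr (- 1)" by (simp only: r_def powr_powr)
    then show ?thesis using assms by (simp add: powr_minus_divide)
  qed
  \<comment> \<open>Chosen so that C d^(\<kappa> - 1) is at most \<open>r\<close>, which closes the
    induction.\<close>
  define d where "d = (r / (C + 1)) powr (1 / (\<kappa> - 1))"
  have d: "0 < d" using r assms by (simp add: d_def)
  have "d powr (\<kappa> - 1) = r / (C + 1)" using r assms by (simp add: d_def powr_powr)
  moreover have "C * (r / (C + 1)) \<le> r" using r assms by (simp add: field_simps)
  ultimately have dr: "C * d powr (\<kappa> - 1) \<le> r" by simp
  show ?thesis
  proof (rule that[OF d])
    fix Y :: "nat \<Rightarrow> real"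
    assume Y0: "\<And>j. 0 \<le> Y j" and step: "\<And>j. Y (Suc j) \<le> C * b ^ j * Y j powr \<kappa>" and Yd: "Y 0 \<le> d"
    have le: "Y j \<le> d * r ^ j" for j
    proof (induction j)
      case (Suc j)
      have "Y (Suc j) \<le> C * b ^ j * (d * r ^ j) powr \<kappa>"
        using Suc Y0 assms by (intro order_trans[OF step] mult_left_mono powr_mono2) auto
      also have "(d * r ^ j) powr \<kappa> = (d * r ^ j) powr 1 * (d * r ^ j) powr (\<kappa> - 1)"
        by (simp only: powr_add[symmetric]) simp
      also have "\<dots> = d * r ^ j * (d powr (\<kappa> - 1) * (r powr (\<kappa> - 1)) ^ j)"
        using d r by (simp add: powr_mult powr_realpow[symmetric] powr_powr mult.commute)
      also have "C * b ^ j * (d * r ^ j * (d powr (\<kappa> - 1) * (r powr (\<kappa> - 1)) ^ j))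
          = (C * d powr (\<kappa> - 1)) * (d * r ^ j) * (b * r powr (\<kappa> - 1)) ^ j"
        by (simp only: power_mult_distrib mult_ac)
      also have "\<dots> \<le> r * (d * r ^ j)"
        unfolding br power_one mult_1_right using d r by (intro mult_right_mono dr) simp
      finally show ?case by (simp add: mult_ac)
    qed (use Yd in simp)
    have "(\<lambda>j. r ^ j) \<longlonglongrightarrow> 0" using r by (intro LIMSEQ_realpow_zero) auto
    then show "Y \<longlonglongrightarrow> 0" using le Y0 by (rule energy_tendsto_0_le[rotated 2])
  qed
qed

text \<open>Function and gradient are kept together so that a closed linear subspace of one L^p
  space carries the whole structure. Truncation is required only as the positive part above a level
  \<open>s \<ge> 0\<close>; negative parts come from it by a change of sign.\<close>

locale sobolev_lattice = finite_Lp M p for M :: "'a measure" and p +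
  fixes V :: "('a \<Rightarrow> real \<times> 'b::euclidean_space) set" and \<kappa> S :: real
  assumes V_Lspace: "V \<subseteq> Lspace M p"
    and V_zero: "(\<lambda>x. 0) \<in> V"
    and V_add: "\<And>U W. U \<in> V \<Longrightarrow> W \<in> V \<Longrightarrow> (\<lambda>x. U x + W x) \<in> V"
    and V_scaleR: "\<And>U t. U \<in> V \<Longrightarrow> (\<lambda>x. t *\<^sub>R U x) \<in> V"
    and V_closed: "\<And>Y U. (\<And>n::nat. Y n \<in> V) \<Longrightarrow> U \<in> Lspace M p \<Longrightarrow>
        (\<lambda>n. energy M p (\<lambda>x. Y n x - U x)) \<longlonglongrightarrow> 0 \<Longrightarrow> U \<in> V"
    and V_truncate: "\<And>U s. U \<in> V \<Longrightarrow> 0 \<le> s \<Longrightarrow>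
        (\<lambda>x. (max 0 (fst (U x) - s), if s < fst (U x) then snd (U x) else 0)) \<in> V"
    and kappa: "1 < \<kappa>" and S_nonneg: "0 \<le> S"
    and sobolev_integrable: "\<And>U. U \<in> V \<Longrightarrow> integrable M (\<lambda>x. \<bar>fst (U x)\<bar> powr (\<kappa> * p))"
    and sobolev: "\<And>U. U \<in> V \<Longrightarrow> (\<integral>x. \<bar>fst (U x)\<bar> powr (\<kappa> * p) \<partial>M)
        \<le> S * energy M p (\<lambda>x. snd (U x)) powr \<kappa>"
begin

lemma V_diff: "U \<in> V \<Longrightarrow> W \<in> V \<Longrightarrow> (\<lambda>x. U x - W x) \<in> V"
  using V_add[of U "\<lambda>x. - W x"] V_scaleR[of W "-1"] by simp

lemma
  assumes "U \<in> V"
  shows V_fst: "(\<lambda>x. fst (U x)) \<in> Lspace M p" and V_snd: "(\<lambda>x. snd (U x)) \<in> Lspace M p"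
  using assms V_Lspace by (auto intro: Lspace_fst Lspace_snd p_nonneg)

lemma V_measurable [measurable_dest]: "U \<in> V \<Longrightarrow> U \<in> borel_measurable M"
  using V_Lspace Lspace_measurable by blast

abbreviation mass :: real where "mass \<equiv> measure M (space M)"

text \<open>With J the gradient energy, splitting |u|^p at a level \<open>l\<close> by
  \<open>le_add_powr\<close> gives l mass + l^(1 - \<kappa>) S J^\<kappa>. The choice l = J makes
  both terms linear in J.\<close>

lemma poincare:
  assumes "U \<in> V"
  shows "energy M p (\<lambda>x. fst (U x)) \<le> (mass + S) * energy M p (\<lambda>x. snd (U x))"
proof -
  define J where "J = energy M p (\<lambda>x. snd (U x))"
  have J: "0 \<le> J" by (simp add: J_def energy_nonneg)
  have "energy M p (\<lambda>x. fst (U x)) \<le> l * mass + l powr (1 - \<kappa>) * (S * J powr \<kappa>)" if l: "l > 0" for l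
  proof -
    have i: "integrable M (\<lambda>x. l + l powr (1 - \<kappa>) * \<bar>fst (U x)\<bar> powr (\<kappa> * p))"
      using sobolev_integrable[OF assms] by simp
    have "energy M p (\<lambda>x. fst (U x)) \<le> (\<integral>x. l + l powr (1 - \<kappa>) * \<bar>fst (U x)\<bar> powr (\<kappa> * p) \<partial>M)"
      unfolding energy_def
    proof (rule integral_mono[OF _ i])
      show "integrable M (\<lambda>x. norm (fst (U x)) powr p)" using V_fst[OF assms] by (rule Lspace_integrable)
      fix x
      show "norm (fst (U x)) powr p \<le> l + l powr (1 - \<kappa>) * \<bar>fst (U x)\<bar> powr (\<kappa> * p)"
        using le_add_powr[OF kappa _ l, of "\<bar>fst (U x)\<bar> powr p"] by (simp add: powr_powr mult.commute)
    qed
    also have "\<dots> = l * mass + l powr (1 - \<kappa>) * (\<integral>x. \<bar>fst (U x)\<bar> powr (\<kappa> * p) \<partial>M)"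
      using sobolev_integrable[OF assms] by simp
    also have "\<dots> \<le> l * mass + l powr (1 - \<kappa>) * (S * J powr \<kappa>)"
      unfolding J_def by (intro add_left_mono mult_left_mono sobolev assms) auto
    finally show ?thesis .
  qed note * = this
  show ?thesis
  proof (cases "J = 0")
    case True
    \<comment> \<open>The level must be positive, so for \<open>J = 0\<close> it is sent to 0
      instead.\<close>
    have "energy M p (\<lambda>x. fst (U x)) \<le> 0"
    proof (rule field_le_epsilon)
      fix e :: real assume "e > 0"
      have "0 < mass + 1" by (intro add_nonneg_pos) auto
      then have "e / (mass + 1) * mass \<le> e" using \<open>e > 0\<close> by (simp add: pos_divide_le_eq)
      then show "energy M p (\<lambda>x. fst (U x)) \<le> 0 + e"
        using *[of "e / (mass + 1)"] \<open>e > 0\<close> True measure_nonneg[of M "space M"] kappa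
        by (simp add: add_nonneg_pos)
    qed
    then show ?thesis using True by (simp add: J_def)
  next
    case False
    then have "J > 0" using J by simp
    then have "J powr (1 - \<kappa>) * J powr \<kappa> = J" by (simp flip: powr_add)
    then show ?thesis using *[OF \<open>J > 0\<close>] by (simp add: J_def algebra_simps)
  qed
qed

lemma gradient_zero_imp_zero:
  assumes "U \<in> V" "energy M p (\<lambda>x. snd (U x)) \<le> 0"
  shows "AE x in M. fst (U x) = 0"
proof -
  have "energy M p (\<lambda>x. snd (U x)) = 0" using assms(2) energy_nonneg by (metis antisym)
  then have "energy M p (\<lambda>x. fst (U x)) = 0"
    using poincare[OF assms(1)] energy_nonneg[of M p "\<lambda>x. fst (U x)"] by simp
  then have "AE x in M. norm (fst (U x)) powr p = 0"
    unfolding energy_def using Lspace_integrable[OF V_fst[OF assms(1)]]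
    by (subst (asm) integral_nonneg_eq_0_iff_AE) auto
  then show ?thesis by simp
qed

lemma energy_le_gradient:
  assumes "U \<in> V"
  shows "energy M p U \<le> 2 powr p * (mass + S + 1) * energy M p (\<lambda>x. snd (U x))"
proof -
  note i = Lspace_integrable[OF V_fst[OF assms]] Lspace_integrable[OF V_snd[OF assms]]
  have "energy M p U \<le> (\<integral>x. 2 powr p * (norm (fst (U x)) powr p + norm (snd (U x)) powr p) \<partial>M)"
    unfolding energy_def
  proof (rule integral_mono)
    show "norm (U x) powr p \<le> 2 powr p * (norm (fst (U x)) powr p + norm (snd (U x)) powr p)" for x
      using norm_add_powr_le[OF p_nonneg, of "(fst (U x), 0)" "(0, snd (U x))"] by (simp add: norm_Pair)
  qed (use i assms V_Lspace in \<open>auto intro: Lspace_integrable\<close>)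
  also have "\<dots> = 2 powr p * (energy M p (\<lambda>x. fst (U x)) + energy M p (\<lambda>x. snd (U x)))"
    using i by (simp add: energy_def)
  also have "\<dots> \<le> 2 powr p * ((mass + S) * energy M p (\<lambda>x. snd (U x)) + energy M p (\<lambda>x. snd (U x)))"
    by (intro mult_left_mono add_right_mono poincare assms) auto
  finally show ?thesis by (simp add: algebra_simps)
qed

lemma integrable_fst:
  assumes "U \<in> V" shows "integrable M (\<lambda>x. fst (U x))"
proof (rule Bochner_Integration.integrable_bound)
  show "integrable M (\<lambda>x. 1 + norm (fst (U x)) powr p)"
    using Lspace_integrable[OF V_fst[OF assms]] by simp
  show "AE x in M. norm (fst (U x)) \<le> norm (1 + norm (fst (U x)) powr p)"
    using le_add_powr[OF p, of "\<bar>fst (U x)\<bar>" 1 for x] by (auto intro!: AE_I2)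
qed (use assms in measurable)

text \<open>Because p > 1, a linear term is absorbed into an arbitrarily small part of the gradient
  energy. Both a priori estimates, for fixed \<open>n\<close> and uniform in \<open>n\<close>, rest
  on this.\<close>

lemma integral_fst_absorb:
  assumes "0 \<le> H" "0 < e"
  obtains C where "0 \<le> C"
    "\<And>U. U \<in> V \<Longrightarrow> H * (\<integral>x. \<bar>fst (U x)\<bar> \<partial>M) \<le> e * energy M p (\<lambda>x. snd (U x)) + C"
proof -
  \<comment> \<open>\<open>B\<close> dominates H (mass + S) / e, and \<open>d\<close> is chosen with
    d^(1 - p) = 1 / B, which outweighs the Poincare constant.\<close>
  define B where "B = H * (mass + S) / e + 1"
  have mS: "0 \<le> mass + S" using S_nonneg by simp
  then have B: "B \<ge> 1" using assms by (simp add: B_def)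
  define d where "d = B powr (1 / (p - 1))"
  have d: "d > 0" using B by (simp add: d_def)
  have "d powr (1 - p) = B powr (- 1)"
  proof -
    have "1 / (p - 1) * (1 - p) = - 1" using p by (simp add: field_simps)
    then show ?thesis by (simp only: d_def powr_powr)
  qed
  then have dp: "d powr (1 - p) = 1 / B" using B by (simp add: powr_minus_divide)
  show ?thesis
  proof (rule that[of "H * (d * mass)"])
    show "0 \<le> H * (d * mass)" using assms d by simp
    fix U assume U: "U \<in> V"
    note i = Lspace_integrable[OF V_fst[OF U]]
    have "(\<integral>x. \<bar>fst (U x)\<bar> \<partial>M) \<le> (\<integral>x. d + d powr (1 - p) * norm (fst (U x)) powr p \<partial>M)"
      using i integrable_fst[OF U] le_add_powr[OF p _ d] by (intro integral_mono) auto
    also have "\<dots> = d * mass + d powr (1 - p) * energy M p (\<lambda>x. fst (U x))"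
      using i by (simp add: energy_def)
    also have "\<dots> \<le> d * mass + d powr (1 - p) * ((mass + S) * energy M p (\<lambda>x. snd (U x)))"
      by (intro add_left_mono mult_left_mono poincare U) auto
    finally have "H * (\<integral>x. \<bar>fst (U x)\<bar> \<partial>M)
        \<le> H * (d * mass + d powr (1 - p) * ((mass + S) * energy M p (\<lambda>x. snd (U x))))"
      using assms by (intro mult_left_mono) auto
    also have "\<dots> = H * (d * mass) + (H * (mass + S) / B) * energy M p (\<lambda>x. snd (U x))"
      by (simp add: dp algebra_simps add_divide_distrib)
    also have "\<dots> \<le> H * (d * mass) + e * energy M p (\<lambda>x. snd (U x))"
    proof (intro add_left_mono mult_right_mono energy_nonneg)
      have "H * (mass + S) \<le> e * B" using assms by (simp add: B_def field_simps)
      then show "H * (mass + S) / B \<le> e" using B by (simp add: pos_divide_le_eq)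
    qed
    finally show "H * (\<integral>x. \<bar>fst (U x)\<bar> \<partial>M) \<le> e * energy M p (\<lambda>x. snd (U x)) + H * (d * mass)" by simp
  qed
qed

end

section \<open>The regularized problems\<close>

text \<open>\<open>a\<close> stands for A / w, the weight being carried by \<open>M\<close>. The
  condition on the exponent near the boundary enters only later, as the alternative assumed in
  \<open>sol_gradient_bound\<close>.\<close>

locale singular_problem = sobolev_lattice M p V \<kappa> S
  for M :: "'a measure" and p and V :: "('a \<Rightarrow> real \<times> 'b::euclidean_space) set" and \<kappa> S +
  fixes a :: "'a \<Rightarrow> 'b \<Rightarrow> 'b" and \<alpha> \<beta> :: real and \<gamma> :: "'a \<Rightarrow> real" and \<gamma>1 :: real
  assumes a_measurable: "\<And>Z. Z \<in> borel_measurable M \<Longrightarrow> (\<lambda>x. a x (Z x)) \<in> borel_measurable M"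
    and a_continuous: "\<And>x. continuous_on UNIV (a x)"
    and a_growth: "\<And>x z. norm (a x z) \<le> \<beta> * norm z powr (p - 1)"
    and a_coercive: "\<And>x z. \<alpha> * norm z powr p \<le> a x z \<bullet> z"
    and a_strict: "\<And>x y z. y \<noteq> z \<Longrightarrow> 0 < (a x y - a x z) \<bullet> (y - z)"
    and alpha: "0 < \<alpha>" and beta: "0 < \<beta>"
    and gamma_measurable [measurable]: "\<gamma> \<in> borel_measurable M"
    and gamma: "\<And>x. 0 \<le> \<gamma> x" "\<And>x. \<gamma> x \<le> \<gamma>1"
begin

lemma a_monotone: "0 \<le> (a x y - a x z) \<bullet> (y - z)"
  using a_strict[of y z x] by (cases "y = z") auto

text \<open>The positive part makes the source bounded and nonincreasing on the whole line, so
  solutions can be sought before their sign is known. The shrinking shift makes it nondecreasing in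
  \<open>n\<close>.\<close>

definition h :: "nat \<Rightarrow> 'a \<Rightarrow> real \<Rightarrow> real" where
  "h n x s = (max s 0 + 1 / real (Suc n)) powr (- \<gamma> x)"

text \<open>Since \<open>- h n x\<close> is nondecreasing, the combined field is monotone on pairs.
  An element of \<open>V\<close> at which its pairing with all of \<open>V\<close> vanishes is a
  weak solution of the regularized problem.\<close>

definition T :: "nat \<Rightarrow> 'a \<Rightarrow> real \<times> 'b \<Rightarrow> real \<times> 'b" where
  "T n x z = (- h n x (fst z), a x (snd z))"

lemma h_base_pos: "0 < max s 0 + 1 / real (Suc n)"
  by (rule add_nonneg_pos) auto

lemma h_pos: "0 < h n x s"
  unfolding h_def powr_gt_zero using h_base_pos by (metis less_irrefl)

lemma h_antimono: "s \<le> t \<Longrightarrow> h n x t \<le> h n x s"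
  unfolding h_def using gamma(1)[of x] by (intro powr_mono2' h_base_pos) auto

lemma h_mono_index: "h n x s \<le> h (Suc n) x s"
  unfolding h_def using gamma(1)[of x]
  by (intro powr_mono2' h_base_pos) (auto intro!: divide_left_mono)

lemma h_bound: "h n x s \<le> real (Suc n) powr \<gamma>1"
proof -
  have "h n x s \<le> (1 / real (Suc n)) powr (- \<gamma> x)"
    unfolding h_def using gamma(1)[of x] by (intro powr_mono2') auto
  also have "\<dots> = real (Suc n) powr \<gamma> x" by (simp add: powr_minus powr_divide del: of_nat_Suc)
  also have "\<dots> \<le> real (Suc n) powr \<gamma>1" using gamma(2)[of x] by (intro powr_mono) auto
  finally show ?thesis .
qed

lemma h_measurable [measurable]:
  assumes [measurable]: "f \<in> borel_measurable M"
  shows "(\<lambda>x. h n x (f x)) \<in> borel_measurable M"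
  unfolding h_def by measurable

lemma a_operator: "monotone_operator M p a \<beta>"
proof
  fix x z
  have "norm (a x z) \<le> \<beta> * norm z powr (p - 1)" by (rule a_growth)
  also have "\<dots> \<le> \<beta> * (1 + norm z) powr (p - 1)"
    using beta p by (intro mult_left_mono powr_mono2) auto
  finally show "norm (a x z) \<le> \<beta> * (1 + norm z) powr (p - 1)" .
qed (auto intro: a_measurable a_continuous a_monotone)

lemma T_operator: "monotone_operator M p (T n) (real (Suc n) powr \<gamma>1 + \<beta>)"
proof
  fix Z :: "'a \<Rightarrow> real \<times> 'b" assume Z: "Z \<in> borel_measurable M"
  then have [measurable]: "Z \<in> borel_measurable M"
    "(\<lambda>x. a x (snd (Z x))) \<in> borel_measurable M" by (auto intro!: a_measurable borel_measurable_snd)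
  show "(\<lambda>x. T n x (Z x)) \<in> borel_measurable M" unfolding T_def by measurable
next
  fix x
  have "max (fst z) 0 + 1 / real (Suc n) \<noteq> 0" for z :: "real \<times> 'b"
    using h_base_pos by (metis less_irrefl)
  then have "continuous_on UNIV (\<lambda>z::real\<times>'b. h n x (fst z))"
    unfolding h_def by (intro continuous_intros) auto
  then show "continuous_on UNIV (T n x)" unfolding T_def
    by (intro continuous_intros continuous_on_compose2[OF a_continuous]) auto
next
  fix x and z :: "real \<times> 'b"
  have "norm (T n x z) \<le> \<bar>h n x (fst z)\<bar> + norm (a x (snd z))"
    unfolding T_def by (rule order_trans[OF norm_Pair_le]) simp
  also have "\<dots> \<le> real (Suc n) powr \<gamma>1 * 1 + \<beta> * norm (snd z) powr (p - 1)"
    using h_pos[of n x "fst z"] h_bound[of n x "fst z"] a_growth[of x "snd z"] by simp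
  also have "\<dots> \<le> real (Suc n) powr \<gamma>1 * (1 + norm z) powr (p - 1) + \<beta> * (1 + norm z) powr (p - 1)"
    using p beta norm_snd_le[of "snd z" "fst z"]
    by (intro add_mono mult_left_mono powr_mono2 ge_one_powr_ge_zero) auto
  finally show "norm (T n x z) \<le> (real (Suc n) powr \<gamma>1 + \<beta>) * (1 + norm z) powr (p - 1)"
    by (simp add: algebra_simps)
next
  fix x and y z :: "real \<times> 'b"
  have "0 \<le> (h n x (fst z) - h n x (fst y)) * (fst y - fst z)"
    using h_antimono[of "fst y" "fst z" n x] h_antimono[of "fst z" "fst y" n x]
    by (cases "fst y \<le> fst z") (auto intro: mult_nonneg_nonneg mult_nonpos_nonpos)
  then show "0 \<le> (T n x y - T n x z) \<bullet> (y - z)"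
    using a_monotone[of x "snd y" "snd z"] by (simp add: T_def inner_prod_def)
qed

lemma a_integrable: "Z \<in> Lspace M p \<Longrightarrow> Y \<in> Lspace M p \<Longrightarrow> integrable M (\<lambda>x. a x (Z x) \<bullet> Y x)"
  by (rule monotone_operator.T_pairing_integrable[OF a_operator])

lemma h_integrable:
  assumes [measurable]: "f \<in> borel_measurable M" and g: "integrable M g"
  shows "integrable M (\<lambda>x. h n x (f x) * g x)"
proof (rule Bochner_Integration.integrable_bound)
  show "integrable M (\<lambda>x. real (Suc n) powr \<gamma>1 * g x)" using g by simp
  show "AE x in M. norm (h n x (f x) * g x) \<le> norm (real (Suc n) powr \<gamma>1 * g x)"
    using h_bound h_pos[THEN less_imp_le]
    by (auto intro!: AE_I2 mult_right_mono simp: abs_mult abs_of_nonneg)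
qed (use g in measurable)

lemma T_integral:
  assumes "U \<in> V" "W \<in> V"
  shows "(\<integral>x. T n x (U x) \<bullet> W x \<partial>M)
    = (\<integral>x. a x (snd (U x)) \<bullet> snd (W x) \<partial>M) - (\<integral>x. h n x (fst (U x)) * fst (W x) \<partial>M)"
proof -
  have [measurable]: "U \<in> borel_measurable M" using assms by measurable
  have "integrable M (\<lambda>x. h n x (fst (U x)) * fst (W x))"
    by (rule h_integrable[OF _ integrable_fst[OF assms(2)]]) measurable
  moreover have "integrable M (\<lambda>x. a x (snd (U x)) \<bullet> snd (W x))"
    by (intro a_integrable V_snd assms)
  ultimately show ?thesis
    by (subst Bochner_Integration.integral_diff[symmetric])
      (auto simp: T_def inner_prod_def intro!: Bochner_Integration.integral_cong)
qed

lemma coercive_integral: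
  assumes "U \<in> V"
  shows "\<alpha> * energy M p (\<lambda>x. snd (U x)) \<le> (\<integral>x. a x (snd (U x)) \<bullet> snd (U x) \<partial>M)"
proof -
  have "\<alpha> * energy M p (\<lambda>x. snd (U x)) = (\<integral>x. \<alpha> * norm (snd (U x)) powr p \<partial>M)"
    by (simp add: energy_def)
  also have "\<dots> \<le> (\<integral>x. a x (snd (U x)) \<bullet> snd (U x) \<partial>M)"
    using Lspace_integrable[OF V_snd[OF assms]]
    by (intro integral_mono a_coercive a_integrable V_snd assms) auto
  finally show ?thesis .
qed

text \<open>The variational inequality is solved on a ball for the gradient energy. An a priori
  bound shows that the constraint is not active at the solution, so every direction of
  \<open>V\<close> is admissible and the inequality becomes an equation.\<close>

lemma regularized_solution_exists:
  "\<exists>U\<in>V. \<forall>W\<in>V. (\<integral>x. a x (snd (U x)) \<bullet> snd (W x) \<partial>M) = (\<integral>x. h n x (fst (U x)) * fst (W x) \<partial>M)"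
proof -
  define G where "G = (\<lambda>U::'a \<Rightarrow> real \<times> 'b. energy M p (\<lambda>x. snd (U x)))"
  define H where "H = real (Suc n) powr \<gamma>1"
  have H: "0 \<le> H" by (simp add: H_def)
  obtain C where C: "0 \<le> C" "\<And>U. U \<in> V \<Longrightarrow> H * (\<integral>x. \<bar>fst (U x)\<bar> \<partial>M) \<le> \<alpha> / 2 * G U + C"
    using integral_fst_absorb[OF H, of "\<alpha> / 2"] alpha unfolding G_def by auto
  \<comment> \<open>The estimate below gives G U \<le> 2 C / \<alpha>; the added 1 puts the solution
    strictly inside the ball.\<close>
  define R where "R = 2 * C / \<alpha> + 1"
  have R: "0 \<le> R" using C alpha by (simp add: R_def)
  define K where "K = {U \<in> V. G U \<le> R}"
  have Gconv: "G (\<lambda>x. (1 - t) *\<^sub>R X x + t *\<^sub>R Y x) \<le> (1 - t) * G X + t * G Y"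
    if "X \<in> V" "Y \<in> V" "0 \<le> t" "t \<le> 1" for X Y t
  proof -
    have XY: "(\<lambda>x. (1 - t) *\<^sub>R X x + t *\<^sub>R Y x) \<in> V" by (intro V_add V_scaleR that)
    have "G (\<lambda>x. (1 - t) *\<^sub>R X x + t *\<^sub>R Y x)
        \<le> (\<integral>x. (1 - t) * norm (snd (X x)) powr p + t * norm (snd (Y x)) powr p \<partial>M)"
      unfolding G_def energy_def
      using Lspace_integrable[OF V_snd[OF XY]] Lspace_integrable[OF V_snd[OF that(1)]]
        Lspace_integrable[OF V_snd[OF that(2)]] norm_powr_convex[OF p that(3,4)]
      by (intro integral_mono) auto
    then show ?thesis
      using Lspace_integrable[OF V_snd[OF that(1)]] Lspace_integrable[OF V_snd[OF that(2)]]
      by (simp add: G_def energy_def)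
  qed
  obtain U where U: "U \<in> K" and VI: "\<And>W. W \<in> K \<Longrightarrow> 0 \<le> (\<integral>x. T n x (U x) \<bullet> (W x - U x) \<partial>M)"
  proof (rule monotone_operator.variational_inequality[OF T_operator[of n], of K "2 powr p * (mass + S + 1) * R"])
    show "K \<subseteq> Lspace M p" using V_Lspace by (auto simp: K_def)
    have "(\<lambda>x. 0) \<in> K" using V_zero R by (simp add: K_def G_def energy_def)
    then show "K \<noteq> {}" by blast
  next
    fix X Y and t :: real assume *: "X \<in> K" "Y \<in> K" "0 \<le> t" "t \<le> 1"
    then have XY: "X \<in> V" "Y \<in> V" "G X \<le> R" "G Y \<le> R" by (auto simp: K_def)
    have "(1 - t) * G X + t * G Y \<le> (1 - t) * R + t * R"
      using * XY by (intro add_mono mult_left_mono) auto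
    also have "\<dots> = R" by (simp add: algebra_simps)
    finally have "G (\<lambda>x. (1 - t) *\<^sub>R X x + t *\<^sub>R Y x) \<le> R"
      using Gconv[OF XY(1,2) *(3,4)] by linarith
    moreover have "(\<lambda>x. (1 - t) *\<^sub>R X x + t *\<^sub>R Y x) \<in> V" by (intro V_add V_scaleR XY)
    ultimately show "(\<lambda>x. (1 - t) *\<^sub>R X x + t *\<^sub>R Y x) \<in> K" by (simp add: K_def)
  next
    fix X assume "X \<in> K"
    then have X: "X \<in> V" "G X \<le> R" by (auto simp: K_def)
    have "energy M p X \<le> 2 powr p * (mass + S + 1) * G X"
      unfolding G_def by (rule energy_le_gradient[OF X(1)])
    also have "\<dots> \<le> 2 powr p * (mass + S + 1) * R" using X S_nonneg by (intro mult_left_mono) auto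
    finally show "energy M p X \<le> 2 powr p * (mass + S + 1) * R" .
  next
    fix Y :: "nat \<Rightarrow> 'a \<Rightarrow> real \<times> 'b" and U
    assume Y: "\<And>n. Y n \<in> K" and UL: "U \<in> Lspace M p" and lim: "(\<lambda>n. energy M p (\<lambda>x. Y n x - U x)) \<longlonglongrightarrow> 0"
    have YV: "Y n \<in> V" for n using Y[of n] by (simp add: K_def)
    have YL: "Y n \<in> Lspace M p" for n using YV V_Lspace by blast
    have UV: "U \<in> V" by (rule V_closed[OF YV UL lim])
    obtain r :: "nat \<Rightarrow> nat" where r: "strict_mono r" "AE x in M. (\<lambda>n. Y (r n) x) \<longlonglongrightarrow> U x"
      using AE_convergent_subsequence[OF YL UL lim] by blast
    have "AE x in M. (\<lambda>n. snd (Y (r n) x)) \<longlonglongrightarrow> snd (U x)"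
      using r(2) by eventually_elim (intro tendsto_intros)
    then have "G U \<le> R" unfolding G_def
      using energy_Fatou(2)[of "\<lambda>n x. snd (Y (r n) x)" "\<lambda>x. snd (U x)" R]
        V_snd[OF YV] Lspace_measurable[OF V_snd[OF UV]] Y by (auto simp: K_def G_def)
    then show "U \<in> K" using UV by (simp add: K_def)
  qed auto
  have UV: "U \<in> V" using U by (simp add: K_def)
  have [measurable]: "U \<in> borel_measurable M" using UV by measurable
  have GU: "G U < R"
  proof -
    have "(\<lambda>x. 0) \<in> K" using V_zero R by (simp add: K_def G_def energy_def)
    \<comment> \<open>The competitor 0 yields the usual energy estimate, as if the solution had been
      tested with itself.\<close>
    from VI[OF this] have "(\<integral>x. T n x (U x) \<bullet> U x \<partial>M) \<le> 0" by simp
    then have "(\<integral>x. a x (snd (U x)) \<bullet> snd (U x) \<partial>M) \<le> (\<integral>x. h n x (fst (U x)) * fst (U x) \<partial>M)"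
      using T_integral[OF UV UV] by simp
    then have "\<alpha> * G U \<le> (\<integral>x. h n x (fst (U x)) * fst (U x) \<partial>M)"
      using coercive_integral[OF UV] by (simp add: G_def)
    also have "\<dots> \<le> (\<integral>x. H * \<bar>fst (U x)\<bar> \<partial>M)"
    proof (rule integral_mono)
      fix x
      have "h n x (fst (U x)) * fst (U x) \<le> h n x (fst (U x)) * \<bar>fst (U x)\<bar>"
        using h_pos[of n x "fst (U x)"] by (intro mult_left_mono) auto
      also have "\<dots> \<le> H * \<bar>fst (U x)\<bar>"
        unfolding H_def by (intro mult_right_mono h_bound) auto
      finally show "h n x (fst (U x)) * fst (U x) \<le> H * \<bar>fst (U x)\<bar>" .
    qed (use integrable_fst[OF UV] in \<open>auto intro!: h_integrable\<close>)
    also have "\<dots> = H * (\<integral>x. \<bar>fst (U x)\<bar> \<partial>M)" by simp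
    also have "\<dots> \<le> \<alpha> / 2 * G U + C" by (rule C(2)[OF UV])
    finally have "\<alpha> / 2 * G U \<le> C" by simp
    then show ?thesis using alpha by (simp add: R_def field_simps)
  qed
  have ge: "0 \<le> (\<integral>x. T n x (U x) \<bullet> W x \<partial>M)" if W: "W \<in> V" for W
  proof -
    let ?Y = "\<lambda>x. U x + W x"
    have Y: "?Y \<in> V" by (intro V_add UV W)
    have GY: "0 \<le> G ?Y" "0 \<le> G U" by (auto simp: G_def energy_nonneg)
    \<comment> \<open>By convexity of \<open>G\<close> the mixture has energy at most G U + t G(U +
      W), so a step of this length stays in \<open>K\<close>; the 1 in the denominator avoids
      division by 0.\<close>
    define t where "t = min 1 ((R - G U) / (G ?Y + 1))"
    have t: "0 < t" "t \<le> 1" using GU GY by (auto simp: t_def)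
    have "t * G ?Y \<le> t * (G ?Y + 1)" using t by simp
    also have "\<dots> \<le> R - G U"
      using GY by (simp add: t_def min_le_iff_disj pos_le_divide_eq[symmetric])
    finally have tG: "t * G ?Y \<le> R - G U" .
    have "G (\<lambda>x. (1 - t) *\<^sub>R U x + t *\<^sub>R ?Y x) \<le> (1 - t) * G U + t * G ?Y"
      using t by (intro Gconv UV Y) auto
    also have "\<dots> \<le> 1 * G U + t * G ?Y" using t GY by (intro add_right_mono mult_right_mono) auto
    also have "\<dots> \<le> R" using tG by simp
    finally have "(\<lambda>x. (1 - t) *\<^sub>R U x + t *\<^sub>R ?Y x) \<in> K"
      by (auto simp: K_def intro!: V_add V_scaleR UV W)
    from VI[OF this] have "0 \<le> (\<integral>x. T n x (U x) \<bullet> (t *\<^sub>R W x) \<partial>M)"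
      by (simp add: algebra_simps)
    then show ?thesis using t by (simp add: zero_le_mult_iff)
  qed
  show ?thesis
  proof (intro bexI[OF _ UV] ballI)
    fix W assume W: "W \<in> V"
    have "0 \<le> (\<integral>x. T n x (U x) \<bullet> (- W x) \<partial>M)" using ge[OF V_scaleR[OF W, of "-1"]] by simp
    then have "(\<integral>x. T n x (U x) \<bullet> W x \<partial>M) = 0" using ge[OF W] by simp
    then show "(\<integral>x. a x (snd (U x)) \<bullet> snd (W x) \<partial>M) = (\<integral>x. h n x (fst (U x)) * fst (W x) \<partial>M)"
      using T_integral[OF UV W] by simp
  qed
qed

section \<open>Sign, monotonicity in n and lower bound of the regularized solutions\<close>

definition sol :: "nat \<Rightarrow> 'a \<Rightarrow> real \<times> 'b" where
  "sol n = (SOME U. U \<in> V \<and> (\<forall>W\<in>V. (\<integral>x. a x (snd (U x)) \<bullet> snd (W x) \<partial>M)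
     = (\<integral>x. h n x (fst (U x)) * fst (W x) \<partial>M)))"

lemma sol: "sol n \<in> V"
  and sol_eq: "W \<in> V \<Longrightarrow> (\<integral>x. a x (snd (sol n x)) \<bullet> snd (W x) \<partial>M)
     = (\<integral>x. h n x (fst (sol n x)) * fst (W x) \<partial>M)"
  using someI_ex[of "\<lambda>U. U \<in> V \<and> (\<forall>W\<in>V. (\<integral>x. a x (snd (U x)) \<bullet> snd (W x) \<partial>M)
     = (\<integral>x. h n x (fst (U x)) * fst (W x) \<partial>M))"] regularized_solution_exists[of n]
  unfolding sol_def[symmetric] by blast+

lemma sol_measurable [measurable]: "sol n \<in> borel_measurable M"
  using sol by measurable

text \<open>Test with the negative part: by coercivity the left side is at most -\<alpha> times the
  gradient energy of that part, while the right side is nonnegative because \<open>h\<close> is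
  positive.\<close>

lemma sol_nonneg: "AE x in M. 0 \<le> fst (sol n x)"
proof -
  let ?N = "\<lambda>x. - sol n x"
  define W where "W = (\<lambda>x. (max 0 (fst (?N x) - 0), if 0 < fst (?N x) then snd (?N x) else 0))"
  have N: "?N \<in> V" using V_scaleR[OF sol, of "-1" n] by simp
  have W: "W \<in> V" unfolding W_def by (rule V_truncate[OF N]) simp
  have "\<alpha> * energy M p (\<lambda>x. snd (W x)) = (\<integral>x. \<alpha> * norm (snd (W x)) powr p \<partial>M)"
    by (simp add: energy_def)
  also have "\<dots> \<le> (\<integral>x. - (a x (snd (sol n x)) \<bullet> snd (W x)) \<partial>M)"
  proof (rule integral_mono)
    show "integrable M (\<lambda>x. \<alpha> * norm (snd (W x)) powr p)"
      using Lspace_integrable[OF V_snd[OF W]] by simp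
    show "integrable M (\<lambda>x. - (a x (snd (sol n x)) \<bullet> snd (W x)))"
      by (intro integrable_minus a_integrable V_snd W sol)
    show "\<alpha> * norm (snd (W x)) powr p \<le> - (a x (snd (sol n x)) \<bullet> snd (W x))" for x
      using a_coercive[of "snd (sol n x)" x] p by (simp add: W_def)
  qed
  also have "\<dots> = - (\<integral>x. h n x (fst (sol n x)) * fst (W x) \<partial>M)"
    using sol_eq[OF W] by simp
  also have "\<dots> \<le> 0"
    using h_pos by (simp add: W_def less_imp_le Bochner_Integration.integral_nonneg)
  finally have "energy M p (\<lambda>x. snd (W x)) \<le> 0" using alpha by (simp add: mult_le_0_iff)
  then have "AE x in M. fst (W x) = 0" by (rule gradient_zero_imp_zero[OF W])
  then show ?thesis by eventually_elim (simp add: W_def max_def split: if_splits)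
qed

text \<open>Comparison: both equations are tested with the positive part of u_n - u_(n+1). Where it
  is positive, the source of index n is the smaller one, by monotonicity in \<open>n\<close> and in
  \<open>s\<close>; strict monotonicity of \<open>a\<close> then makes its gradient vanish.\<close>

lemma sol_mono_Suc: "AE x in M. fst (sol n x) \<le> fst (sol (Suc n) x)"
proof -
  let ?D = "\<lambda>x. sol n x - sol (Suc n) x"
  define W where "W = (\<lambda>x. (max 0 (fst (?D x) - 0), if 0 < fst (?D x) then snd (?D x) else 0))"
  have D: "?D \<in> V" by (intro V_diff sol)
  have W: "W \<in> V" unfolding W_def by (rule V_truncate[OF D]) simp
  define f where "f = (\<lambda>x. (a x (snd (sol n x)) - a x (snd (sol (Suc n) x))) \<bullet> snd (W x))"
  have i: "integrable M (\<lambda>x. a x (snd (sol k x)) \<bullet> snd (W x))" for k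
    by (intro a_integrable V_snd W sol)
  have ih: "integrable M (\<lambda>x. h k x (fst (sol k x)) * fst (W x))" for k
    by (intro h_integrable integrable_fst W) measurable
  have f: "integrable M f" unfolding f_def inner_diff_left using i by auto
  have f0: "0 \<le> f x" for x
    using a_monotone[of x "snd (sol n x)" "snd (sol (Suc n) x)"] by (simp add: f_def W_def)
  have "(\<integral>x. f x \<partial>M) = (\<integral>x. a x (snd (sol n x)) \<bullet> snd (W x) \<partial>M)
      - (\<integral>x. a x (snd (sol (Suc n) x)) \<bullet> snd (W x) \<partial>M)"
    unfolding f_def inner_diff_left by (intro Bochner_Integration.integral_diff i)
  also have "\<dots> = (\<integral>x. h n x (fst (sol n x)) * fst (W x) \<partial>M)
      - (\<integral>x. h (Suc n) x (fst (sol (Suc n) x)) * fst (W x) \<partial>M)"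
    using sol_eq[OF W, of n] sol_eq[OF W, of "Suc n"] by simp
  also have "\<dots> \<le> 0"
  proof -
    have "(\<integral>x. h n x (fst (sol n x)) * fst (W x) \<partial>M) \<le> (\<integral>x. h (Suc n) x (fst (sol (Suc n) x)) * fst (W x) \<partial>M)"
    proof (rule integral_mono[OF ih ih])
      fix x
      show "h n x (fst (sol n x)) * fst (W x) \<le> h (Suc n) x (fst (sol (Suc n) x)) * fst (W x)"
      proof (cases "fst (sol (Suc n) x) < fst (sol n x)")
        case True
        have "h n x (fst (sol n x)) \<le> h (Suc n) x (fst (sol n x))" by (rule h_mono_index)
        also have "\<dots> \<le> h (Suc n) x (fst (sol (Suc n) x))" using True by (intro h_antimono) auto
        finally show ?thesis by (intro mult_right_mono) (auto simp: W_def)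
      qed (simp add: W_def)
    qed
    then show ?thesis by simp
  qed
  finally have "(\<integral>x. f x \<partial>M) = 0" using Bochner_Integration.integral_nonneg[of M f] f0 by (meson antisym)
  then have "AE x in M. f x = 0" using f f0 by (subst (asm) integral_nonneg_eq_0_iff_AE) auto
  then have "AE x in M. snd (W x) = 0"
  proof eventually_elim
    fix x assume "f x = 0"
    then show "snd (W x) = 0"
      using a_strict[of "snd (sol n x)" "snd (sol (Suc n) x)" x]
      by (cases "snd (sol n x) = snd (sol (Suc n) x)") (auto simp: f_def W_def split: if_splits)
  qed
  then have "AE x in M. norm (snd (W x)) powr p = 0" by eventually_elim simp
  then have "energy M p (\<lambda>x. snd (W x)) = 0"
    unfolding energy_def by (rule integral_eq_zero_AE)
  then have "AE x in M. fst (W x) = 0" using gradient_zero_imp_zero[OF W] by simp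
  then show ?thesis by eventually_elim (simp add: W_def max_def split: if_splits)
qed

lemma sol_mono: "AE x in M. mono (\<lambda>n. fst (sol n x))"
proof -
  have "AE x in M. \<forall>n. fst (sol n x) \<le> fst (sol (Suc n) x)"
    using sol_mono_Suc by (simp add: AE_all_countable)
  then show ?thesis by eventually_elim (simp add: mono_iff_le_Suc)
qed

text \<open>De Giorgi iteration for the truncations of \<open>k \<eta> - u\<close>: since the right-hand side is bounded
  below where \<open>u < k\<close>, the set where \<open>k \<eta> - u > k / 4\<close> has measure $O(k^{p-1})$, which for
  small \<open>k\<close> is small enough to start the iteration with constants independent of \<open>k\<close>.\<close>

lemma sol_lower_bound:
  assumes N: "N \<in> V" and L: "AE x in M. norm (snd (N x)) \<le> L" and N1: "AE x in M. fst (N x) \<le> 1"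
  obtains k where "0 < k" "AE x in M. k * (fst (N x) - 1/2) \<le> fst (sol 0 x)"
proof -
  have L0: "0 \<le> max L 0" and LL: "AE x in M. norm (snd (N x)) \<le> max L 0" using L by auto
  define L' where "L' = max L 0"
  \<comment> \<open>Chosen with \<beta> e = \<alpha> / 2, so that Young's inequality uses up half of
    the coercive term.\<close>
  define e where "e = \<alpha> / (2 * \<beta>)"
  have e: "e > 0" using alpha beta by (simp add: e_def)
  define C1 where "C1 = \<beta> * e powr (1 - p) * L' powr p"
  have C1: "0 \<le> C1" using beta by (simp add: C1_def)
  \<comment> \<open>A lower bound for the source \<open>h 0\<close> where the solution is at most 1:
    its base is then at most 2.\<close>
  define c0 :: real where "c0 = 2 powr (- \<gamma>1)"
  have c0: "0 < c0" by (simp add: c0_def)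
  \<comment> \<open>C2 k^(p - 1) will bound the measure of the first superlevel set, as shown in
    \<open>start\<close>.\<close>
  define C2 where "C2 = 4 * C1 * mass / c0"
  define C3 where "C3 = 2 powr p * (L' powr p + 2 * C1 / \<alpha>)"
  have C3: "0 \<le> C3" using C1 alpha by (simp add: C3_def)
  define q where "q = \<kappa> * p"
  have q: "q > 0" using kappa p by (simp add: q_def)
  \<comment> \<open>The 8 comes from the gaps k / 8 times 2^(- j) between the levels used below, and
    \<open>C3\<close> from the energy estimate on a superlevel set.\<close>
  define C5 where "C5 = S * C3 powr \<kappa> * 8 powr q"
  have C5: "0 \<le> C5" using S_nonneg by (simp add: C5_def)
  obtain d where d: "0 < d"
    "\<And>Y::nat\<Rightarrow>real. (\<And>j. 0 \<le> Y j) \<Longrightarrow> (\<And>j. Y (Suc j) \<le> C5 * (2 powr q) ^ j * Y j powr \<kappa>) \<Longrightarrow>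
       Y 0 \<le> d \<Longrightarrow> Y \<longlonglongrightarrow> 0"
    using fast_geometric_convergence[of C5 "2 powr q" \<kappa>] C5 q kappa by auto
  have C20: "0 \<le> C2" using C1 c0 by (simp add: C2_def)
  \<comment> \<open>The bound by 1 keeps k N below 1, where the source is at least
    \<open>c0\<close>; the other bound brings the first superlevel set under the threshold
    \<open>d\<close>.\<close>
  define k where "k = min 1 ((d / (C2 + 1)) powr (1 / (p - 1)))"
  have k: "0 < k" "k \<le> 1" using d C20 by (auto simp: k_def)
  have "k powr (p - 1) \<le> ((d / (C2 + 1)) powr (1 / (p - 1))) powr (p - 1)"
    using k p by (intro powr_mono2) (auto simp: k_def)
  also have "\<dots> = d / (C2 + 1)" using p d C20 by (simp add: powr_powr)
  finally have "C2 * k powr (p - 1) \<le> C2 * (d / (C2 + 1))" using C20 by (intro mult_left_mono)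
  also have "\<dots> \<le> d" using d C20 by (simp add: field_simps)
  finally have kd: "C2 * k powr (p - 1) \<le> d" .

  let ?u = "\<lambda>x. fst (sol 0 x)" and ?v = "\<lambda>x. snd (sol 0 x)"
  define Z where "Z = (\<lambda>x. k *\<^sub>R N x - sol 0 x)"
  have Z: "Z \<in> V" unfolding Z_def by (intro V_diff V_scaleR N sol)
  have [measurable]: "Z \<in> borel_measurable M" "N \<in> borel_measurable M" using Z N by measurable
  define A where "A = (\<lambda>s. {x \<in> space M. s < fst (Z x)})"
  have [measurable]: "A s \<in> sets M" for s unfolding A_def by measurable
  define \<Phi> where "\<Phi> = (\<lambda>s. measure M (A s))"
  have \<Phi>0: "0 \<le> \<Phi> s" for s by (simp add: \<Phi>_def)
  define W where "W = (\<lambda>s x. (max 0 (fst (Z x) - s), if s < fst (Z x) then snd (Z x) else 0))"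
  have W: "W s \<in> V" if "0 \<le> s" for s unfolding W_def by (rule V_truncate[OF Z that])
  define I where "I = (\<lambda>s. \<integral>x. indicator (A s) x * norm (?v x) powr p \<partial>M)"
  have iv: "integrable M (\<lambda>x. indicator (A s) x * norm (?v x) powr p)" for s
    using integrable_mult_indicator[of "A s" M "\<lambda>x. norm (?v x) powr p"]
      Lspace_integrable[OF V_snd[OF sol[of 0]]] by simp
  have iA: "integrable M (\<lambda>x. indicator (A s) x :: real)" for s
    by (intro integrable_real_indicator) (auto simp: emeasure_eq_measure)

  have I0: "0 \<le> I s" for s
    unfolding I_def by (intro Bochner_Integration.integral_nonneg) simp

  \<comment> \<open>The test pair is the truncation of k N - u at level \<open>s\<close>, with
    gradient k grad N - grad u on \<open>A s\<close>. The source term is kept on the left: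
    \<open>start\<close> uses it, \<open>recursion\<close> discards it.\<close>
  have energy_ineq: "\<alpha> / 2 * I s + (\<integral>x. h 0 x (?u x) * fst (W s x) \<partial>M) \<le> C1 * k powr p * \<Phi> s"
    if s: "0 \<le> s" for s
  proof -
    have "(\<integral>x. h 0 x (?u x) * fst (W s x) \<partial>M) = (\<integral>x. a x (?v x) \<bullet> snd (W s x) \<partial>M)"
      using sol_eq[OF W[OF s]] by simp
    also have "\<dots> \<le> (\<integral>x. C1 * k powr p * indicator (A s) x
        - \<alpha> / 2 * (indicator (A s) x * norm (?v x) powr p) \<partial>M)"
    proof (rule integral_mono_AE)
      show "integrable M (\<lambda>x. a x (?v x) \<bullet> snd (W s x))" by (intro a_integrable V_snd sol W s)
      show "integrable M (\<lambda>x. C1 * k powr p * indicator (A s) x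
        - \<alpha> / 2 * (indicator (A s) x * norm (?v x) powr p))"
        by (intro Bochner_Integration.integrable_diff integrable_mult_right iv iA)
      show "AE x in M. a x (?v x) \<bullet> snd (W s x) \<le> C1 * k powr p * indicator (A s) x
        - \<alpha> / 2 * (indicator (A s) x * norm (?v x) powr p)"
        using LL AE_space
      proof eventually_elim
        fix x assume Lx: "norm (snd (N x)) \<le> max L 0" and x: "x \<in> space M"
        show "a x (?v x) \<bullet> snd (W s x) \<le> C1 * k powr p * indicator (A s) x
          - \<alpha> / 2 * (indicator (A s) x * norm (?v x) powr p)"
        proof (cases "s < fst (Z x)")
          case True
          have "a x (?v x) \<bullet> (k *\<^sub>R snd (N x)) \<le> norm (a x (?v x)) * norm (k *\<^sub>R snd (N x))"
            by (rule norm_cauchy_schwarz)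
          also have "\<dots> \<le> (\<beta> * norm (?v x) powr (p - 1)) * (k * L')"
            using Lx k L0 beta a_growth[of x "?v x"] by (intro mult_mono) (auto simp: L'_def)
          also have "\<dots> = \<beta> * (norm (?v x) powr (p - 1) * (k * L'))" by simp
          also have "\<dots> \<le> \<beta> * (e * norm (?v x) powr p + e powr (1 - p) * (k * L') powr p)"
            using beta k e by (intro mult_left_mono powr_mult_le_add p) (auto simp: L'_def)
          also have "\<dots> = \<alpha> / 2 * norm (?v x) powr p + C1 * k powr p"
            using beta k by (simp add: e_def C1_def powr_mult L'_def algebra_simps)
          finally have "a x (?v x) \<bullet> (k *\<^sub>R snd (N x)) \<le> \<alpha> / 2 * norm (?v x) powr p + C1 * k powr p" .
          moreover have "\<alpha> * norm (?v x) powr p \<le> a x (?v x) \<bullet> ?v x" by (rule a_coercive)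
          ultimately have "a x (?v x) \<bullet> (k *\<^sub>R snd (N x) - ?v x) \<le> C1 * k powr p - \<alpha> / 2 * norm (?v x) powr p"
            by (simp add: inner_diff_right)
          then show ?thesis using True x by (simp add: W_def A_def Z_def)
        qed (simp add: W_def A_def)
      qed
    qed
    also have "\<dots> = C1 * k powr p * \<Phi> s - \<alpha> / 2 * I s"
      using iv[of s] iA[of s] by (simp add: I_def \<Phi>_def)
    finally show ?thesis by simp
  qed

  have measure_le: "(t - s) powr r * \<Phi> t \<le> (\<integral>x. \<bar>fst (W s x)\<bar> powr r \<partial>M)"
    if "s \<le> t" "0 < r" "integrable M (\<lambda>x. \<bar>fst (W s x)\<bar> powr r)" for s t r
  proof -
    have "(t - s) powr r * \<Phi> t = (\<integral>x. (t - s) powr r * indicator (A t) x \<partial>M)"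
      by (simp add: \<Phi>_def)
    also have "\<dots> \<le> (\<integral>x. \<bar>fst (W s x)\<bar> powr r \<partial>M)"
      using that by (intro integral_mono integrable_mult_right iA)
        (auto simp: indicator_def A_def W_def intro!: powr_mono2)
    finally show ?thesis .
  qed

  \<comment> \<open>On the set in question u < k N \<le> 1, so the source is at least
    \<open>c0\<close>. The energy contributes k^p and Chebyshev's inequality costs one factor k,
    which leaves k^(p - 1).\<close>
  have start: "\<Phi> (k / 4) \<le> d"
  proof -
    have i0: "integrable M (\<lambda>x. fst (W 0 x))" by (intro integrable_fst W) simp
    have "c0 * (\<integral>x. fst (W 0 x) \<partial>M) = (\<integral>x. c0 * fst (W 0 x) \<partial>M)" by simp
    also have "\<dots> \<le> (\<integral>x. h 0 x (?u x) * fst (W 0 x) \<partial>M)"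
    proof (rule integral_mono_AE)
      show "integrable M (\<lambda>x. c0 * fst (W 0 x))" using i0 by simp
      show "integrable M (\<lambda>x. h 0 x (?u x) * fst (W 0 x))" by (intro h_integrable i0) measurable
      show "AE x in M. c0 * fst (W 0 x) \<le> h 0 x (?u x) * fst (W 0 x)"
        using N1
      proof eventually_elim
        fix x assume Nx: "fst (N x) \<le> 1"
        show "c0 * fst (W 0 x) \<le> h 0 x (?u x) * fst (W 0 x)"
        proof (cases "0 < fst (Z x)")
          case True
          then have "?u x < k * fst (N x)" by (simp add: Z_def)
          also have "\<dots> \<le> 1" using k Nx mult_left_le[of "fst (N x)" k] by linarith
          finally have "h 0 x 1 \<le> h 0 x (?u x)" by (intro h_antimono) simp
          moreover have "c0 \<le> h 0 x 1" unfolding c0_def h_def using gamma(2)[of x] by simp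
          ultimately show ?thesis by (intro mult_right_mono) (auto simp: W_def)
        qed (simp add: W_def)
      qed
    qed
    also have "\<dots> \<le> C1 * k powr p * \<Phi> 0"
      using energy_ineq[of 0] I0[of 0] alpha
        mult_nonneg_nonneg[of "\<alpha> / 2" "I 0"] by linarith
    also have "\<dots> \<le> C1 * k powr p * mass"
      using C1 by (intro mult_left_mono) (auto simp: \<Phi>_def intro: bounded_measure)
    finally have le: "(\<integral>x. fst (W 0 x) \<partial>M) \<le> C1 * k powr p * mass / c0"
      using c0 by (simp add: field_simps)
    have "k / 4 * \<Phi> (k / 4) \<le> (\<integral>x. fst (W 0 x) \<partial>M)"
      using measure_le[of 0 "k / 4" 1] k i0 by (simp add: W_def)
    also note le
    finally have "4 / k * (k / 4 * \<Phi> (k / 4)) \<le> 4 / k * (C1 * k powr p * mass / c0)"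
      using k by (intro mult_left_mono) auto
    then have "\<Phi> (k / 4) \<le> 4 / k * (C1 * k powr p * mass / c0)" using k by simp
    also have "k powr p = k * k powr (p - 1)"
    proof -
      have "k powr p = k powr 1 * k powr (p - 1)" by (simp only: powr_add[symmetric]) simp
      then show ?thesis using k by simp
    qed
    also have "4 / k * (C1 * (k * k powr (p - 1)) * mass / c0) = C2 * k powr (p - 1)"
      using k by (simp add: C2_def)
    finally show ?thesis using kd by simp
  qed

  \<comment> \<open>The gradient energy of the truncation at \<open>s\<close> is controlled by the
    measure of \<open>A s\<close>; the Sobolev and Chebyshev inequalities turn this into a
    superlinear bound at the higher level \<open>t\<close>.\<close>
  have recursion: "(t - s) powr q * \<Phi> t \<le> S * (C3 * k powr p * \<Phi> s) powr \<kappa>"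
    if s: "0 \<le> s" and t: "s < t" for s t
  proof -
    have "0 \<le> (\<integral>x. h 0 x (?u x) * fst (W s x) \<partial>M)"
      using h_pos by (intro Bochner_Integration.integral_nonneg) (auto simp: W_def less_imp_le)
    then have "\<alpha> / 2 * I s \<le> C1 * k powr p * \<Phi> s" using energy_ineq[OF s] by linarith
    then have Is: "I s \<le> 2 * C1 / \<alpha> * k powr p * \<Phi> s" using alpha by (simp add: field_simps)
    have "energy M p (\<lambda>x. snd (W s x))
      \<le> (\<integral>x. 2 powr p * ((k * L') powr p * indicator (A s) x + indicator (A s) x * norm (?v x) powr p) \<partial>M)"
      unfolding energy_def
    proof (rule integral_mono_AE)
      show "integrable M (\<lambda>x. norm (snd (W s x)) powr p)" by (intro Lspace_integrable V_snd W s)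
      show "integrable M (\<lambda>x. 2 powr p * ((k * L') powr p * indicator (A s) x + indicator (A s) x * norm (?v x) powr p))"
        by (intro integrable_mult_right Bochner_Integration.integrable_add iA iv)
      show "AE x in M. norm (snd (W s x)) powr p
        \<le> 2 powr p * ((k * L') powr p * indicator (A s) x + indicator (A s) x * norm (?v x) powr p)"
        using LL AE_space
      proof eventually_elim
        fix x assume Lx: "norm (snd (N x)) \<le> max L 0" and x: "x \<in> space M"
        show "norm (snd (W s x)) powr p
        \<le> 2 powr p * ((k * L') powr p * indicator (A s) x + indicator (A s) x * norm (?v x) powr p)"
        proof (cases "s < fst (Z x)")
          case True
          have "norm (snd (W s x)) powr p \<le> 2 powr p * (norm (k *\<^sub>R snd (N x)) powr p + norm (?v x) powr p)"
            using norm_diff_powr_le[OF p_nonneg, of "k *\<^sub>R snd (N x)" "?v x"] True by (simp add: W_def Z_def)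
          also have "\<dots> \<le> 2 powr p * ((k * L') powr p + norm (?v x) powr p)"
            using Lx k p by (intro mult_left_mono add_right_mono powr_mono2) (auto simp: L'_def)
          finally show ?thesis using True x by (simp add: A_def)
        qed (use p in \<open>simp add: W_def A_def\<close>)
      qed
    qed
    also have "\<dots> = 2 powr p * ((k * L') powr p * \<Phi> s + I s)"
      using iA[of s] iv[of s] by (simp add: I_def \<Phi>_def)
    also have "\<dots> \<le> 2 powr p * ((k * L') powr p * \<Phi> s + 2 * C1 / \<alpha> * k powr p * \<Phi> s)"
      using Is by (intro mult_left_mono add_left_mono) auto
    also have "\<dots> = C3 * k powr p * \<Phi> s"
      using k by (simp add: C3_def powr_mult L'_def algebra_simps)
    finally have en: "energy M p (\<lambda>x. snd (W s x)) \<le> C3 * k powr p * \<Phi> s" .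
    have "(t - s) powr q * \<Phi> t \<le> (\<integral>x. \<bar>fst (W s x)\<bar> powr q \<partial>M)"
      using t q sobolev_integrable[OF W[OF s]] by (intro measure_le) (auto simp: q_def)
    also have "\<dots> \<le> S * energy M p (\<lambda>x. snd (W s x)) powr \<kappa>"
      unfolding q_def by (intro sobolev W s)
    also have "\<dots> \<le> S * (C3 * k powr p * \<Phi> s) powr \<kappa>"
      using en S_nonneg kappa by (intro mult_left_mono powr_mono2) (auto simp: energy_nonneg)
    finally show ?thesis .
  qed

  \<comment> \<open>The levels rise from k / 4 towards k / 2, with gaps k / 8 times 2^(- j).\<close>
  define s where "s = (\<lambda>j::nat. k * (1/2 - 1/4 * (1/2)^j))"
  have s0: "0 \<le> s j" "s j < k / 2" for j
  proof -
    have "(1/2::real)^j \<le> 1" by (rule power_le_one) auto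
    then show "0 \<le> s j" "s j < k / 2" using k by (auto simp: s_def)
  qed
  have sd: "s (Suc j) - s j = (k / 8) * (1/2)^j" for j by (simp add: s_def algebra_simps)
  have "(\<lambda>j. \<Phi> (s j)) \<longlonglongrightarrow> 0"
  proof (rule d(2))
    fix j
    have pos: "0 < s (Suc j) - s j" unfolding sd using k by simp
    have "(s (Suc j) - s j) powr q * \<Phi> (s (Suc j)) \<le> S * (C3 * k powr p * \<Phi> (s j)) powr \<kappa>"
      using pos by (intro recursion s0) auto
    also have "(C3 * k powr p * \<Phi> (s j)) powr \<kappa> = C3 powr \<kappa> * k powr q * \<Phi> (s j) powr \<kappa>"
      using C3 \<Phi>0 by (simp add: powr_mult powr_powr q_def mult.commute)
    finally have le: "(s (Suc j) - s j) powr q * \<Phi> (s (Suc j)) \<le> S * (C3 powr \<kappa> * k powr q * \<Phi> (s j) powr \<kappa>)" .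
    have "(s (Suc j) - s j) powr q = (k / (8 * 2 ^ j)) powr q"
      unfolding sd by (simp add: power_one_over)
    also have "\<dots> = k powr q / (8 * 2 ^ j) powr q" by (rule powr_divide)
    also have "(8 * 2 ^ j) powr q = 8 powr q * (2 powr q) ^ j"
      by (simp add: powr_mult powr_realpow[symmetric] powr_powr mult.commute)
    \<comment> \<open>The factor k^q occurs on both sides; its cancellation keeps \<open>C5\<close>,
      and with it the threshold \<open>d\<close>, independent of \<open>k\<close>.\<close>
    finally have "k powr q / (8 powr q * (2 powr q) ^ j) * \<Phi> (s (Suc j))
        \<le> k powr q * (S * C3 powr \<kappa> * \<Phi> (s j) powr \<kappa>)" using le by (simp add: mult_ac)
    then have "\<Phi> (s (Suc j)) / (8 powr q * (2 powr q) ^ j) \<le> S * C3 powr \<kappa> * \<Phi> (s j) powr \<kappa>"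
      using k by (simp only: times_divide_eq_left times_divide_eq_right[symmetric] mult_le_cancel_left_pos powr_gt_zero)
    then show "\<Phi> (s (Suc j)) \<le> C5 * (2 powr q) ^ j * \<Phi> (s j) powr \<kappa>"
      by (simp add: C5_def pos_divide_le_eq mult_ac)
  qed (use \<Phi>0 start in \<open>auto simp: s_def\<close>)
  moreover have "\<Phi> (k / 2) \<le> \<Phi> (s j)" for j
    unfolding \<Phi>_def using s0(2)[of j] by (intro finite_measure_mono) (auto simp: A_def)
  ultimately have "\<Phi> (k / 2) \<le> 0" by (intro LIMSEQ_le_const) auto
  then have "measure M (A (k / 2)) = 0"
    using measure_nonneg[of M "A (k / 2)"] unfolding \<Phi>_def by linarith
  then have "A (k / 2) \<in> null_sets M" by (simp add: null_sets_def emeasure_eq_measure)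
  then have "AE x in M. x \<notin> A (k / 2)" by (rule AE_not_in)
  then have "AE x in M. k * (fst (N x) - 1/2) \<le> fst (sol 0 x)"
    using AE_space by eventually_elim (auto simp: A_def Z_def algebra_simps)
  then show ?thesis using k(1) that by blast
qed

section \<open>Estimates uniform in n and passage to the limit\<close>

lemma h_le_powr:
  assumes "0 < c" "c \<le> s"
  shows "h n x s \<le> 1 + c powr (- \<gamma>1)"
proof -
  have "h n x s \<le> c powr (- \<gamma> x)"
    unfolding h_def using assms gamma(1)[of x] by (intro powr_mono2') (auto intro!: add_increasing2)
  \<comment> \<open>The summand 1 covers \<open>c \<ge> 1\<close>; the power with the largest
    exponent covers \<open>c < 1\<close>.\<close>
  also have "\<dots> \<le> 1 + c powr (- \<gamma>1)"
  proof (cases "1 \<le> c")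
    case True
    then have "c powr (- \<gamma> x) \<le> c powr 0" using gamma(1)[of x] by (intro powr_mono) auto
    then show ?thesis using assms by (simp add: add_increasing2)
  next
    case False
    then have "c powr (- \<gamma> x) \<le> c powr (- \<gamma>1)"
      using assms gamma(2)[of x] by (intro powr_mono') auto
    then show ?thesis by simp
  qed
  finally show ?thesis .
qed

text \<open>Testing with the solution itself leaves the product h u. Where the exponent may exceed
  1, u_n \<ge> u_0 \<ge> c bounds \<open>h\<close> uniformly in \<open>n\<close>; elsewhere the
  product is at most u^(1 - \<gamma>). In both cases it grows at most linearly in u and is
  absorbed.\<close>

lemma sol_gradient_bound:
  assumes c: "0 < c" and split: "AE x in M. \<gamma> x \<le> 1 \<or> c \<le> fst (sol 0 x)"
  obtains R where "\<And>n. energy M p (\<lambda>x. snd (sol n x)) \<le> R"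
proof -
  define B where "B = 1 + c powr (- \<gamma>1)"
  have B: "1 \<le> B" by (simp add: B_def)
  obtain C where C: "0 \<le> C" "\<And>U. U \<in> V \<Longrightarrow> B * (\<integral>x. \<bar>fst (U x)\<bar> \<partial>M) \<le> \<alpha> / 2 * energy M p (\<lambda>x. snd (U x)) + C"
    using integral_fst_absorb[of B "\<alpha> / 2"] alpha B by auto
  have "energy M p (\<lambda>x. snd (sol n x)) \<le> 2 / \<alpha> * (B * mass + C)" for n
  proof -
    note i = integrable_fst[OF sol[of n]]
    have "\<alpha> * energy M p (\<lambda>x. snd (sol n x)) \<le> (\<integral>x. h n x (fst (sol n x)) * fst (sol n x) \<partial>M)"
      using coercive_integral[OF sol] sol_eq[OF sol] by simp
    also have "\<dots> \<le> (\<integral>x. B * (1 + \<bar>fst (sol n x)\<bar>) \<partial>M)"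
    proof (rule integral_mono_AE)
      show "integrable M (\<lambda>x. h n x (fst (sol n x)) * fst (sol n x))" by (intro h_integrable i) measurable
      show "integrable M (\<lambda>x. B * (1 + \<bar>fst (sol n x)\<bar>))" using i by simp
      show "AE x in M. h n x (fst (sol n x)) * fst (sol n x) \<le> B * (1 + \<bar>fst (sol n x)\<bar>)"
        using split sol_nonneg[of n] sol_mono
      proof eventually_elim
        fix x assume *: "\<gamma> x \<le> 1 \<or> c \<le> fst (sol 0 x)" "0 \<le> fst (sol n x)" "mono (\<lambda>n. fst (sol n x))"
        let ?s = "fst (sol n x)"
        have m: "fst (sol 0 x) \<le> ?s" using monoD[OF *(3), of 0 n] by simp
        have "h n x ?s * ?s \<le> B * (1 + ?s)"
        proof (cases "c \<le> fst (sol 0 x)")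
          case True
          then have "h n x ?s \<le> B" unfolding B_def using m c by (intro h_le_powr) auto
          then have "h n x ?s * ?s \<le> B * ?s" using * by (intro mult_right_mono) auto
          then show ?thesis using B by (simp add: distrib_left)
        next
          case False
          then have g: "\<gamma> x \<le> 1" using * by simp
          show ?thesis
          proof (cases "?s = 0")
            case False
            then have s: "?s > 0" using * by simp
            then have "h n x ?s \<le> ?s powr (- \<gamma> x)"
              unfolding h_def using gamma(1)[of x] by (intro powr_mono2') auto
            then have "h n x ?s * ?s \<le> ?s powr (- \<gamma> x) * ?s powr 1" using s by simp
            also have "\<dots> = ?s powr (1 - \<gamma> x)" by (simp only: powr_add[symmetric]) simp
            also have "\<dots> \<le> 1 + ?s"
            proof (cases "?s \<le> 1")
              case True
              then have "?s powr (1 - \<gamma> x) \<le> 1" using g s by (intro powr_le1) auto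
              then show ?thesis using s by simp
            next
              case False
              then have "?s powr (1 - \<gamma> x) \<le> ?s powr 1" using gamma(1)[of x] by (intro powr_mono) auto
              then show ?thesis using s by simp
            qed
            also have "\<dots> \<le> B * (1 + ?s)" using B s by (simp add: mult_le_cancel_right1)
            finally show ?thesis .
          qed (use B in simp)
        qed
        then show "h n x ?s * ?s \<le> B * (1 + \<bar>?s\<bar>)" using * by simp
      qed
    qed
    also have "\<dots> = B * mass + B * (\<integral>x. \<bar>fst (sol n x)\<bar> \<partial>M)"
      using i by (simp add: distrib_left)
    also have "\<dots> \<le> B * mass + (\<alpha> / 2 * energy M p (\<lambda>x. snd (sol n x)) + C)"
      by (intro add_left_mono C sol)
    finally show ?thesis using alpha by (simp add: field_simps)
  qed
  then show ?thesis by (rule that)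
qed

text \<open>Admissible test pairs are bounded and live where u_0 \<ge> k. There the regularized
  sources are bounded uniformly in \<open>n\<close>, so the right-hand sides converge by dominated
  convergence without any global integrability of the singular term.\<close>

theorem singular_solution_exists:
  assumes c: "0 < c" and split: "AE x in M. \<gamma> x \<le> 1 \<or> c \<le> fst (sol 0 x)"
  obtains U where "U \<in> V" "AE x in M. fst (sol 0 x) \<le> fst (U x)"
    "\<And>N k B. N \<in> V \<Longrightarrow> 0 < k \<Longrightarrow> AE x in M. fst (N x) \<noteq> 0 \<longrightarrow> k \<le> fst (sol 0 x) \<Longrightarrow>
       AE x in M. \<bar>fst (N x)\<bar> \<le> B \<Longrightarrow>
       integrable M (\<lambda>x. fst (U x) powr (- \<gamma> x) * fst (N x)) \<and>
       (\<integral>x. a x (snd (U x)) \<bullet> snd (N x) \<partial>M) = (\<integral>x. fst (U x) powr (- \<gamma> x) * fst (N x) \<partial>M)"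
proof -
  obtain R where R: "\<And>n. energy M p (\<lambda>x. snd (sol n x)) \<le> R" using sol_gradient_bound[OF assms] by blast
  have solL: "sol n \<in> Lspace M p" for n using sol V_Lspace by blast
  have "energy M p (sol n) \<le> 2 powr p * (mass + S + 1) * R" for n
    using S_nonneg by (intro order_trans[OF energy_le_gradient[OF sol]] mult_left_mono R) auto
  then obtain U where UL: "U \<in> Lspace M p" and
    lim: "\<And>n. \<exists>Y. (\<forall>k::nat. Y k \<in> midpoint_hull (sol ` {n..})) \<and> (\<lambda>k. energy M p (\<lambda>x. Y k x - U x)) \<longlonglongrightarrow> 0"
    using bounded_sequence_midpoint_limit[of sol, OF solL] by blast
  have hullV: "Y \<in> V" if "Y \<in> midpoint_hull (sol ` {n..})" for Y n
    using that by induction (auto intro: sol V_scaleR V_add)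
  have hullL: "Y \<in> Lspace M p" if "Y \<in> midpoint_hull (sol ` {n..})" for Y n
    using hullV[OF that] V_Lspace by blast
  obtain Y0 where Y0: "\<And>k::nat. Y0 k \<in> midpoint_hull (sol ` {0..})" "(\<lambda>k. energy M p (\<lambda>x. Y0 k x - U x)) \<longlonglongrightarrow> 0"
    using lim[of 0] by blast
  have U: "U \<in> V" by (rule V_closed[OF hullV[OF Y0(1)] UL Y0(2)])
  have [measurable]: "U \<in> borel_measurable M" using U by measurable

  \<comment> \<open>Combinations of the tail beginning at \<open>n\<close> stay above u_n by
    monotonicity in the index, and so does their limit.\<close>
  have sol_le: "AE x in M. fst (sol n x) \<le> fst (U x)" for n
  proof -
    obtain Y where Y: "\<And>k::nat. Y k \<in> midpoint_hull (sol ` {n..})" "(\<lambda>k. energy M p (\<lambda>x. Y k x - U x)) \<longlonglongrightarrow> 0"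
      using lim[of n] by blast
    have "AE x in M. fst (sol n x) \<le> fst (Z x)" if "Z \<in> midpoint_hull (sol ` {n..})" for Z
      using that
    proof induction
      case (base Z)
      then obtain m where "Z = sol m" "n \<le> m" by auto
      then show ?case using sol_mono by (auto elim!: eventually_mono dest: monoD)
    next
      case (mid X Z)
      from mid.IH show ?case by eventually_elim auto
    qed
    then have ge: "AE x in M. \<forall>k. fst (sol n x) \<le> fst (Y k x)"
      using Y(1) by (simp add: AE_all_countable)
    obtain r :: "nat \<Rightarrow> nat" where r: "AE x in M. (\<lambda>k. Y (r k) x) \<longlonglongrightarrow> U x"
      using AE_convergent_subsequence[OF hullL[OF Y(1)] UL Y(2)] by blast
    show ?thesis using r ge
    proof eventually_elim
      fix x assume "(\<lambda>k. Y (r k) x) \<longlonglongrightarrow> U x" and *: "\<forall>k. fst (sol n x) \<le> fst (Y k x)"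
      then have "(\<lambda>k. fst (Y (r k) x)) \<longlonglongrightarrow> fst (U x)" by (intro tendsto_intros)
      then show "fst (sol n x) \<le> fst (U x)" using * by (intro LIMSEQ_le_const) auto
    qed
  qed
  then have sol_le_all: "AE x in M. \<forall>n. fst (sol n x) \<le> fst (U x)" by (simp add: AE_all_countable)
  \<comment> \<open>The combinations also stay below the supremum, so U lies below
    \<open>ubar\<close>. Together with \<open>sol_le\<close> this upgrades the limit of combinations
    to pointwise convergence of the sequence itself.\<close>
  define ubar where "ubar = (\<lambda>x. SUP n. fst (sol n x))"
  have bound: "AE x in M. bdd_above (range (\<lambda>n. fst (sol n x)))"
    using sol_le_all by eventually_elim (auto intro!: bdd_aboveI)
  have le_ubar: "AE x in M. fst (Z x) \<le> ubar x" if "Z \<in> midpoint_hull (sol ` {0..})" for Z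
    using that
  proof induction
    case (base Z)
    then obtain m where m: "Z = sol m" by auto
    show ?case using bound by eventually_elim (auto simp: m ubar_def intro: cSUP_upper)
  next
    case (mid X Z)
    from mid.IH show ?case by eventually_elim auto
  qed
  have conv: "AE x in M. (\<lambda>n. fst (sol n x)) \<longlonglongrightarrow> fst (U x)"
  proof -
    have ge: "AE x in M. \<forall>k. fst (Y0 k x) \<le> ubar x"
      using le_ubar Y0(1) by (simp add: AE_all_countable)
    obtain r :: "nat \<Rightarrow> nat" where r: "AE x in M. (\<lambda>k. Y0 (r k) x) \<longlonglongrightarrow> U x"
      using AE_convergent_subsequence[OF hullL[OF Y0(1)] UL Y0(2)] by blast
    show ?thesis using r ge sol_le_all bound sol_mono
    proof eventually_elim
      fix x assume *: "(\<lambda>k. Y0 (r k) x) \<longlonglongrightarrow> U x" "\<forall>k. fst (Y0 k x) \<le> ubar x"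
        "\<forall>n. fst (sol n x) \<le> fst (U x)" "bdd_above (range (\<lambda>n. fst (sol n x)))" "mono (\<lambda>n. fst (sol n x))"
      have "(\<lambda>k. fst (Y0 (r k) x)) \<longlonglongrightarrow> fst (U x)" using *(1) by (intro tendsto_intros)
      then have "fst (U x) \<le> ubar x" using *(2) by (intro LIMSEQ_le_const2) auto
      moreover have "ubar x \<le> fst (U x)" unfolding ubar_def using *(3) by (intro cSUP_least) auto
      moreover have "(\<lambda>n. fst (sol n x)) \<longlonglongrightarrow> ubar x"
        unfolding ubar_def using *(4,5) by (intro LIMSEQ_incseq_SUP) auto
      ultimately show "(\<lambda>n. fst (sol n x)) \<longlonglongrightarrow> fst (U x)" by simp
    qed
  qed

  show ?thesis
  proof (rule that[OF U sol_le])
    fix N k B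
    assume N: "N \<in> V" and k: "0 < k" and Nk: "AE x in M. fst (N x) \<noteq> 0 \<longrightarrow> k \<le> fst (sol 0 x)"
      and NB: "AE x in M. \<bar>fst (N x)\<bar> \<le> B"
    have [measurable]: "N \<in> borel_measurable M" using N by measurable
    define C where "C = 1 + k powr (- \<gamma>1)"
    define l where "l = (\<lambda>n. \<integral>x. h n x (fst (sol n x)) * fst (N x) \<partial>M)"
    define l0 where "l0 = (\<integral>x. fst (U x) powr (- \<gamma> x) * fst (N x) \<partial>M)"
    have C: "0 \<le> C" by (simp add: C_def)
    have bd: "AE x in M. norm (h n x (fst (sol n x)) * fst (N x)) \<le> C * B" for n
      using Nk NB sol_mono
    proof eventually_elim
      fix x assume *: "fst (N x) \<noteq> 0 \<longrightarrow> k \<le> fst (sol 0 x)" "\<bar>fst (N x)\<bar> \<le> B" "mono (\<lambda>n. fst (sol n x))"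
      have B: "0 \<le> B" using *(2) by linarith
      show "norm (h n x (fst (sol n x)) * fst (N x)) \<le> C * B"
      proof (cases "fst (N x) = 0")
        case False
        then have "k \<le> fst (sol n x)" using * monoD[OF *(3), of 0 n] by auto
        then have "h n x (fst (sol n x)) \<le> C" unfolding C_def using k by (intro h_le_powr)
        then have "h n x (fst (sol n x)) * \<bar>fst (N x)\<bar> \<le> C * B"
          using * C by (intro mult_mono) auto
        then show ?thesis using h_pos[of n x "fst (sol n x)"] by (simp add: abs_mult)
      qed (use C B in simp)
    qed
    have lim_h: "AE x in M. (\<lambda>n. h n x (fst (sol n x)) * fst (N x)) \<longlonglongrightarrow> fst (U x) powr (- \<gamma> x) * fst (N x)"
      using Nk conv sol_le[of 0]
    proof eventually_elim
      fix x assume *: "fst (N x) \<noteq> 0 \<longrightarrow> k \<le> fst (sol 0 x)" "(\<lambda>n. fst (sol n x)) \<longlonglongrightarrow> fst (U x)"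
        "fst (sol 0 x) \<le> fst (U x)"
      show "(\<lambda>n. h n x (fst (sol n x)) * fst (N x)) \<longlonglongrightarrow> fst (U x) powr (- \<gamma> x) * fst (N x)"
      proof (cases "fst (N x) = 0")
        case False
        then have U0: "fst (U x) > 0" using * k by auto
        have "(\<lambda>n. 1 / real (Suc n)) \<longlonglongrightarrow> 0" by (rule one_over_Suc_tendsto_0)
        then have "(\<lambda>n. max (fst (sol n x)) 0 + 1 / real (Suc n)) \<longlonglongrightarrow> max (fst (U x)) 0 + 0"
          by (intro tendsto_intros *)
        then have "(\<lambda>n. h n x (fst (sol n x))) \<longlonglongrightarrow> fst (U x) powr (- \<gamma> x)"
          unfolding h_def using U0 by (intro tendsto_powr tendsto_const) auto
        then show ?thesis by (intro tendsto_intros)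
      qed simp
    qed
    note dom = integral_dominated_convergence[of _ M "\<lambda>n x. h n x (fst (sol n x)) * fst (N x)" "\<lambda>x. C * B", OF _ _ _ lim_h bd]
      and dom' = integrable_dominated_convergence[of _ M "\<lambda>n x. h n x (fst (sol n x)) * fst (N x)" "\<lambda>x. C * B", OF _ _ _ lim_h bd]
    have ll: "l \<longlonglongrightarrow> l0" unfolding l_def l0_def by (rule dom) auto
    have int: "integrable M (\<lambda>x. fst (U x) powr (- \<gamma> x) * fst (N x))" by (rule dom') auto
    have iN: "integrable M (\<lambda>x. fst (N x))" by (rule integrable_fst[OF N])

    \<comment> \<open>With P = U + t N, monotonicity exchanges the unknown field at u_n for the
      fixed field at \<open>P\<close>, against which u_n enters linearly.\<close>
    have minty: "t * l0 \<le> (\<integral>x. a x (snd (U x) + t *\<^sub>R snd (N x)) \<bullet> (t *\<^sub>R snd (N x)) \<partial>M)" for t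
    proof -
      define P where "P = (\<lambda>x. U x + t *\<^sub>R N x)"
      have P: "P \<in> V" unfolding P_def by (intro V_add V_scaleR U N)
      have [measurable]: "P \<in> borel_measurable M" using P by measurable
      define J where "J = (\<lambda>Y::'a \<Rightarrow> real \<times> 'b. \<integral>x. a x (snd (P x)) \<bullet> snd (Y x) \<partial>M)"
      have Ji: "integrable M (\<lambda>x. a x (snd (P x)) \<bullet> snd (Y x))" if "Y \<in> V" for Y
        by (intro a_integrable V_snd P that)
      have step: "t * l n \<le> J P - J (sol n)" for n
      proof -
        let ?W = "\<lambda>x. P x - sol n x"
        have W: "?W \<in> V" by (intro V_diff P sol)
        \<comment> \<open>P - u_n exceeds t N by U - u_n, which is nonnegative; its product with the
          positive source is dropped.\<close>
        have "t * l n \<le> (\<integral>x. h n x (fst (sol n x)) * fst (?W x) \<partial>M)"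
        proof -
          have "t * l n = (\<integral>x. h n x (fst (sol n x)) * (t * fst (N x)) \<partial>M)"
            unfolding l_def by (simp flip: integral_mult_right_zero add: mult.left_commute)
          also have "\<dots> \<le> (\<integral>x. h n x (fst (sol n x)) * fst (?W x) \<partial>M)"
          proof (rule integral_mono_AE)
            show "integrable M (\<lambda>x. h n x (fst (sol n x)) * (t * fst (N x)))"
              using iN by (intro h_integrable) auto
            show "integrable M (\<lambda>x. h n x (fst (sol n x)) * fst (?W x))"
              by (intro h_integrable integrable_fst W) measurable
            show "AE x in M. h n x (fst (sol n x)) * (t * fst (N x)) \<le> h n x (fst (sol n x)) * fst (?W x)"
              using sol_le[of n]
              by eventually_elim (intro mult_left_mono less_imp_le[OF h_pos], auto simp: P_def)
          qed
          finally show ?thesis .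
        qed
        also have "\<dots> = (\<integral>x. a x (snd (sol n x)) \<bullet> snd (?W x) \<partial>M)" using sol_eq[OF W] by simp
        also have "\<dots> \<le> (\<integral>x. a x (snd (P x)) \<bullet> snd (?W x) \<partial>M)"
          using monotone_operator.T_monotone_integral[OF a_operator V_snd[OF P] V_snd[OF sol]] by simp
        also have "\<dots> = J P - J (sol n)"
          unfolding J_def using Ji[OF P] Ji[OF sol] by (simp add: inner_diff_right)
        finally show ?thesis .
      qed
      have "t * l0 \<le> J P - J U"
      proof (rule field_le_epsilon)
        fix e :: real assume e: "e > 0"
        have "(\<lambda>n. t * l n) \<longlonglongrightarrow> t * l0" by (intro tendsto_intros ll)
        then have "eventually (\<lambda>n. t * l0 - e < t * l n) sequentially"
          using e by (intro order_tendstoD(1)) auto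
        then obtain m where m: "\<And>n. n \<ge> m \<Longrightarrow> t * l0 - e < t * l n"
          by (auto simp: eventually_sequentially)
        \<comment> \<open>\<open>J\<close> is linear, so the inequality for indices beyond
          \<open>m\<close> passes to midpoints of that tail and from there to the strong limit
          \<open>U\<close>.\<close>
        have hull: "J Z \<le> J P - t * l0 + e" if "Z \<in> midpoint_hull (sol ` {m..})" for Z
          using that
        proof induction
          case (base Z)
          then obtain n where "Z = sol n" "n \<ge> m" by auto
          then show ?case using step[of n] m[of n] by simp
        next
          case (mid X Z)
          have "J (\<lambda>x. (1/2) *\<^sub>R (X x + Z x)) = (J X + J Z) / 2"
            using Ji[OF hullV[OF mid.hyps(1)]] Ji[OF hullV[OF mid.hyps(2)]]
            by (simp add: J_def inner_add_right)
          then show ?case using mid.IH by simp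
        qed
        obtain Y where Y: "\<And>k::nat. Y k \<in> midpoint_hull (sol ` {m..})" "(\<lambda>k. energy M p (\<lambda>x. Y k x - U x)) \<longlonglongrightarrow> 0"
          using lim[of m] by blast
        have sndlim: "(\<lambda>k. energy M p (\<lambda>x. snd (Y k x) - snd (U x))) \<longlonglongrightarrow> 0"
        proof (rule energy_tendsto_0_le[where c=1, OF _ _ Y(2)])
          fix k
          have D: "(\<lambda>x. Y k x - U x) \<in> V" by (intro V_diff hullV[OF Y(1)] U)
          then have "(\<lambda>x. Y k x - U x) \<in> Lspace M p" using V_Lspace by blast
          from Lspace_snd(2)[OF this p_nonneg]
          show "energy M p (\<lambda>x. snd (Y k x) - snd (U x)) \<le> 1 * energy M p (\<lambda>x. Y k x - U x)" by simp
        qed (simp add: energy_nonneg)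
        have "(\<lambda>k. J (Y k)) \<longlonglongrightarrow> J U"
          unfolding J_def
          by (rule pairing_tendsto[OF monotone_operator.T_Lspace[OF a_operator V_snd[OF P]]
                V_snd[OF hullV[OF Y(1)]] V_snd[OF U] sndlim])
        then have "J U \<le> J P - t * l0 + e" using hull[OF Y(1)] by (intro LIMSEQ_le_const2) auto
        then show "t * l0 \<le> J P - J U + e" by simp
      qed
      also have "\<dots> = (\<integral>x. a x (snd (P x)) \<bullet> (snd (P x) - snd (U x)) \<partial>M)"
        unfolding J_def using Ji[OF P] Ji[OF U] by (simp add: inner_diff_right)
      finally show ?thesis by (simp add: P_def)
    qed
    \<comment> \<open>Dividing by positive and by negative \<open>t\<close> and letting
      \<open>t\<close> tend to 0 gives the two inequalities that make up the equation.\<close>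
    define J where "J = (\<lambda>t. \<integral>x. a x (snd (U x) + t *\<^sub>R snd (N x)) \<bullet> snd (N x) \<partial>M)"
    have J: "t * l0 \<le> t * J t" for t using minty[of t] by (simp add: J_def)
    have Jlim: "(\<lambda>n. J (s n)) \<longlonglongrightarrow> J 0" if "s \<longlonglongrightarrow> 0" "\<And>n. \<bar>s n\<bar> \<le> 1" for s
      using monotone_operator.T_hemicontinuous[OF a_operator V_snd[OF U] V_snd[OF N] that] by (simp add: J_def)
    define s where "s = (\<lambda>n. 1 / real (Suc n))"
    have s: "s \<longlonglongrightarrow> 0" unfolding s_def by (rule one_over_Suc_tendsto_0)
    have s1: "0 < s n" "s n \<le> 1" for n by (auto simp: s_def)
    have "l0 \<le> J (s n)" for n using J[of "s n"] s1[of n] by simp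
    moreover have "(\<lambda>n. J (s n)) \<longlonglongrightarrow> J 0" using s s1 by (intro Jlim) (auto simp: abs_of_pos)
    ultimately have "l0 \<le> J 0" by (intro LIMSEQ_le_const) auto
    moreover have "J (- s n) \<le> l0" for n using J[of "- s n"] s1[of n] by simp
    then have "J 0 \<le> l0"
      using Jlim[of "\<lambda>n. - s n"] tendsto_minus[OF s] s1 by (intro LIMSEQ_le_const2) (auto simp: abs_of_pos)
    ultimately have "J 0 = l0" by simp
    then show "integrable M (\<lambda>x. fst (U x) powr (- \<gamma> x) * fst (N x)) \<and>
       (\<integral>x. a x (snd (U x)) \<bullet> snd (N x) \<partial>M) = (\<integral>x. fst (U x) powr (- \<gamma> x) * fst (N x) \<partial>M)"
      using int by (simp add: J_def l0_def)
  qed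
qed

end

section \<open>Smooth functions\<close>

lemma Ck_on_subset: "Ck_on k S f \<Longrightarrow> T \<subseteq> S \<Longrightarrow> Ck_on k T f"
  by (induction k arbitrary: f) (auto intro: continuous_on_subset)

lemma Ck_on_SucI:
  assumes "\<And>x. (f has_derivative F x) (at x)" "\<And>b. b \<in> Basis \<Longrightarrow> Ck_on k UNIV (\<lambda>x. F x b)"
  shows "Ck_on (Suc k) UNIV f"
proof -
  have "frechet_derivative f (at x) = F x" for x using frechet_derivative_at[OF assms(1)] by simp
  then show ?thesis using assms by (auto simp: differentiable_def)
qed

lemma Ck_on_SucD:
  assumes "Ck_on (Suc k) UNIV f"
  shows "(f has_derivative frechet_derivative f (at x)) (at x)"
  using assms by (simp add: frechet_derivative_works)

lemma Ck_on_Suc_imp: "Ck_on (Suc k) UNIV f \<Longrightarrow> Ck_on k UNIV f"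
proof (induction k arbitrary: f)
  case 0
  then show ?case by (auto intro!: differentiable_imp_continuous_on simp: differentiable_on_def)
qed auto

lemma Ck_on_const: "Ck_on k UNIV (\<lambda>x. c)"
  by (induction k arbitrary: c) (auto intro!: Ck_on_SucI[of _ "\<lambda>x h. 0"] derivative_eq_intros simp del: Ck_on.simps(2))

lemma Ck_on_add: "Ck_on k UNIV f \<Longrightarrow> Ck_on k UNIV g \<Longrightarrow> Ck_on k UNIV (\<lambda>x. f x + g x)"
proof (induction k arbitrary: f g)
  case (Suc k)
  show ?case
    by (rule Ck_on_SucI[OF has_derivative_add[OF Ck_on_SucD[OF Suc.prems(1)] Ck_on_SucD[OF Suc.prems(2)]]])
      (use Suc in auto)
qed (auto intro: continuous_intros)

lemma Ck_on_mult: "Ck_on k UNIV f \<Longrightarrow> Ck_on k UNIV g \<Longrightarrow> Ck_on k UNIV (\<lambda>x. f x * g x)"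
proof (induction k arbitrary: f g)
  case (Suc k)
  show ?case
    by (rule Ck_on_SucI[OF has_derivative_mult[OF Ck_on_SucD[OF Suc.prems(1)] Ck_on_SucD[OF Suc.prems(2)]]])
      (use Suc Ck_on_Suc_imp[OF Suc.prems(1)] Ck_on_Suc_imp[OF Suc.prems(2)] in \<open>auto intro!: Ck_on_add\<close>)
qed (auto intro: continuous_intros)

lemma Ck_on_inner: "Ck_on k UNIV (\<lambda>x. x \<bullet> b)"
proof (cases k)
  case (Suc j)
  show ?thesis unfolding Suc
    by (rule Ck_on_SucI[of _ "\<lambda>x h. h \<bullet> b"]) (auto intro!: derivative_eq_intros Ck_on_const)
qed (auto intro: continuous_intros)

lemma Ck_on_inner_self: "Ck_on k UNIV (\<lambda>x. (x - c) \<bullet> (x - c))"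
proof (cases k)
  case (Suc j)
  have "Ck_on j UNIV (\<lambda>x. 2 * (x \<bullet> b) + (- 2 * (c \<bullet> b)))" for b
    by (intro Ck_on_add Ck_on_mult Ck_on_const Ck_on_inner)
  then show ?thesis unfolding Suc
    by (intro Ck_on_SucI[of _ "\<lambda>x h. 2 * (x \<bullet> h) + (- 2 * (c \<bullet> h))"])
      (auto intro!: derivative_eq_intros simp: inner_diff_left inner_diff_right inner_commute)
qed (simp, intro continuous_intros)

text \<open>The chain rule produces g' composed with f, and g' is again in \<open>G\<close>, so
  closure of the family under differentiation carries the induction on \<open>k\<close>.
  \<open>G\<close> will be the functions \<open>exp_bump q\<close>, or softplus together with the
  polynomials in the logistic function.\<close>

lemma Ck_on_compose:
  assumes closed: "\<And>g. g \<in> G \<Longrightarrow> \<exists>g'\<in>G. \<forall>t. (g has_real_derivative g' t) (at t)"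
  shows "g \<in> G \<Longrightarrow> Ck_on k UNIV f \<Longrightarrow> Ck_on k UNIV (\<lambda>x. g (f x))"
proof (induction k arbitrary: g)
  case 0
  obtain g' where g': "\<And>t. (g has_real_derivative g' t) (at t)" using closed[OF 0(1)] by blast
  have "continuous_on UNIV g" by (intro continuous_at_imp_continuous_on ballI DERIV_isCont[OF g'])
  then show ?case using 0 continuous_on_compose2[of UNIV g UNIV f] by auto
next
  case (Suc k)
  obtain g' where g': "g' \<in> G" "\<forall>t. (g has_real_derivative g' t) (at t)" using closed[OF Suc.prems(1)] by blast
  let ?D = "\<lambda>x. frechet_derivative f (at x)"
  have "((\<lambda>x. g (f x)) has_derivative (\<lambda>h. g' (f x) * ?D x h)) (at x)" for x
    using has_derivative_compose[OF Ck_on_SucD[OF Suc.prems(2)], of g "(*) (g' (f x))" x] g'(2)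
    by (simp add: has_field_derivative_def)
  moreover have "Ck_on k UNIV (\<lambda>x. g' (f x) * ?D x b)" if "b \<in> Basis" for b
    by (rule Ck_on_mult[OF Suc.IH[OF g'(1) Ck_on_Suc_imp[OF Suc.prems(2)]]])
      (use Suc.prems(2) that in simp)
  ultimately show ?case by (rule Ck_on_SucI)
qed

lemma grad_eqI:
  assumes "(f has_derivative (\<lambda>h. v \<bullet> h)) (at x)"
  shows "grad f x = v"
  using frechet_derivative_at[OF assms, symmetric] by (simp add: grad_def euclidean_representation)

lemma has_derivative_grad:
  assumes "f differentiable (at x)"
  shows "(f has_derivative (\<lambda>h. grad f x \<bullet> h)) (at x)"
proof -
  have D: "(f has_derivative frechet_derivative f (at x)) (at x)"
    using assms by (simp add: frechet_derivative_works)
  then interpret bounded_linear "frechet_derivative f (at x)" by (rule has_derivative_bounded_linear)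
  have "frechet_derivative f (at x) h = grad f x \<bullet> h" for h
  proof -
    have "frechet_derivative f (at x) h = frechet_derivative f (at x) (\<Sum>b\<in>Basis. (h \<bullet> b) *\<^sub>R b)"
      by (simp add: euclidean_representation)
    also have "\<dots> = (\<Sum>b\<in>Basis. (h \<bullet> b) * frechet_derivative f (at x) b)"
      by (simp add: sum scaleR)
    also have "\<dots> = grad f x \<bullet> h"
      by (simp add: grad_def inner_sum_left inner_commute[of h] mult.commute)
    finally show ?thesis .
  qed
  then have "frechet_derivative f (at x) = (\<lambda>h. grad f x \<bullet> h)" by auto
  then show ?thesis using D by simp
qed

lemma Ck_on_1_grad:
  assumes "Ck_on 1 UNIV f"
  shows "f differentiable (at x)" "continuous_on UNIV (grad f)" "continuous_on UNIV f"
proof -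
  have 1: "Ck_on (Suc 0) UNIV f" using assms by simp
  then show "f differentiable (at x)" by simp
  show "continuous_on UNIV (grad f)"
    unfolding grad_def using 1 by (intro continuous_intros) auto
  show "continuous_on UNIV f" using Ck_on_Suc_imp[OF 1] by simp
qed

lemma smooth_on_Ck1: "smooth_on UNIV f \<Longrightarrow> Ck_on 1 UNIV f"
  unfolding smooth_on_def by blast

lemma grad_zero_outside:
  assumes "compact K" "\<And>x. x \<notin> K \<Longrightarrow> f x = 0" "x \<notin> K"
  shows "grad f x = 0"
proof (rule grad_eqI)
  have "open (- K)" using assms(1) by (simp add: compact_imp_closed open_Compl)
  moreover have "((\<lambda>x. 0::real) has_derivative (\<lambda>h. 0 \<bullet> h)) (at x)" by simp
  ultimately show "(f has_derivative (\<lambda>h. 0 \<bullet> h)) (at x)"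
    using assms by (elim has_derivative_transform_within_open[rotated]) auto
qed

section \<open>Bump functions and mollification\<close>

text \<open>A family instead of the single function exp(- 1 / t), to be closed under
  differentiation: in the variable y = 1 / t the derivative replaces q by y^2 (q - q').\<close>

definition exp_bump :: "real poly \<Rightarrow> real \<Rightarrow> real" where
  "exp_bump q t = (if 0 < t then poly q (1 / t) * exp (- (1 / t)) else 0)"

lemma poly_times_exp_tendsto_0: "((\<lambda>y. poly q y * exp (- y)) \<longlongrightarrow> (0::real)) at_top"
proof -
  have "((\<lambda>y. \<Sum>i\<le>degree q. coeff q i * (y ^ i / exp y)) \<longlongrightarrow> (\<Sum>i\<le>degree q. coeff q i * 0)) at_top"
    by (intro tendsto_intros tendsto_power_div_exp_0)
  then show ?thesis by (simp add: poly_altdef sum_distrib_right exp_minus divide_inverse mult.assoc)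
qed

lemma exp_bump_deriv:
  "(exp_bump q has_real_derivative exp_bump ([:0, 0, 1:] * (q - pderiv q)) t) (at t)"
proof -
  consider "t > 0" | "t < 0" | "t = 0" by linarith
  then show ?thesis
  proof cases
    case 1
    have "((\<lambda>t. poly q (1 / t) * exp (- (1 / t))) has_real_derivative
      poly (pderiv q) (1 / t) * (- 1 / t\<^sup>2) * exp (- (1 / t)) + poly q (1 / t) * (exp (- (1 / t)) * (1 / t\<^sup>2))) (at t)"
      using 1 by (auto intro!: derivative_eq_intros DERIV_chain2[OF poly_DERIV] simp: power2_eq_square)
    also have "poly (pderiv q) (1 / t) * (- 1 / t\<^sup>2) * exp (- (1 / t)) + poly q (1 / t) * (exp (- (1 / t)) * (1 / t\<^sup>2))
      = exp_bump ([:0, 0, 1:] * (q - pderiv q)) t"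
      using 1 by (simp add: exp_bump_def algebra_simps power2_eq_square)
    finally show ?thesis
      by (rule has_field_derivative_transform_within_open[of _ _ _ "{0<..}"]) (use 1 in \<open>auto simp: exp_bump_def\<close>)
  next
    case 2
    have "((\<lambda>t. 0) has_real_derivative exp_bump ([:0, 0, 1:] * (q - pderiv q)) t) (at t)"
      using 2 by (simp add: exp_bump_def)
    then show ?thesis
      by (rule has_field_derivative_transform_within_open[of _ _ _ "{..<0}"]) (use 2 in \<open>auto simp: exp_bump_def\<close>)
  next
    case 3
    \<comment> \<open>In the variable 1 / h the difference quotient is again a polynomial times a
      decaying exponential.\<close>
    have "((\<lambda>h. poly ([:0, 1:] * q) (inverse h) * exp (- inverse h)) \<longlongrightarrow> 0) (at_right 0)"
      by (rule filterlim_compose[OF poly_times_exp_tendsto_0 filterlim_inverse_at_top_right])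
    then have "((\<lambda>h. exp_bump q h / h) \<longlongrightarrow> 0) (at_right 0)"
      by (rule Lim_transform_eventually)
        (auto simp: eventually_at_right_field exp_bump_def divide_simps intro!: exI[of _ 1])
    moreover have "((\<lambda>h. exp_bump q h / h) \<longlongrightarrow> 0) (at_left 0)"
      by (rule Lim_transform_eventually[OF tendsto_const])
        (auto simp: eventually_at_left_field exp_bump_def intro!: exI[of _ "-1"])
    ultimately have "((\<lambda>h. exp_bump q h / h) \<longlongrightarrow> 0) (at 0)" by (simp add: filterlim_split_at)
    then show ?thesis using 3 by (simp add: DERIV_def exp_bump_def)
  qed
qed

lemma smooth_on_exp_bump: "smooth_on UNIV f \<Longrightarrow> smooth_on UNIV (\<lambda>x. exp_bump q (f x))"
  unfolding smooth_on_def
proof (intro allI)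
  fix k assume "\<forall>k. Ck_on k UNIV f"
  then have f: "Ck_on k UNIV f" by blast
  show "Ck_on k UNIV (\<lambda>x. exp_bump q (f x))"
  proof (rule Ck_on_compose[of "range exp_bump", OF _ _ f])
    fix g assume "g \<in> range exp_bump"
    then obtain r where "g = exp_bump r" by blast
    then show "\<exists>g'\<in>range exp_bump. \<forall>t. (g has_real_derivative g' t) (at t)"
      using exp_bump_deriv[of r] by (intro bexI[of _ "exp_bump ([:0, 0, 1:] * (r - pderiv r))"]) auto
  qed simp
qed

lemma bump_exists:
  fixes x0 :: "'a::euclidean_space"
  assumes "0 < r"
  obtains \<rho> where "smooth_on UNIV \<rho>" "\<And>x. 0 \<le> \<rho> x" "\<And>x. \<rho> x \<le> 1" "\<rho> x0 = 1" "\<And>x. x \<notin> cball x0 r \<Longrightarrow> \<rho> x = 0"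
proof -
  define E where "E = exp_bump 1"
  \<comment> \<open>The argument of \<open>E\<close> is positive exactly in the open ball of radius
    \<open>r\<close>; the leading factor normalizes the value at the center to 1.\<close>
  define \<rho> where "\<rho> = (\<lambda>x::'a. exp (1 / r\<^sup>2) * E (r\<^sup>2 + (- 1) * ((x - x0) \<bullet> (x - x0))))"
  have "smooth_on UNIV (\<lambda>x::'a. r\<^sup>2 + (- 1) * ((x - x0) \<bullet> (x - x0)))"
    unfolding smooth_on_def by (intro allI Ck_on_add Ck_on_mult Ck_on_const Ck_on_inner_self)
  then have "smooth_on UNIV (\<lambda>x::'a. E (r\<^sup>2 + (- 1) * ((x - x0) \<bullet> (x - x0))))"
    unfolding E_def by (rule smooth_on_exp_bump)
  then have 1: "smooth_on UNIV \<rho>"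
    unfolding smooth_on_def \<rho>_def by (intro allI Ck_on_mult Ck_on_const) blast
  have le: "\<rho> x \<le> 1" for x
  proof (cases "0 < r\<^sup>2 - (x - x0) \<bullet> (x - x0)")
    case True
    have "1 / r\<^sup>2 \<le> 1 / (r\<^sup>2 - (x - x0) \<bullet> (x - x0))"
      using True assms by (intro divide_left_mono mult_pos_pos) auto
    then show ?thesis using True by (simp add: \<rho>_def E_def exp_bump_def flip: exp_add)
  qed (simp add: \<rho>_def E_def exp_bump_def)
  have zero: "\<rho> x = 0" if "x \<notin> cball x0 r" for x
  proof -
    have "r < norm (x - x0)" using that by (simp add: dist_norm norm_minus_commute)
    then have "r\<^sup>2 < (x - x0) \<bullet> (x - x0)"
      using assms power_strict_mono[of r "norm (x - x0)" 2] by (simp add: power2_norm_eq_inner)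
    then show ?thesis by (simp add: \<rho>_def E_def exp_bump_def)
  qed
  show ?thesis
    by (rule that[of \<rho>]) (use 1 le zero assms in \<open>auto simp: \<rho>_def E_def exp_bump_def simp flip: exp_add\<close>)
qed

section \<open>Convolutions and smooth approximation of C^1 test functions\<close>

lemma compact_support_uniformly_continuous:
  fixes f :: "'a::euclidean_space \<Rightarrow> 'b::real_normed_vector"
  assumes f: "continuous_on UNIV f" and K: "compact K" and z: "\<And>x. x \<notin> K \<Longrightarrow> f x = 0"
  shows "uniformly_continuous_on UNIV f"
  unfolding uniformly_continuous_on_def
proof (intro allI impI)
  fix e :: real assume e: "e > 0"
  define L where "L = {x + y | x y. x \<in> K \<and> y \<in> cball (0::'a) 1}"
  have "compact L" unfolding L_def by (intro compact_sums K compact_cball)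
  then have uc: "uniformly_continuous_on L f"
    using f by (intro compact_uniformly_continuous) (auto intro: continuous_on_subset)
  obtain d where d: "d > 0" "\<And>x x'. x \<in> L \<Longrightarrow> x' \<in> L \<Longrightarrow> dist x' x < d \<Longrightarrow> dist (f x') (f x) < e"
    by (rule uniformly_continuous_onE[OF uc e]) auto
  have KL: "x' \<in> L" if "x \<in> K" "dist x' x < 1" for x x'
  proof -
    have "x' = x + (x' - x)" "x' - x \<in> cball 0 1" using that by (auto simp: dist_norm norm_minus_commute)
    then show ?thesis unfolding L_def using that(1) by blast
  qed
  show "\<exists>d>0. \<forall>x\<in>UNIV. \<forall>x'\<in>UNIV. dist x' x < d \<longrightarrow> dist (f x') (f x) < e"
  proof (intro exI[of _ "min d 1"] conjI ballI impI)
    fix x x' :: 'a assume *: "dist x' x < min d 1"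
    show "dist (f x') (f x) < e"
    proof (cases "x \<in> K \<or> x' \<in> K")
      case True
      then have "x \<in> L" "x' \<in> L" using KL[of x x'] KL[of x x] KL[of x' x] KL[of x' x'] *
        by (auto simp: dist_commute)
      then show ?thesis using d * by auto
    qed (use z e in auto)
  qed (use d in auto)
qed

lemma integrable_compact_support:
  fixes f :: "'a::euclidean_space \<Rightarrow> 'b::euclidean_space"
  assumes f: "continuous_on UNIV f" and K: "compact K" and z: "\<And>x. x \<notin> K \<Longrightarrow> f x = 0"
  shows "integrable lborel f"
proof -
  have "integrable lborel (\<lambda>x. indicator K x *\<^sub>R f x)"
    by (intro borel_integrable_compact K continuous_on_subset[OF f]) auto
  also have "(\<lambda>x. indicator K x *\<^sub>R f x) = f" using z by (auto simp: indicator_def)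
  finally show ?thesis .
qed

lemma convolution_integrable:
  fixes G :: "'a::euclidean_space \<Rightarrow> 'b::euclidean_space"
  assumes "continuous_on UNIV k" "compact K" "\<And>x. x \<notin> K \<Longrightarrow> k x = 0" "continuous_on UNIV G"
  shows "integrable lborel (\<lambda>y. k y *\<^sub>R G (x - y))"
  by (rule integrable_compact_support[OF _ assms(2)])
    (use assms in \<open>auto intro!: continuous_intros continuous_on_compose2[OF assms(4)]\<close>)

text \<open>On a segment shorter than \<open>d\<close> the linearization error of \<open>g\<close>
  is controlled by the oscillation of \<open>G\<close>, uniformly in the base point because
  \<open>G\<close> is uniformly continuous; integration against |k| preserves this.\<close>

lemma convolution_has_derivative:
  fixes g k :: "'a::euclidean_space \<Rightarrow> real"
  assumes k: "continuous_on UNIV k" "compact K" "\<And>x. x \<notin> K \<Longrightarrow> k x = 0"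
    and der: "\<And>x. (g has_derivative (\<lambda>h. G x \<bullet> h)) (at x)"
    and G: "continuous_on UNIV G" "compact L" "\<And>x. x \<notin> L \<Longrightarrow> G x = 0"
  shows "((\<lambda>x. \<integral>y. k y * g (x - y) \<partial>lborel) has_derivative (\<lambda>h. (\<integral>y. k y *\<^sub>R G (x - y) \<partial>lborel) \<bullet> h)) (at x)"
  unfolding has_derivative_at_alt
proof (intro conjI allI impI)
  show "bounded_linear ((\<bullet>) (\<integral>y. k y *\<^sub>R G (x - y) \<partial>lborel))" by (rule bounded_linear_inner_right)
  fix e :: real assume e: "e > 0"
  have gc: "continuous_on UNIV g"
    using der by (auto intro!: has_derivative_continuous_on intro: has_derivative_at_withinI)
  define B where "B = (\<integral>y. \<bar>k y\<bar> \<partial>lborel)"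
  have ik: "integrable lborel (\<lambda>y. \<bar>k y\<bar>)"
    using integrable_compact_support[OF k] by simp
  have B: "0 \<le> B" by (simp add: B_def Bochner_Integration.integral_nonneg)
  define e' where "e' = e / (B + 1)"
  have e': "e' > 0" "B * e' \<le> e" using e B by (auto simp: e'_def field_simps)
  obtain d where d: "d > 0" "\<And>z z'. dist z' z < d \<Longrightarrow> dist (G z') (G z) < e'"
    by (rule uniformly_continuous_onE[OF compact_support_uniformly_continuous[OF G] e'(1)]) auto
  show "\<exists>d>0. \<forall>x'. norm (x' - x) < d \<longrightarrow>
      norm ((\<integral>y. k y * g (x' - y) \<partial>lborel) - (\<integral>y. k y * g (x - y) \<partial>lborel)
        - (\<integral>y. k y *\<^sub>R G (x - y) \<partial>lborel) \<bullet> (x' - x)) \<le> e * norm (x' - x)"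
  proof (intro exI[of _ d] conjI allI impI d)
    fix x' assume x': "norm (x' - x) < d"
    let ?r = "\<lambda>y. g (x' - y) - g (x - y) - G (x - y) \<bullet> (x' - x)"
    have lin: "\<bar>?r y\<bar> \<le> norm (x' - x) * e'" for y
    proof -
      have "norm (g (x' - y) - g (x - y) - (\<lambda>z h. G z \<bullet> h) (x - y) ((x' - y) - (x - y)))
          \<le> norm ((x' - y) - (x - y)) * e'"
      proof (rule differentiable_bound_linearization[where S="ball (x - y) d" and f'="\<lambda>z h. G z \<bullet> h"])
        fix t :: real assume "t \<in> {0..1}"
        then have "norm (t *\<^sub>R (x' - x)) < d"
          using x' by (auto intro: le_less_trans[OF mult_left_le_one_le])
        then show "(x - y) + t *\<^sub>R ((x' - y) - (x - y)) \<in> ball (x - y) d" by (simp add: dist_norm)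
      next
        show "(g has_derivative (\<lambda>h. G z \<bullet> h)) (at z within ball (x - y) d)" for z
          using der by (rule has_derivative_at_withinI)
      next
        fix z assume "z \<in> ball (x - y) d"
        then have le: "norm (G z - G (x - y)) \<le> e'"
          using d(2)[of z "x - y"] by (simp add: dist_norm norm_minus_commute)
        show "onorm ((\<lambda>h. G z \<bullet> h) - (\<lambda>h. G (x - y) \<bullet> h)) \<le> e'"
        proof (rule onorm_le)
          fix h
          have "norm ((G z - G (x - y)) \<bullet> h) \<le> norm (G z - G (x - y)) * norm h"
            by (rule Cauchy_Schwarz_ineq2[folded real_norm_def])
          also have "\<dots> \<le> e' * norm h" using le by (intro mult_right_mono) auto
          finally show "norm (((\<lambda>h. G z \<bullet> h) - (\<lambda>h. G (x - y) \<bullet> h)) h) \<le> e' * norm h"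
            by (simp add: inner_diff_left)
        qed
      qed (use d in auto)
      then show ?thesis by simp
    qed
    have i1: "integrable lborel (\<lambda>y. k y * g (z - y))" for z
      using convolution_integrable[OF k gc, of z] by simp
    have i2: "integrable lborel (\<lambda>y. k y *\<^sub>R G (x - y))" by (rule convolution_integrable[OF k G(1)])
    have i3: "integrable lborel (\<lambda>y. k y * (G (x - y) \<bullet> (x' - x)))"
      using integrable_inner_left[OF i2, of "x' - x"] by simp
    have "(\<integral>y. k y * g (x' - y) \<partial>lborel) - (\<integral>y. k y * g (x - y) \<partial>lborel)
        - (\<integral>y. k y *\<^sub>R G (x - y) \<partial>lborel) \<bullet> (x' - x) = (\<integral>y. k y * ?r y \<partial>lborel)"
      using i1 i2 i3 by (simp add: right_diff_distrib flip: integral_inner_left)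
    also have "\<bar>\<dots>\<bar> \<le> (\<integral>y. \<bar>k y\<bar> * (norm (x' - x) * e') \<partial>lborel)"
    proof (rule integral_abs_bound[THEN order_trans], rule integral_mono)
      show "integrable lborel (\<lambda>y. \<bar>k y * ?r y\<bar>)"
        using i1 i3 by (simp add: right_diff_distrib)
      show "integrable lborel (\<lambda>y. \<bar>k y\<bar> * (norm (x' - x) * e'))" using ik by simp
      show "\<bar>k y * ?r y\<bar> \<le> \<bar>k y\<bar> * (norm (x' - x) * e')" for y
        unfolding abs_mult by (intro mult_left_mono lin) auto
    qed
    also have "\<dots> = (B * e') * norm (x' - x)" by (simp add: B_def)
    also have "\<dots> \<le> e * norm (x' - x)" using e' by (intro mult_right_mono) auto
    finally show "norm ((\<integral>y. k y * g (x' - y) \<partial>lborel) - (\<integral>y. k y * g (x - y) \<partial>lborel)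
        - (\<integral>y. k y *\<^sub>R G (x - y) \<partial>lborel) \<bullet> (x' - x)) \<le> e * norm (x' - x)" by simp
  qed
qed

lemma convolution_commute:
  fixes g k :: "'a::euclidean_space \<Rightarrow> real"
  assumes "continuous_on UNIV k" "continuous_on UNIV g"
  shows "(\<integral>y. k y * g (x - y) \<partial>lborel) = (\<integral>y. g y * k (x - y) \<partial>lborel)"
proof -
  have [measurable]: "k \<in> borel_measurable borel" "g \<in> borel_measurable borel"
    using assms by (auto intro: borel_measurable_continuous_onI)
  have "(\<integral>y. k y * g (x - y) \<partial>lborel) = (\<integral>y. k y * g (x - y) \<partial>distr lborel borel (\<lambda>y. x - y))"
    using lborel_affine[of "-1" x] by (simp add: density_1)
  also have "\<dots> = (\<integral>y. k (x - y) * g (x - (x - y)) \<partial>lborel)" by (subst integral_distr) auto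
  finally show ?thesis by (simp add: mult.commute)
qed

text \<open>All derivatives fall on the smooth factor \<open>g\<close>; the factor \<open>k\<close>
  is merely continuous with compact support.\<close>

lemma Ck_on_convolution:
  fixes g k :: "'a::euclidean_space \<Rightarrow> real"
  assumes k: "continuous_on UNIV k" "compact K" "\<And>x. x \<notin> K \<Longrightarrow> k x = 0"
  shows "smooth_on UNIV g \<Longrightarrow> compact L \<Longrightarrow> (\<And>x. x \<notin> L \<Longrightarrow> g x = 0) \<Longrightarrow>
    Ck_on n UNIV (\<lambda>x. \<integral>y. k y * g (x - y) \<partial>lborel)"
proof (induction n arbitrary: g)
  case 0
  note g = Ck_on_1_grad[OF smooth_on_Ck1[OF 0(1)]]
  have "((\<lambda>x. \<integral>y. k y * g (x - y) \<partial>lborel) has_derivative (\<lambda>h. (\<integral>y. k y *\<^sub>R grad g (x - y) \<partial>lborel) \<bullet> h)) (at x)" for x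
    using 0 g by (intro convolution_has_derivative[OF k, of _ _ L] has_derivative_grad grad_zero_outside)
  then show ?case
    by (auto intro!: has_derivative_continuous_on intro: has_derivative_at_withinI)
next
  case (Suc n)
  note g = Ck_on_1_grad[OF smooth_on_Ck1[OF Suc.prems(1)]]
  show ?case
  proof (rule Ck_on_SucI)
    show "((\<lambda>x. \<integral>y. k y * g (x - y) \<partial>lborel) has_derivative (\<lambda>h. (\<integral>y. k y *\<^sub>R grad g (x - y) \<partial>lborel) \<bullet> h)) (at x)" for x
      using Suc.prems g by (intro convolution_has_derivative[OF k, of _ _ L] has_derivative_grad grad_zero_outside)
    fix b :: 'a assume b: "b \<in> Basis"
    have "frechet_derivative g (at x) = (\<bullet>) (grad g x)" for x
      using frechet_derivative_at[OF has_derivative_grad[OF g(1)]] by simp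
    moreover have "smooth_on UNIV (\<lambda>x. frechet_derivative g (at x) b)"
      using Suc.prems(1) b unfolding smooth_on_def by (metis Ck_on.simps(2))
    ultimately have sm: "smooth_on UNIV (\<lambda>x. grad g x \<bullet> b)" by simp
    have "(\<integral>y. k y *\<^sub>R grad g (x - y) \<partial>lborel) \<bullet> b = (\<integral>y. k y * (grad g (x - y) \<bullet> b) \<partial>lborel)" for x
      using convolution_integrable[OF k g(2), of x] by (simp flip: integral_inner_left)
    then show "Ck_on n UNIV (\<lambda>x. (\<integral>y. k y *\<^sub>R grad g (x - y) \<partial>lborel) \<bullet> b)"
      using Suc.IH[OF sm Suc.prems(2)] grad_zero_outside[OF Suc.prems(2,3)] by simp
  qed
qed

text \<open>The convolution is read in two ways: with derivatives on the mollifier it is smooth;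
  with the one derivative on \<open>\<phi>\<close> its gradient is an average of values of the
  gradient of \<open>\<phi>\<close>, hence uniformly close to it.\<close>

lemma Cck1_approx:
  fixes \<phi> :: "'a::euclidean_space \<Rightarrow> real"
  assumes \<phi>: "\<phi> \<in> Cck 1 \<Omega>" and \<Omega>: "open \<Omega>" and e: "0 < e"
  obtains \<psi> where "\<psi> \<in> Cc_smooth \<Omega>" "\<And>x. \<bar>\<psi> x - \<phi> x\<bar> \<le> e" "\<And>x. norm (grad \<psi> x - grad \<phi> x) \<le> e"
proof -
  obtain K where K: "compact K" "K \<subseteq> \<Omega>" "\<And>x. x \<notin> K \<Longrightarrow> \<phi> x = 0"
    using \<phi> by (auto simp: Cck_def compactly_supported_in_def)
  have C1: "Ck_on 1 UNIV \<phi>" using \<phi> by (simp add: Cck_def)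
  note g = Ck_on_1_grad[OF C1]
  note gz = grad_zero_outside[OF K(1,3)]
  obtain d0 where d0: "d0 > 0" "(\<Union>x\<in>K. ball x d0) \<subseteq> \<Omega>"
    using compact_subset_open_imp_ball_epsilon_subset[OF K(1) \<Omega> K(2)] by blast
  obtain d1 where d1: "d1 > 0" "\<And>z z'. dist z' z < d1 \<Longrightarrow> dist (\<phi> z') (\<phi> z) < e"
    by (rule uniformly_continuous_onE[OF compact_support_uniformly_continuous[OF g(3) K(1,3)] e]) auto
  obtain d2 where d2: "d2 > 0" "\<And>z z'. dist z' z < d2 \<Longrightarrow> dist (grad \<phi> z') (grad \<phi> z) < e"
    by (rule uniformly_continuous_onE[OF compact_support_uniformly_continuous[OF g(2) K(1) gz] e]) auto
  \<comment> \<open>Small enough that supports enlarged by \<open>d\<close> stay in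
    \<open>\<Omega>\<close>, and below both moduli of uniform continuity.\<close>
  define d where "d = min d0 (min d1 d2) / 2"
  have d: "d > 0" "d < d0" "d < d1" "d < d2" using d0 d1 d2 by (auto simp: d_def)
  obtain \<rho>0 where \<rho>0: "smooth_on UNIV \<rho>0" "\<And>x. 0 \<le> \<rho>0 x" "\<rho>0 (0::'a) = 1" "\<And>x. x \<notin> cball 0 d \<Longrightarrow> \<rho>0 x = 0"
    using bump_exists[OF d(1), of 0] by metis
  have c0: "continuous_on UNIV \<rho>0" using Ck_on_1_grad(3)[OF smooth_on_Ck1[OF \<rho>0(1)]] .
  define I where "I = (\<integral>y. \<rho>0 y \<partial>lborel)"
  have i0: "integrable lborel \<rho>0" by (rule integrable_compact_support[OF c0 compact_cball \<rho>0(4)])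
  have "I > 0"
  proof -
    have "I \<noteq> 0"
    proof
      assume "I = 0"
      then have ae: "AE x in lborel. \<rho>0 x = 0"
        unfolding I_def using i0 \<rho>0(2) by (subst (asm) integral_nonneg_eq_0_iff_AE) auto
      have "open {x. \<rho>0 x > 1/2}" using c0 by (intro open_Collect_less continuous_intros) auto
      moreover have "0 \<in> {x. \<rho>0 x > 1/2}" using \<rho>0(3) by simp
      ultimately have "\<not> negligible {x. \<rho>0 x > 1/2}" "{x. \<rho>0 x > 1/2} \<in> sets lborel"
        using open_not_negligible by (blast, simp)
      moreover have "AE x in lborel. x \<notin> {x. \<rho>0 x > 1/2}" using ae by eventually_elim auto
      ultimately show False
        by (metis AE_iff_null_sets negligible_iff_null_sets null_sets_completionI)
    qed
    moreover have "I \<ge> 0" unfolding I_def by (intro Bochner_Integration.integral_nonneg \<rho>0)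
    ultimately show ?thesis by simp
  qed
  define \<rho> where "\<rho> = (\<lambda>y. inverse I * \<rho>0 y)"
  have \<rho>: "smooth_on UNIV \<rho>" "\<And>x. 0 \<le> \<rho> x" "\<And>x. x \<notin> cball 0 d \<Longrightarrow> \<rho> x = 0"
    using \<rho>0 \<open>I > 0\<close> by (auto simp: \<rho>_def smooth_on_def intro!: Ck_on_mult Ck_on_const)
  have \<rho>c: "continuous_on UNIV \<rho>" using Ck_on_1_grad(3)[OF smooth_on_Ck1[OF \<rho>(1)]] .
  have i\<rho>: "integrable lborel \<rho>" by (rule integrable_compact_support[OF \<rho>c compact_cball \<rho>(3)])
  have I1: "(\<integral>y. \<rho> y \<partial>lborel) = 1" using \<open>I > 0\<close> by (simp add: \<rho>_def I_def)
  define \<psi> where "\<psi> = (\<lambda>x. \<integral>y. \<rho> y * \<phi> (x - y) \<partial>lborel)"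
  have sm: "smooth_on UNIV \<psi>"
    unfolding \<psi>_def smooth_on_def convolution_commute[OF \<rho>c g(3)]
    using Ck_on_convolution[OF g(3) K(1,3) \<rho>(1) compact_cball \<rho>(3)] by blast
  \<comment> \<open>\<open>\<rho>\<close> has total mass 1, so averaging moves a value by at most
    the oscillation within distance \<open>d\<close>; this serves both \<open>\<phi>\<close> and its
    gradient.\<close>
  have avg: "norm ((\<integral>y. \<rho> y *\<^sub>R F (x - y) \<partial>lborel) - F x) \<le> e"
    if F: "continuous_on UNIV F" "\<And>z z'. dist z' z \<le> d \<Longrightarrow> dist (F z') (F z) < e" for F :: "'a \<Rightarrow> 'b::euclidean_space" and x
  proof -
    have i: "integrable lborel (\<lambda>y. \<rho> y *\<^sub>R F (x - y))" by (rule convolution_integrable[OF \<rho>c compact_cball \<rho>(3) F(1)])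
    have "(\<integral>y. \<rho> y *\<^sub>R F (x - y) \<partial>lborel) - F x = (\<integral>y. \<rho> y *\<^sub>R (F (x - y) - F x) \<partial>lborel)"
      using i i\<rho> I1 by (simp add: scaleR_diff_right)
    also have "norm \<dots> \<le> (\<integral>y. \<rho> y * e \<partial>lborel)"
    proof (rule Bochner_Integration.integral_norm_bound_integral)
      show "integrable lborel (\<lambda>y. \<rho> y *\<^sub>R (F (x - y) - F x))" using i i\<rho> by (simp add: scaleR_diff_right)
      show "integrable lborel (\<lambda>y. \<rho> y * e)" using i\<rho> by simp
      fix y
      show "norm (\<rho> y *\<^sub>R (F (x - y) - F x)) \<le> \<rho> y * e"
      proof (cases "y \<in> cball 0 d")
        case True
        then have "norm (F (x - y) - F x) \<le> e" using F(2)[of "x - y" x] by (simp add: dist_norm)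
        then show ?thesis using \<rho>(2)[of y] by (simp add: mult_left_mono)
      qed (simp add: \<rho>(3))
    qed
    also have "\<dots> = e" using I1 by simp
    finally show ?thesis .
  qed
  have der: "grad \<psi> x = (\<integral>y. \<rho> y *\<^sub>R grad \<phi> (x - y) \<partial>lborel)" for x
    unfolding \<psi>_def
    by (rule grad_eqI, rule convolution_has_derivative[OF \<rho>c compact_cball \<rho>(3) has_derivative_grad[OF g(1)] g(2) K(1) gz])
  show ?thesis
  proof (rule that[of \<psi>])
    define L where "L = {x + y | x y. x \<in> K \<and> y \<in> cball (0::'a) d}"
    have "compact L" unfolding L_def by (intro compact_sums K compact_cball)
    moreover have "L \<subseteq> \<Omega>"
    proof
      fix z assume "z \<in> L"
      then obtain x y where "z = x + y" "x \<in> K" "norm y \<le> d" by (auto simp: L_def)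
      then have "z \<in> ball x d0" using d by (simp add: dist_norm)
      then show "z \<in> \<Omega>" using d0(2) \<open>x \<in> K\<close> by blast
    qed
    moreover have "\<psi> x = 0" if "x \<notin> L" for x
    proof -
      have "\<rho> y * \<phi> (x - y) = 0" for y
      proof (cases "y \<in> cball 0 d")
        case True
        then have "x - y \<notin> K" using that unfolding L_def by (auto dest: spec[of _ "x - y"] spec[of _ y])
        then show ?thesis by (simp add: K(3))
      qed (simp add: \<rho>(3))
      then show ?thesis unfolding \<psi>_def by (simp only: Bochner_Integration.integral_zero)
    qed
    ultimately show "\<psi> \<in> Cc_smooth \<Omega>" using sm by (auto simp: Cc_smooth_def compactly_supported_in_def)
    show "\<bar>\<psi> x - \<phi> x\<bar> \<le> e" for x
      using avg[OF g(3), of x] d1(2) d by (auto simp: \<psi>_def)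
    show "norm (grad \<psi> x - grad \<phi> x) \<le> e" for x
      unfolding der using avg[OF g(2), of x] d2(2) d by auto
  qed
qed

section \<open>Smooth approximations of the truncation\<close>

definition logistic :: "real \<Rightarrow> real \<Rightarrow> real \<Rightarrow> real" where
  "logistic l m t = 1 / (1 + exp (- (l * t - m)))"

text \<open>The primitive of \<open>logistic\<close> that vanishes at 0, so that composition with it
  preserves compact support.\<close>

definition softplus :: "real \<Rightarrow> real \<Rightarrow> real \<Rightarrow> real" where
  "softplus l m t = (ln (1 + exp (l * t - m)) - ln (1 + exp (- m))) / l"

lemma one_add_exp_pos: "0 < 1 + exp (x::real)"
  by (simp add: add_pos_pos)

lemma logistic_bounds: "0 < logistic l m t" "logistic l m t < 1"
  using one_add_exp_pos[of "- (l * t - m)"] by (auto simp: logistic_def)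

lemma logistic_deriv:
  "(logistic l m has_real_derivative l * (logistic l m t * (1 - logistic l m t))) (at t)"
proof -
  define E where "E = exp (- (l * t - m))"
  have E: "1 + E > 0" unfolding E_def by (rule one_add_exp_pos)
  have "(logistic l m has_real_derivative l * E / (1 + E)\<^sup>2) (at t)"
    unfolding logistic_def using E
    by (auto intro!: derivative_eq_intros simp: E_def power2_eq_square field_simps)
  moreover have "l * E / (1 + E)\<^sup>2 = l * (logistic l m t * (1 - logistic l m t))"
    unfolding logistic_def E_def[symmetric] using E by (simp add: field_simps power2_eq_square)
  ultimately show ?thesis by simp
qed

lemma softplus_deriv:
  assumes "l \<noteq> 0"
  shows "(softplus l m has_real_derivative logistic l m t) (at t)"
proof -
  define E where "E = exp (l * t - m)"
  have E: "1 + E > 0" unfolding E_def by (rule one_add_exp_pos)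
  have "(softplus l m has_real_derivative (1 / (1 + E) * (E * l)) / l) (at t)"
    unfolding softplus_def using E by (auto intro!: derivative_eq_intros simp: E_def)
  then have "(softplus l m has_real_derivative E / (1 + E)) (at t)" using assms by simp
  moreover have "E / (1 + E) = logistic l m t"
  proof -
    have "E > 0" by (simp add: E_def)
    then show ?thesis using E unfolding logistic_def exp_minus[of "l * t - m"] E_def[symmetric]
      by (simp add: field_simps)
  qed
  ultimately show ?thesis by simp
qed

text \<open>The logistic function satisfies s' = l s (1 - s), so polynomials in it are closed under
  differentiation; with softplus added they form the family required by
  \<open>Ck_on_compose\<close>.\<close>

lemma smooth_on_softplus:
  assumes "l \<noteq> 0" "smooth_on UNIV f"
  shows "smooth_on UNIV (\<lambda>x. softplus l m (f x))"
  unfolding smooth_on_def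
proof
  fix k
  let ?P = "\<lambda>q t. poly q (logistic l m t)"
  have f: "Ck_on k UNIV f" using assms(2) by (simp add: smooth_on_def)
  show "Ck_on k UNIV (\<lambda>x. softplus l m (f x))"
  proof (rule Ck_on_compose[of "insert (softplus l m) (range ?P)", OF _ _ f])
    fix g assume g: "g \<in> insert (softplus l m) (range ?P)"
    show "\<exists>g'\<in>insert (softplus l m) (range ?P). \<forall>t. (g has_real_derivative g' t) (at t)"
    proof (cases "g = softplus l m")
      case True
      then show ?thesis using softplus_deriv[OF assms(1), of m]
        by (intro bexI[of _ "logistic l m"]) (auto intro!: image_eqI[of _ _ "[:0, 1:]"])
    next
      case False
      then obtain q where q: "g = ?P q" using g by blast
      have "(g has_real_derivative ?P (pderiv q * [:0, l, - l:]) t) (at t)" for t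
      proof -
        have "(g has_real_derivative poly (pderiv q) (logistic l m t) * (l * (logistic l m t * (1 - logistic l m t)))) (at t)"
          unfolding q by (rule DERIV_chain2[OF poly_DERIV logistic_deriv])
        then show ?thesis by (simp add: algebra_simps)
      qed
      then show ?thesis by (intro bexI[of _ "?P (pderiv q * [:0, l, - l:])"] insertI2 rangeI allI)
    qed
  qed simp
qed

lemma ln_one_add_exp_bounds: "max 0 x \<le> ln (1 + exp x)" "ln (1 + exp x) \<le> max 0 x + ln (2::real)"
proof -
  have "max 0 x \<le> ln (exp (max 0 x))" by simp
  also have "\<dots> \<le> ln (1 + exp x)" by (subst ln_le_cancel_iff) (auto simp: one_add_exp_pos max_def)
  finally show "max 0 x \<le> ln (1 + exp x)" .
  have "1 + exp x \<le> 2 * exp (max 0 x)" by (cases "0 \<le> x") (auto simp: max_def)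
  then have "ln (1 + exp x) \<le> ln (2 * exp (max 0 x))"
    by (subst ln_le_cancel_iff) (auto simp: one_add_exp_pos)
  then show "ln (1 + exp x) \<le> max 0 x + ln (2::real)" by (simp add: ln_mult)
qed

text \<open>The shift by \<open>sqrt n\<close> makes the limit vanish also at \<open>t = s\<close>.\<close>

lemma logistic_tendsto:
  "(\<lambda>n. logistic (real n) (real n * s + sqrt (real n)) t) \<longlonglongrightarrow> (if s < t then 1 else 0)"
proof -
  define X where "X = (\<lambda>n. real n * (t - s) - sqrt (real n))"
  have sq: "filterlim (\<lambda>n. sqrt (real n)) at_top sequentially"
    by (rule filterlim_compose[OF sqrt_at_top filterlim_real_sequentially])
  have alt: "logistic (real n) (real n * s + sqrt (real n)) t = 1 / (1 + exp (- X n))" for n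
    by (simp add: logistic_def X_def algebra_simps)
  show ?thesis
  proof (cases "s < t")
    case True
    have "eventually (\<lambda>n. sqrt (real n) \<le> X n) sequentially"
    proof -
      have "eventually (\<lambda>n. 2 / (t - s) \<le> sqrt (real n)) sequentially"
        using sq by (auto simp: filterlim_at_top)
      then show ?thesis
      proof eventually_elim
        fix n assume "2 / (t - s) \<le> sqrt (real n)"
        then have "2 \<le> sqrt (real n) * (t - s)" using True by (simp add: field_simps)
        then have "sqrt (real n) * 2 \<le> sqrt (real n) * (sqrt (real n) * (t - s))" by (intro mult_left_mono) auto
        also have "\<dots> = real n * (t - s)" by (simp flip: mult.assoc)
        finally show "sqrt (real n) \<le> X n" by (simp add: X_def)
      qed
    qed
    then have "filterlim X at_top sequentially" by (rule filterlim_at_top_mono[OF sq])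
    then have "(\<lambda>n. exp (- X n)) \<longlonglongrightarrow> 0"
      by (intro filterlim_compose[OF exp_at_bot] filterlim_compose[OF filterlim_uminus_at_bot_at_top])
    then have "(\<lambda>n. 1 / (1 + exp (- X n))) \<longlonglongrightarrow> 1 / (1 + 0)" by (intro tendsto_intros) auto
    then show ?thesis using True by (simp add: alt)
  next
    case False
    have "(\<lambda>n. exp (- sqrt (real n))) \<longlonglongrightarrow> 0"
      by (intro filterlim_compose[OF exp_at_bot] filterlim_compose[OF filterlim_uminus_at_bot_at_top] sq)
    then have "(\<lambda>n. 1 / (1 + exp (- X n))) \<longlonglongrightarrow> 0"
    proof (rule energy_tendsto_0_le[where c=1, rotated 2])
      fix n
      have "X n \<le> - sqrt (real n)" using False by (simp add: X_def mult_nonneg_nonpos)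
      then have "exp (X n) \<le> exp (- sqrt (real n))" by simp
      moreover have "1 / (1 + exp (- X n)) \<le> 1 / exp (- X n)"
        by (intro divide_left_mono mult_pos_pos one_add_exp_pos) auto
      moreover have "1 / exp (- X n) = exp (X n)" by (simp add: exp_minus field_simps)
      ultimately show "1 / (1 + exp (- X n)) \<le> 1 * exp (- sqrt (real n))" by linarith
      show "0 \<le> 1 / (1 + exp (- X n))" using one_add_exp_pos[of "- X n"] by simp
    qed
    then show ?thesis using False by (simp add: alt)
  qed
qed

text \<open>ln (1 + exp x) differs from the positive part of x by at most ln 2, which disappears
  after division by n + 1, as does the square root shift. The normalizing term tends to the positive
  part of - s, which is 0 because \<open>s \<ge> 0\<close>.\<close>

lemma softplus_tendsto:
  assumes "0 \<le> s"
  shows "(\<lambda>n. softplus (real (Suc n)) (real (Suc n) * s + sqrt (real (Suc n))) t) \<longlonglongrightarrow> max 0 (t - s)"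
proof -
  have *: "(\<lambda>n. ln (1 + exp (real (Suc n) * c - sqrt (real (Suc n)))) / real (Suc n)) \<longlonglongrightarrow> max 0 c" for c
  proof (rule tendsto_sandwich)
    let ?l = "\<lambda>n. max 0 (c - 1 / sqrt (real (Suc n)))"
    have "(\<lambda>n. 1 / real (Suc n)) \<longlonglongrightarrow> 0" by (rule one_over_Suc_tendsto_0)
    from tendsto_real_sqrt[OF this] have z: "(\<lambda>n. 1 / sqrt (real (Suc n))) \<longlonglongrightarrow> 0"
      by (simp add: real_sqrt_divide)
    have "?l \<longlonglongrightarrow> max 0 (c - 0)" by (intro tendsto_intros z)
    then show l: "?l \<longlonglongrightarrow> max 0 c" by simp
    have "(\<lambda>n. ?l n + ln 2 * (1 / real (Suc n))) \<longlonglongrightarrow> max 0 c + ln 2 * 0"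
      by (intro tendsto_intros l) fact
    then show "(\<lambda>n. ?l n + ln 2 / real (Suc n)) \<longlonglongrightarrow> max 0 c" by simp
    have d: "max 0 (real (Suc n) * c - sqrt (real (Suc n))) / real (Suc n) = ?l n" for n
    proof -
      define N where "N = real (Suc n)"
      have N: "N > 0" by (simp add: N_def)
      have "N * (1 / sqrt N) = sqrt N" using N real_div_sqrt[of N] by (simp add: field_simps)
      then have "N * c - sqrt N = N * (c - 1 / sqrt N)" by (simp add: right_diff_distrib)
      then have "max 0 (N * c - sqrt N) = N * max 0 (c - 1 / sqrt N)"
        using N by (simp add: max_def zero_le_mult_iff)
      then show ?thesis using N by (simp add: N_def)
    qed
    show "eventually (\<lambda>n. ?l n \<le> ln (1 + exp (real (Suc n) * c - sqrt (real (Suc n)))) / real (Suc n)) sequentially"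
      unfolding d[symmetric] by (intro always_eventually allI divide_right_mono ln_one_add_exp_bounds) auto
    show "eventually (\<lambda>n. ln (1 + exp (real (Suc n) * c - sqrt (real (Suc n)))) / real (Suc n) \<le> ?l n + ln 2 / real (Suc n)) sequentially"
      unfolding d[symmetric] add_divide_distrib[symmetric]
      by (intro always_eventually allI divide_right_mono ln_one_add_exp_bounds) auto
  qed
  have "(\<lambda>n. ln (1 + exp (real (Suc n) * (t - s) - sqrt (real (Suc n)))) / real (Suc n)
      - ln (1 + exp (real (Suc n) * (- s) - sqrt (real (Suc n)))) / real (Suc n)) \<longlonglongrightarrow> max 0 (t - s) - max 0 (- s)"
    by (intro tendsto_diff *)
  moreover have "max 0 (- s) = 0" using assms by simp
  ultimately show ?thesis by (simp add: softplus_def diff_divide_distrib algebra_simps)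
qed

section \<open>The weighted Sobolev space with zero boundary values\<close>

locale weighted_domain =
  fixes \<Omega> :: "'a::euclidean_space set" and p :: real and w :: "'a \<Rightarrow> real"
  assumes open_domain: "open \<Omega>" and bounded_domain: "bounded \<Omega>"
    and p_gt_1: "1 < p"
    and w_measurable: "w \<in> borel_measurable lebesgue"
    and w_locally_integrable: "\<And>K. compact K \<Longrightarrow> set_integrable lebesgue K w"
    and w_pos: "AE x in lebesgue. 0 < w x"
    and w_sobolev: "weighted_sobolev_ineq p w"
begin

text \<open>Cutting off where \<open>w\<close> is not positive changes the weight only on a null set
  and makes the density nonnegative everywhere. Restriction to \<open>\<Omega>\<close> makes
  \<open>M\<close> a finite measure on the whole space.\<close>

definition dens :: "'a \<Rightarrow> real" where
  "dens x = (if x \<in> \<Omega> \<and> 0 < w x then w x else 0)"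

definition M :: "'a measure" where
  "M = density lebesgue (\<lambda>x. ennreal (dens x))"

lemma domain_sets: "\<Omega> \<in> sets lebesgue"
  by (intro sets_completionI_sets) (use open_domain in simp)

lemma dens_measurable: "dens \<in> borel_measurable lebesgue"
proof -
  have [measurable]: "\<Omega> \<in> sets lebesgue" "w \<in> borel_measurable lebesgue"
    by (rule domain_sets, rule w_measurable)
  show ?thesis unfolding dens_def by measurable
qed

lemma dens_nonneg: "0 \<le> dens x"
  by (simp add: dens_def)

lemma dens_eq: "AE x in lebesgue. dens x = indicator \<Omega> x * w x"
  using w_pos by eventually_elim (auto simp: dens_def)

lemma dens_integrable: "integrable lebesgue dens"
proof (rule Bochner_Integration.integrable_bound)
  have "compact (closure \<Omega>)" using bounded_domain by simp
  then show "integrable lebesgue (\<lambda>x. indicator (closure \<Omega>) x *\<^sub>R w x)"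
    using w_locally_integrable by (simp add: set_integrable_def)
  show "AE x in lebesgue. norm (dens x) \<le> norm (indicator (closure \<Omega>) x *\<^sub>R w x)"
    using closure_subset[of \<Omega>] by (auto simp: dens_def indicator_def intro!: AE_I2)
qed (rule dens_measurable)

lemma M_measurable: "f \<in> measurable M N \<longleftrightarrow> f \<in> measurable lebesgue N"
  by (simp add: M_def)

text \<open>The density is positive almost everywhere in \<open>\<Omega>\<close> and zero outside,
  so \<open>M\<close> and Lebesgue measure have the same null sets within
  \<open>\<Omega>\<close>.\<close>

lemma AE_M: "(AE x in M. P x) \<longleftrightarrow> (AE x in lebesgue. x \<in> \<Omega> \<longrightarrow> P x)"
proof -
  have "(AE x in M. P x) \<longleftrightarrow> (AE x in lebesgue. 0 < ennreal (dens x) \<longrightarrow> P x)"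
    unfolding M_def using dens_measurable by (intro AE_density) simp
  also have "\<dots> \<longleftrightarrow> (AE x in lebesgue. x \<in> \<Omega> \<longrightarrow> P x)"
    by (rule eventually_cong[OF w_pos]) (auto simp: dens_def)
  finally show ?thesis .
qed

sublocale finite_Lp M p
proof (intro finite_Lp.intro finite_Lp_axioms.intro finite_measureI)
  have "(\<integral>\<^sup>+x. ennreal (dens x) \<partial>lebesgue) < \<infinity>"
    using dens_integrable dens_nonneg by (simp add: nn_integral_eq_integral)
  then show "emeasure M (space M) \<noteq> \<infinity>"
    using dens_measurable by (simp add: M_def emeasure_density)
qed (rule p_gt_1)

lemma integral_M:
  fixes f :: "'a \<Rightarrow> 'b::euclidean_space"
  assumes "f \<in> borel_measurable lebesgue"
  shows "integrable M f \<longleftrightarrow> integrable lebesgue (\<lambda>x. dens x *\<^sub>R f x)"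
    and "(\<integral>x. f x \<partial>M) = (\<integral>x. dens x *\<^sub>R f x \<partial>lebesgue)"
  unfolding M_def using integrable_density[OF assms dens_measurable] integral_density[OF assms dens_measurable]
    dens_nonneg by simp_all

section \<open>Jets of test functions and their closure in L^p\<close>

definition jet :: "('a \<Rightarrow> real) \<Rightarrow> 'a \<Rightarrow> real \<times> 'a" where
  "jet \<phi> x = (\<phi> x, grad \<phi> x)"

lemma Cck_jet:
  assumes "\<phi> \<in> Cck 1 \<Omega>"
  shows "jet \<phi> \<in> borel_measurable M" "\<exists>B. \<forall>x. norm (jet \<phi> x) \<le> B" "jet \<phi> \<in> Lspace M p"
proof -
  obtain K where K: "compact K" "K \<subseteq> \<Omega>" "\<And>x. x \<notin> K \<Longrightarrow> \<phi> x = 0"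
    using assms by (auto simp: Cck_def compactly_supported_in_def)
  have C1: "Ck_on 1 UNIV \<phi>" using assms by (simp add: Cck_def)
  have c: "continuous_on UNIV (jet \<phi>)"
    unfolding jet_def by (intro continuous_intros Ck_on_1_grad[OF C1])
  then have "jet \<phi> \<in> borel_measurable borel" by (rule borel_measurable_continuous_onI)
  then show m: "jet \<phi> \<in> borel_measurable M" by (simp add: M_measurable measurable_completion)
  have "compact (jet \<phi> ` K)" using c K by (intro compact_continuous_image) (auto intro: continuous_on_subset)
  then obtain B where B: "\<And>x. x \<in> K \<Longrightarrow> norm (jet \<phi> x) \<le> B"
    using compact_imp_bounded by (fastforce simp: bounded_iff)
  have "norm (jet \<phi> x) \<le> max B 0" for x
  proof (cases "x \<in> K")
    case False
    then have "jet \<phi> x = 0" using grad_zero_outside[OF K(1,3)] K(3) by (simp add: jet_def zero_prod_def)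
    then show ?thesis by simp
  qed (use B in \<open>simp add: le_max_iff_disj\<close>)
  then show "\<exists>B. \<forall>x. norm (jet \<phi> x) \<le> B" by blast
  then show "jet \<phi> \<in> Lspace M p" using Lspace_bounded[OF m] by (auto intro: AE_I2)
qed

lemma Cc_smooth_Cck: "\<phi> \<in> Cc_smooth \<Omega> \<Longrightarrow> \<phi> \<in> Cck 1 \<Omega>"
  using smooth_on_Ck1 by (auto simp: Cc_smooth_def Cck_def)

definition V :: "('a \<Rightarrow> real \<times> 'a) set" where
  "V = {U \<in> Lspace M p. \<forall>e>0. \<exists>\<phi>\<in>Cc_smooth \<Omega>. energy M p (\<lambda>x. jet \<phi> x - U x) < e}"

lemma V_sequence:
  assumes "U \<in> V"
  obtains \<phi> where "\<And>n::nat. \<phi> n \<in> Cc_smooth \<Omega>" "(\<lambda>n. energy M p (\<lambda>x. jet (\<phi> n) x - U x)) \<longlonglongrightarrow> 0"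
proof -
  have "\<forall>n. \<exists>\<phi>. \<phi> \<in> Cc_smooth \<Omega> \<and> energy M p (\<lambda>x. jet \<phi> x - U x) < 1 / real (Suc n)"
  proof
    fix n
    have "0 < 1 / real (Suc n)" by simp
    then show "\<exists>\<phi>. \<phi> \<in> Cc_smooth \<Omega> \<and> energy M p (\<lambda>x. jet \<phi> x - U x) < 1 / real (Suc n)"
      using assms unfolding V_def by blast
  qed
  then obtain \<phi> where \<phi>: "\<And>n. \<phi> n \<in> Cc_smooth \<Omega>" "\<And>n. energy M p (\<lambda>x. jet (\<phi> n) x - U x) < 1 / real (Suc n)"
    by metis
  have "(\<lambda>n. 1 / real (Suc n)) \<longlonglongrightarrow> 0" by (rule one_over_Suc_tendsto_0)
  then have "(\<lambda>n. energy M p (\<lambda>x. jet (\<phi> n) x - U x)) \<longlonglongrightarrow> 0"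
    by (rule energy_tendsto_0_le[where c=1, rotated 2]) (use \<phi>(2) in \<open>auto simp: energy_nonneg less_imp_le\<close>)
  with \<phi>(1) show ?thesis by (rule that)
qed

lemma V_imp_Lspace: "U \<in> V \<Longrightarrow> U \<in> Lspace M p"
  by (simp add: V_def)

lemma V_limit:
  assumes Y: "\<And>n::nat. Y n \<in> V" and U: "U \<in> Lspace M p"
    and lim: "(\<lambda>n. energy M p (\<lambda>x. Y n x - U x)) \<longlonglongrightarrow> 0"
  shows "U \<in> V"
  unfolding V_def
proof (intro CollectI conjI U allI impI)
  fix e :: real assume e: "e > 0"
  \<comment> \<open>The constant 2 powr p of the quasi-triangle inequality for energies is divided
    out in advance.\<close>
  define d where "d = e / (2 * 2 powr p)"
  have d: "d > 0" using e by (simp add: d_def)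
  have "eventually (\<lambda>n. energy M p (\<lambda>x. Y n x - U x) < d) sequentially"
    using lim d by (intro order_tendstoD(2)) auto
  then obtain n where n: "energy M p (\<lambda>x. Y n x - U x) < d" by (auto simp: eventually_sequentially)
  obtain \<phi> where \<phi>: "\<phi> \<in> Cc_smooth \<Omega>" "energy M p (\<lambda>x. jet \<phi> x - Y n x) < d"
    using Y[of n] d by (auto simp: V_def)
  have "energy M p (\<lambda>x. jet \<phi> x - U x)
      \<le> 2 powr p * (energy M p (\<lambda>x. jet \<phi> x - Y n x) + energy M p (\<lambda>x. Y n x - U x))"
    by (intro energy_triangle Cck_jet Cc_smooth_Cck \<phi> V_imp_Lspace Y U p_nonneg)
  also have "\<dots> < 2 powr p * (d + d)" using \<phi> n by (intro mult_strict_left_mono) auto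
  also have "\<dots> = e" by (simp add: d_def)
  finally show "\<exists>\<phi>\<in>Cc_smooth \<Omega>. energy M p (\<lambda>x. jet \<phi> x - U x) < e" using \<phi> by blast
qed

lemma jet_smooth_V:
  assumes "\<phi> \<in> Cc_smooth \<Omega>" shows "jet \<phi> \<in> V"
  unfolding V_def
  by (intro CollectI conjI allI impI bexI[OF _ assms] Cck_jet Cc_smooth_Cck assms) (simp add: energy_def)

lemma V_limit_jets:
  assumes "\<And>n::nat. \<phi> n \<in> Cc_smooth \<Omega>" "U \<in> Lspace M p"
    "(\<lambda>n. energy M p (\<lambda>x. jet (\<phi> n) x - U x)) \<longlonglongrightarrow> 0"
  shows "U \<in> V"
  by (rule V_limit[OF jet_smooth_V[OF assms(1)] assms(2,3)])

lemma Cc_smooth_add: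
  assumes "\<phi> \<in> Cc_smooth \<Omega>" "\<psi> \<in> Cc_smooth \<Omega>"
  shows "(\<lambda>x. \<phi> x + \<psi> x) \<in> Cc_smooth \<Omega>" "jet (\<lambda>x. \<phi> x + \<psi> x) x = jet \<phi> x + jet \<psi> x"
proof -
  obtain K L where K: "compact K" "K \<subseteq> \<Omega>" "\<And>x. x \<notin> K \<Longrightarrow> \<phi> x = 0"
    and L: "compact L" "L \<subseteq> \<Omega>" "\<And>x. x \<notin> L \<Longrightarrow> \<psi> x = 0"
    using assms by (auto simp: Cc_smooth_def compactly_supported_in_def)
  have "\<exists>C. compact C \<and> C \<subseteq> \<Omega> \<and> (\<forall>x. x \<notin> C \<longrightarrow> \<phi> x + \<psi> x = 0)"
    using K L by (intro exI[of _ "K \<union> L"]) auto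
  then show "(\<lambda>x. \<phi> x + \<psi> x) \<in> Cc_smooth \<Omega>"
    using assms by (auto simp: Cc_smooth_def compactly_supported_in_def smooth_on_def intro: Ck_on_add)
  have d: "\<phi> differentiable (at x)" "\<psi> differentiable (at x)"
    using assms by (auto simp: Cc_smooth_def intro: Ck_on_1_grad smooth_on_Ck1)
  have "grad (\<lambda>x. \<phi> x + \<psi> x) x = grad \<phi> x + grad \<psi> x"
    using has_derivative_add[OF has_derivative_grad[OF d(1)] has_derivative_grad[OF d(2)]]
    by (intro grad_eqI) (simp add: inner_add_left)
  then show "jet (\<lambda>x. \<phi> x + \<psi> x) x = jet \<phi> x + jet \<psi> x" by (simp add: jet_def)
qed

lemma Cc_smooth_compose:
  assumes \<phi>: "\<phi> \<in> Cc_smooth \<Omega>" and sm: "smooth_on UNIV (\<lambda>x. g (\<phi> x))" and g0: "g 0 = 0"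
    and der: "\<And>t. (g has_real_derivative g' t) (at t)"
  shows "(\<lambda>x. g (\<phi> x)) \<in> Cc_smooth \<Omega>" "jet (\<lambda>x. g (\<phi> x)) x = (g (\<phi> x), g' (\<phi> x) *\<^sub>R grad \<phi> x)"
proof -
  show "(\<lambda>x. g (\<phi> x)) \<in> Cc_smooth \<Omega>"
  proof -
    obtain K where "compact K" "K \<subseteq> \<Omega>" "\<And>x. x \<notin> K \<Longrightarrow> \<phi> x = 0"
      using \<phi> by (auto simp: Cc_smooth_def compactly_supported_in_def)
    then have "compactly_supported_in \<Omega> (\<lambda>x. g (\<phi> x))"
      unfolding compactly_supported_in_def by (intro exI[of _ K]) (simp add: g0)
    then show ?thesis using sm by (simp add: Cc_smooth_def)
  qed
  have "\<phi> differentiable (at x)" using \<phi> by (auto simp: Cc_smooth_def intro: Ck_on_1_grad smooth_on_Ck1)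
  then have "((\<lambda>x. g (\<phi> x)) has_derivative (\<lambda>h. g' (\<phi> x) * (grad \<phi> x \<bullet> h))) (at x)"
    using has_derivative_compose[OF has_derivative_grad, of \<phi> x g "(*) (g' (\<phi> x))"] der
    by (simp add: has_field_derivative_def)
  then have "grad (\<lambda>x. g (\<phi> x)) x = g' (\<phi> x) *\<^sub>R grad \<phi> x" by (intro grad_eqI) simp
  then show "jet (\<lambda>x. g (\<phi> x)) x = (g (\<phi> x), g' (\<phi> x) *\<^sub>R grad \<phi> x)" by (simp add: jet_def)
qed

lemma V_addition:
  assumes "U \<in> V" "W \<in> V" shows "(\<lambda>x. U x + W x) \<in> V"
proof -
  obtain \<phi> where \<phi>: "\<And>n::nat. \<phi> n \<in> Cc_smooth \<Omega>" "(\<lambda>n. energy M p (\<lambda>x. jet (\<phi> n) x - U x)) \<longlonglongrightarrow> 0"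
    using V_sequence[OF assms(1)] by blast
  obtain \<psi> where \<psi>: "\<And>n::nat. \<psi> n \<in> Cc_smooth \<Omega>" "(\<lambda>n. energy M p (\<lambda>x. jet (\<psi> n) x - W x)) \<longlonglongrightarrow> 0"
    using V_sequence[OF assms(2)] by blast
  have L: "(\<lambda>x. jet (\<phi> n) x - U x) \<in> Lspace M p" "(\<lambda>x. jet (\<psi> n) x - W x) \<in> Lspace M p" for n
    by (intro Lspace_diff Cck_jet Cc_smooth_Cck \<phi>(1) \<psi>(1) V_imp_Lspace[OF assms(1)] V_imp_Lspace[OF assms(2)] p_nonneg)+
  have "(\<lambda>n. energy M p (\<lambda>x. jet (\<phi> n) x - U x) + energy M p (\<lambda>x. jet (\<psi> n) x - W x)) \<longlonglongrightarrow> 0 + 0"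
    by (intro tendsto_add \<phi> \<psi>)
  then have "(\<lambda>n. energy M p (\<lambda>x. (jet (\<phi> n) x - U x) + (jet (\<psi> n) x - W x))) \<longlonglongrightarrow> 0"
    by (intro energy_tendsto_0_le[OF Lspace_add(2)[OF L p_nonneg]]) (auto simp: energy_nonneg)
  then have "(\<lambda>n. energy M p (\<lambda>x. jet (\<lambda>x. \<phi> n x + \<psi> n x) x - (U x + W x))) \<longlonglongrightarrow> 0"
    by (simp add: Cc_smooth_add(2)[OF \<phi>(1) \<psi>(1)] algebra_simps)
  then show ?thesis
    by (rule V_limit_jets[OF Cc_smooth_add(1)[OF \<phi>(1) \<psi>(1)]
          Lspace_add(1)[OF V_imp_Lspace[OF assms(1)] V_imp_Lspace[OF assms(2)] p_nonneg]])
qed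

lemma V_scaling:
  assumes "U \<in> V" shows "(\<lambda>x. t *\<^sub>R U x) \<in> V"
proof -
  obtain \<phi> where \<phi>: "\<And>n::nat. \<phi> n \<in> Cc_smooth \<Omega>" "(\<lambda>n. energy M p (\<lambda>x. jet (\<phi> n) x - U x)) \<longlonglongrightarrow> 0"
    using V_sequence[OF assms] by blast
  have L: "(\<lambda>x. jet (\<phi> n) x - U x) \<in> Lspace M p" for n
    by (intro Lspace_diff Cck_jet Cc_smooth_Cck \<phi>(1) V_imp_Lspace[OF assms] p_nonneg)
  have sm: "smooth_on UNIV (\<lambda>x. t * \<phi> n x)" for n
    using \<phi>(1)[of n] by (auto simp: Cc_smooth_def smooth_on_def intro!: Ck_on_mult Ck_on_const)
  have der: "((*) t has_real_derivative t) (at s)" for s by (auto intro!: derivative_eq_intros)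
  note c = Cc_smooth_compose[OF \<phi>(1) sm mult_zero_right der]
  have "(\<lambda>n. energy M p (\<lambda>x. t *\<^sub>R (jet (\<phi> n) x - U x))) \<longlonglongrightarrow> \<bar>t\<bar> powr p * 0"
    unfolding Lspace_scaleR(2)[OF L] by (intro tendsto_intros \<phi>)
  moreover have "jet (\<lambda>x. t * \<phi> n x) x = t *\<^sub>R jet (\<phi> n) x" for n x
    using c(2)[of n x] by (simp add: jet_def)
  ultimately have "(\<lambda>n. energy M p (\<lambda>x. jet (\<lambda>x. t * \<phi> n x) x - t *\<^sub>R U x)) \<longlonglongrightarrow> 0"
    by (simp add: scaleR_diff_right)
  then show ?thesis by (rule V_limit_jets[OF c(1) Lspace_scaleR(1)[OF V_imp_Lspace[OF assms]]])
qed

section \<open>Stability of V under modification, composition and truncation\<close>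

lemma V_AE_cong:
  assumes U: "U \<in> V" and m: "U' \<in> borel_measurable M" and eq: "AE x in M. U' x = U x"
  shows "U' \<in> V"
proof (rule V_limit[of "\<lambda>_. U"])
  have le: "AE x in M. norm (U' x) \<le> norm (U x)" using eq by eventually_elim simp
  show "U' \<in> Lspace M p" by (rule Lspace_dominated(1)[OF m V_imp_Lspace[OF U] p_nonneg le])
  have "AE x in M. norm (U x - U' x) powr p = 0" using eq by eventually_elim simp
  then show "(\<lambda>n. energy M p (\<lambda>x. U x - U' x)) \<longlonglongrightarrow> 0"
    unfolding energy_def by (simp add: integral_eq_zero_AE)
qed (rule U)

text \<open>Chain rule by density. The gradient error splits into g'(\<phi>_n) times the difference
  of gradients, controlled by |g'| \<le> 1, and g'(\<phi>_n) - g'(u) times the fixed gradient of u,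
  which vanishes by dominated convergence along an almost everywhere convergent subsequence.\<close>

lemma V_compose:
  assumes U: "U \<in> V" and sm: "\<And>\<phi>::'a \<Rightarrow> real. smooth_on UNIV \<phi> \<Longrightarrow> smooth_on UNIV (\<lambda>x. g (\<phi> x))"
    and g0: "g 0 = 0" and der: "\<And>t. (g has_real_derivative g' t) (at t)"
    and g': "\<And>t. \<bar>g' t\<bar> \<le> 1" "continuous_on UNIV g'"
  shows "(\<lambda>x. (g (fst (U x)), g' (fst (U x)) *\<^sub>R snd (U x))) \<in> V"
proof -
  let ?T = "\<lambda>x. (g (fst (U x)), g' (fst (U x)) *\<^sub>R snd (U x))"
  have lip: "\<bar>g s - g t\<bar> \<le> \<bar>s - t\<bar>" for s t
    using field_differentiable_bound[OF convex_UNIV, of g g' 1 s t] der g'(1) by simp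
  have UL: "U \<in> Lspace M p" by (rule V_imp_Lspace[OF U])
  have [measurable]: "U \<in> borel_measurable M" by (rule Lspace_measurable[OF UL])
  have [measurable]: "g' \<in> borel_measurable borel" by (rule borel_measurable_continuous_onI[OF g'(2)])
  have gc: "continuous_on UNIV g" by (intro continuous_at_imp_continuous_on ballI DERIV_isCont[OF der])
  have [measurable]: "g \<in> borel_measurable borel" by (rule borel_measurable_continuous_onI[OF gc])
  have TL: "?T \<in> Lspace M p"
  proof (rule Lspace_dominated(1)[OF _ UL p_nonneg])
    show "AE x in M. norm (?T x) \<le> norm (U x)"
      using lip[of _ 0] g0 g'(1) by (auto intro!: AE_I2 norm_Pair_mono mult_left_le_one_le)
  qed measurable
  obtain \<phi>0 where \<phi>0: "\<And>n::nat. \<phi>0 n \<in> Cc_smooth \<Omega>" "(\<lambda>n. energy M p (\<lambda>x. jet (\<phi>0 n) x - U x)) \<longlonglongrightarrow> 0"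
    using V_sequence[OF U] by blast
  obtain r :: "nat \<Rightarrow> nat" where r: "strict_mono r" "AE x in M. (\<lambda>n. jet (\<phi>0 (r n)) x) \<longlonglongrightarrow> U x"
    using AE_convergent_subsequence[OF Cck_jet(3)[OF Cc_smooth_Cck[OF \<phi>0(1)]] UL \<phi>0(2)] by blast
  define \<phi> where "\<phi> = (\<lambda>n. \<phi>0 (r n))"
  have \<phi>: "\<phi> n \<in> Cc_smooth \<Omega>" for n by (simp add: \<phi>_def \<phi>0)
  have \<phi>lim: "(\<lambda>n. energy M p (\<lambda>x. jet (\<phi> n) x - U x)) \<longlonglongrightarrow> 0"
    unfolding \<phi>_def using LIMSEQ_subseq_LIMSEQ[OF \<phi>0(2) r(1)] by (simp add: o_def)
  have [measurable]: "jet (\<phi> n) \<in> borel_measurable M" for n by (intro Cck_jet Cc_smooth_Cck \<phi>)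
  have [measurable]: "\<phi> n \<in> borel_measurable M" for n
    using borel_measurable_fst[of "jet (\<phi> n)" M] by (simp add: jet_def)
  have smn: "smooth_on UNIV (\<lambda>x. g (\<phi> n x))" for n using \<phi>[of n] by (intro sm) (simp add: Cc_smooth_def)
  note c = Cc_smooth_compose[OF \<phi> smn g0 der]
  \<comment> \<open>The coefficient of the approximant with the gradient of the limit: the
    intermediate term between the two errors.\<close>
  define F where "F = (\<lambda>n x. g' (\<phi> n x) *\<^sub>R snd (U x))"
  define D where "D = (\<lambda>n x. 2 * norm (jet (\<phi> n) x - U x))"
  have vL: "(\<lambda>x. snd (U x)) \<in> Lspace M p" by (rule Lspace_snd(1)[OF UL p_nonneg])
  have Fl: "(\<lambda>n. energy M p (\<lambda>x. F n x - g' (fst (U x)) *\<^sub>R snd (U x))) \<longlonglongrightarrow> 0"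
  proof (rule energy_dominated_convergence[OF _ _ _ vL])
    show "AE x in M. (\<lambda>n. F n x) \<longlonglongrightarrow> g' (fst (U x)) *\<^sub>R snd (U x)"
      using r(2)
    proof eventually_elim
      fix x assume "(\<lambda>n. jet (\<phi>0 (r n)) x) \<longlonglongrightarrow> U x"
      then have "(\<lambda>n. fst (jet (\<phi> n) x)) \<longlonglongrightarrow> fst (U x)" unfolding \<phi>_def by (intro tendsto_intros)
      then have "(\<lambda>n. \<phi> n x) \<longlonglongrightarrow> fst (U x)" by (simp add: jet_def)
      then have "(\<lambda>n. g' (\<phi> n x)) \<longlonglongrightarrow> g' (fst (U x))"
        by (intro continuous_on_tendsto_compose[OF g'(2)]) auto
      then show "(\<lambda>n. F n x) \<longlonglongrightarrow> g' (fst (U x)) *\<^sub>R snd (U x)" unfolding F_def by (intro tendsto_intros)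
    qed
    show "AE x in M. norm (F n x) \<le> norm (snd (U x))" for n
      using g'(1) by (auto simp: F_def intro!: AE_I2 mult_left_le_one_le)
  qed (auto simp: F_def)
  have FL: "(\<lambda>x. F n x - g' (fst (U x)) *\<^sub>R snd (U x)) \<in> Lspace M p" for n
    using g'(1) by (intro Lspace_diff(1) p_nonneg; intro Lspace_dominated(1)[OF _ vL p_nonneg])
      (auto simp: F_def intro!: AE_I2 mult_left_le_one_le)
  have jL: "(\<lambda>x. jet (\<phi> n) x - U x) \<in> Lspace M p" for n
    by (intro Lspace_diff Cck_jet Cc_smooth_Cck \<phi> UL p_nonneg)
  have DL: "D n \<in> Lspace M p" "energy M p (D n) = 2 powr p * energy M p (\<lambda>x. jet (\<phi> n) x - U x)" for n
    using Lspace_scaleR[OF Lspace_norm[OF jL], of 2 n] by (auto simp: D_def energy_def)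
  have bound: "norm (jet (\<lambda>x. g (\<phi> n x)) x - ?T x) \<le> norm (D n x + norm (F n x - g' (fst (U x)) *\<^sub>R snd (U x)))" for n x
  proof -
    let ?u = "fst (U x)" and ?v = "snd (U x)"
    have "jet (\<lambda>x. g (\<phi> n x)) x - ?T x = (g (\<phi> n x) - g ?u, g' (\<phi> n x) *\<^sub>R (grad (\<phi> n) x - ?v)) + (0, F n x - g' ?u *\<^sub>R ?v)"
      by (simp add: c(2) F_def algebra_simps)
    also have "norm \<dots> \<le> norm (g (\<phi> n x) - g ?u, g' (\<phi> n x) *\<^sub>R (grad (\<phi> n) x - ?v)) + norm (0::real, F n x - g' ?u *\<^sub>R ?v)"
      by (rule norm_triangle_ineq)
    also have "norm (g (\<phi> n x) - g ?u, g' (\<phi> n x) *\<^sub>R (grad (\<phi> n) x - ?v)) \<le> norm (jet (\<phi> n) x - U x)"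
      using lip g'(1) by (intro norm_Pair_mono) (auto simp: jet_def intro!: mult_left_le_one_le)
    also have "norm (jet (\<phi> n) x - U x) \<le> D n x" by (simp add: D_def)
    finally show ?thesis by (simp add: norm_Pair)
  qed
  have "(\<lambda>n. energy M p (D n) + energy M p (\<lambda>x. F n x - g' (fst (U x)) *\<^sub>R snd (U x))) \<longlonglongrightarrow> 2 powr p * 0 + 0"
    unfolding DL(2) by (intro tendsto_intros \<phi>lim Fl)
  then have sum0: "(\<lambda>n. energy M p (D n) + energy M p (\<lambda>x. F n x - g' (fst (U x)) *\<^sub>R snd (U x))) \<longlonglongrightarrow> 0" by simp
  have "(\<lambda>n. energy M p (\<lambda>x. jet (\<lambda>x. g (\<phi> n x)) x - ?T x)) \<longlonglongrightarrow> 0"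
  proof (rule energy_tendsto_0_le[where c="2 powr p", OF _ _ sum0])
    fix n
    note a = Lspace_add[OF DL(1)[of n] Lspace_norm[OF FL[of n]] p_nonneg]
    have "energy M p (\<lambda>x. jet (\<lambda>x. g (\<phi> n x)) x - ?T x)
        \<le> energy M p (\<lambda>x. D n x + norm (F n x - g' (fst (U x)) *\<^sub>R snd (U x)))"
      using bound Cck_jet(1)[OF Cc_smooth_Cck[OF c(1)]] Lspace_measurable[OF TL]
      by (intro Lspace_dominated(2)[OF _ a(1) p_nonneg]) (auto intro!: AE_I2)
    also have "\<dots> \<le> 2 powr p * (energy M p (D n) + energy M p (\<lambda>x. F n x - g' (fst (U x)) *\<^sub>R snd (U x)))"
      using a(2) by (simp add: energy_def)
    finally show "energy M p (\<lambda>x. jet (\<lambda>x. g (\<phi> n x)) x - ?T x)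
      \<le> 2 powr p * (energy M p (D n) + energy M p (\<lambda>x. F n x - g' (fst (U x)) *\<^sub>R snd (U x)))" .
  qed (simp add: energy_nonneg)
  then show ?thesis by (rule V_limit_jets[OF c(1) TL])
qed

text \<open>Softplus functions of growing steepness are 1-Lipschitz and vanish at 0, so
  \<open>U\<close> itself dominates all approximants. Their slopes tend to 0 also at the level
  \<open>s\<close>, in agreement with the strict inequality in the truncated gradient.\<close>

lemma V_truncation:
  assumes U: "U \<in> V" and s: "0 \<le> s"
  shows "(\<lambda>x. (max 0 (fst (U x) - s), if s < fst (U x) then snd (U x) else 0)) \<in> V"
proof -
  let ?T = "\<lambda>x. (max 0 (fst (U x) - s), if s < fst (U x) then snd (U x) else 0)"
  define l where "l = (\<lambda>n. real (Suc n))"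
  define m where "m = (\<lambda>n. l n * s + sqrt (l n))"
  define Y where "Y = (\<lambda>n x. (softplus (l n) (m n) (fst (U x)), logistic (l n) (m n) (fst (U x)) *\<^sub>R snd (U x)))"
  have l: "l n \<noteq> 0" for n by (simp add: l_def)
  have UL: "U \<in> Lspace M p" by (rule V_imp_Lspace[OF U])
  have [measurable]: "U \<in> borel_measurable M" by (rule Lspace_measurable[OF UL])
  have lc: "continuous_on UNIV (logistic (l n) (m n))" for n
    by (intro continuous_at_imp_continuous_on ballI DERIV_isCont[OF logistic_deriv])
  have l1: "\<bar>logistic (l n) (m n) t\<bar> \<le> 1" for n t
    using logistic_bounds[of "l n" "m n" t] by simp
  have s0: "softplus (l n) (m n) 0 = 0" for n by (simp add: softplus_def)
  have YV: "Y n \<in> V" for n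
    unfolding Y_def by (rule V_compose[OF U smooth_on_softplus[OF l] s0 softplus_deriv[OF l] l1 lc])
  have lip: "\<bar>softplus (l n) (m n) t\<bar> \<le> \<bar>t\<bar>" for n t
    using field_differentiable_bound[OF convex_UNIV, of "softplus (l n) (m n)" "logistic (l n) (m n)" 1 t 0]
      softplus_deriv[OF l] l1 s0 by simp
  have TL: "?T \<in> Lspace M p"
  proof (rule Lspace_dominated(1)[OF _ UL p_nonneg])
    show "AE x in M. norm (?T x) \<le> norm (U x)" using s by (intro AE_I2 norm_Pair_mono) auto
  qed measurable
  show ?thesis
  proof (rule V_limit[OF YV TL], rule energy_dominated_convergence[OF _ _ _ UL])
    show "Y n \<in> borel_measurable M" for n by (rule Lspace_measurable[OF V_imp_Lspace[OF YV]])
    show "?T \<in> borel_measurable M" by (rule Lspace_measurable[OF TL])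
    show "AE x in M. norm (Y n x) \<le> norm (U x)" for n
      using lip l1 by (auto simp: Y_def intro!: AE_I2 norm_Pair_mono mult_left_le_one_le)
    show "AE x in M. (\<lambda>n. Y n x) \<longlonglongrightarrow> ?T x"
    proof (rule AE_I2)
      fix x
      have "(\<lambda>n. softplus (l n) (m n) (fst (U x))) \<longlonglongrightarrow> max 0 (fst (U x) - s)"
        unfolding l_def m_def by (rule softplus_tendsto[OF s])
      moreover have "(\<lambda>n. logistic (l n) (m n) (fst (U x)) *\<^sub>R snd (U x)) \<longlonglongrightarrow> (if s < fst (U x) then 1 else 0) *\<^sub>R snd (U x)"
        unfolding l_def m_def by (intro tendsto_intros LIMSEQ_Suc[OF logistic_tendsto])
      ultimately have "(\<lambda>n. Y n x) \<longlonglongrightarrow> (max 0 (fst (U x) - s), (if s < fst (U x) then 1 else 0) *\<^sub>R snd (U x))"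
        unfolding Y_def by (rule tendsto_Pair)
      then show "(\<lambda>n. Y n x) \<longlonglongrightarrow> ?T x" by (auto split: if_splits)
    qed
  qed
qed

text \<open>Weak solutions are tested with C^1 functions, whereas \<open>V\<close> is generated by
  smooth ones. Uniform convergence of functions and gradients is convergence in energy because
  \<open>M\<close> is finite.\<close>

lemma jet_Cck_V:
  assumes "\<phi> \<in> Cck 1 \<Omega>" shows "jet \<phi> \<in> V"
proof -
  define e where "e = (\<lambda>n. 1 / real (Suc n))"
  have e: "0 < e n" "e n \<le> 1" for n by (auto simp: e_def)
  have "\<forall>n. \<exists>\<psi>. \<psi> \<in> Cc_smooth \<Omega> \<and> (\<forall>x. \<bar>\<psi> x - \<phi> x\<bar> \<le> e n) \<and> (\<forall>x. norm (grad \<psi> x - grad \<phi> x) \<le> e n)"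
    using Cck1_approx[OF assms open_domain e(1)] by metis
  then obtain \<psi> where \<psi>: "\<And>n. \<psi> n \<in> Cc_smooth \<Omega>" "\<And>n x. \<bar>\<psi> n x - \<phi> x\<bar> \<le> e n"
    "\<And>n x. norm (grad (\<psi> n) x - grad \<phi> x) \<le> e n" by metis
  have d: "norm (jet (\<psi> n) x - jet \<phi> x) \<le> 2 * e n" for n x
    using norm_Pair_le[of "\<psi> n x - \<phi> x" "grad (\<psi> n) x - grad \<phi> x"] \<psi>(2,3)[of n x] by (simp add: jet_def)
  have e0: "(\<lambda>n. 2 * e n) \<longlonglongrightarrow> 0"
    unfolding e_def using tendsto_mult[OF tendsto_const LIMSEQ_inverse_real_of_nat, of 2] by (simp add: inverse_eq_divide)
  have "(\<lambda>n. energy M p (\<lambda>x. (jet (\<psi> n) x - jet \<phi> x) - 0)) \<longlonglongrightarrow> 0"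
  proof (rule energy_dominated_convergence[OF _ _ _ Lspace_const[of "2::real"]])
    show "(\<lambda>x. jet (\<psi> n) x - jet \<phi> x) \<in> borel_measurable M" for n
      using Cck_jet(1)[OF Cc_smooth_Cck[OF \<psi>(1)]] Cck_jet(1)[OF assms] by (intro borel_measurable_diff)
    show "AE x in M. (\<lambda>n. jet (\<psi> n) x - jet \<phi> x) \<longlonglongrightarrow> 0"
      using d by (intro AE_I2 Lim_null_comparison[OF _ e0] always_eventually) auto
    show "AE x in M. norm (jet (\<psi> n) x - jet \<phi> x) \<le> norm (2::real)" for n
      using e[of n] by (intro AE_I2 order_trans[OF d]) simp
  qed simp
  then show ?thesis by (intro V_limit_jets[OF \<psi>(1)] Cck_jet(3) assms) simp
qed

text \<open>The inequality on one ball containing \<open>\<Omega>\<close> is enough: test functions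
  of \<open>\<Omega>\<close> vanish outside it, so averages over the ball are integrals over
  \<open>M\<close> divided by the mass of the ball.\<close>

lemma sobolev_smooth:
  obtains \<kappa> S where "1 < \<kappa>" "0 \<le> S"
    "\<And>\<phi>. \<phi> \<in> Cc_smooth \<Omega> \<Longrightarrow> (\<integral>x. \<bar>\<phi> x\<bar> powr (\<kappa> * p) \<partial>M)
        \<le> S * energy M p (grad \<phi>) powr \<kappa>"
proof -
  obtain \<kappa> C where \<kappa>: "\<kappa> > 1" and C: "C > 0" and sob: "\<And>x0 r \<phi>. r > 0 \<Longrightarrow> \<phi> \<in> Cc_smooth (ball x0 r) \<Longrightarrow>
        (waverage w (ball x0 r) (\<lambda>x. \<bar>\<phi> x\<bar> powr (\<kappa> * p))) powr (1 / (\<kappa> * p))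
        \<le> C * r * (waverage w (ball x0 r) (\<lambda>x. norm (grad \<phi> x) powr p)) powr (1 / p)"
    using w_sobolev unfolding weighted_sobolev_ineq_def by blast
  obtain r where r: "r > 0" "\<Omega> \<subseteq> ball 0 r" using bounded_subset_ballD[OF bounded_domain, of 0] by blast
  define B where "B = ball (0::'a) r"
  define q where "q = \<kappa> * p"
  have q: "q > 0" using \<kappa> p_gt_1 by (simp add: q_def)
  define m where "m = measure (wmeasure w) B"
  have [measurable]: "w \<in> borel_measurable lebesgue" "B \<in> sets lebesgue"
    by (auto simp: w_measurable B_def)
  have m: "m > 0"
  proof -
    have em: "emeasure (wmeasure w) B = (\<integral>\<^sup>+x. ennreal (w x) * indicator B x \<partial>lebesgue)"
      unfolding wmeasure_def by (rule emeasure_density) auto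
    have "emeasure (wmeasure w) B \<le> (\<integral>\<^sup>+x. ennreal (norm (indicator (cball 0 r) x *\<^sub>R w x)) \<partial>lebesgue)"
      unfolding em by (intro nn_integral_mono) (auto simp: B_def indicator_def intro!: ennreal_leI)
    also have "\<dots> < \<infinity>"
      using w_locally_integrable[OF compact_cball, of 0 r] by (simp add: set_integrable_def integrable_iff_bounded)
    finally have fin: "emeasure (wmeasure w) B < \<infinity>" .
    have "emeasure (wmeasure w) B \<noteq> 0"
    proof
      assume "emeasure (wmeasure w) B = 0"
      then have "AE x in lebesgue. ennreal (w x) * indicator B x = 0"
        unfolding em by (subst (asm) nn_integral_0_iff_AE) auto
      then have "AE x in lebesgue. x \<notin> B"
        using w_pos by eventually_elim (auto simp: indicator_def split: if_splits)
      then have "negligible B" by (simp add: AE_iff_null_sets negligible_iff_null_sets)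
      then show False using open_not_negligible[of B] r by (auto simp: B_def)
    qed
    then show ?thesis unfolding m_def using fin by (simp add: measure_def enn2real_positive_iff zero_less_iff_neq_zero)
  qed
  have avg: "waverage w B F = (1 / m) * (\<integral>x. F x \<partial>M)"
    if [measurable]: "F \<in> borel_measurable lebesgue" and z: "\<And>x. x \<notin> \<Omega> \<Longrightarrow> F x = 0" for F
  proof -
    have "(LINT x:B|wmeasure w. F x) = (\<integral>x. w x *\<^sub>R (indicator B x *\<^sub>R F x) \<partial>lebesgue)"
      unfolding set_lebesgue_integral_def wmeasure_def
      using w_pos by (intro integral_density) (auto elim: eventually_mono)
    also have "\<dots> = (\<integral>x. dens x *\<^sub>R F x \<partial>lebesgue)"
    proof (rule integral_cong_AE)
      show "AE x in lebesgue. w x *\<^sub>R (indicator B x *\<^sub>R F x) = dens x *\<^sub>R F x"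
        using w_pos
      proof eventually_elim
        fix x assume "0 < w x"
        then show "w x *\<^sub>R (indicator B x *\<^sub>R F x) = dens x *\<^sub>R F x"
          using r(2) z[of x] by (cases "x \<in> \<Omega>") (auto simp: dens_def B_def indicator_def)
      qed
    qed (use dens_measurable in measurable)
    also have "\<dots> = (\<integral>x. F x \<partial>M)" by (simp add: integral_M)
    finally show ?thesis by (simp add: waverage_def m_def)
  qed
  \<comment> \<open>Results from raising the ball inequality to the power q = \<kappa> p and
    clearing the averages; the exponent q / p = \<kappa> remains on the gradient energy.\<close>
  define S where "S = m * ((C * r) powr q * (1 / m) powr \<kappa>)"
  show ?thesis
  proof (rule that[of \<kappa> S])
    show "1 < \<kappa>" "0 \<le> S" using \<kappa> m by (auto simp: S_def)
    fix \<phi> assume \<phi>: "\<phi> \<in> Cc_smooth \<Omega>"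
    then obtain K where K: "compact K" "K \<subseteq> \<Omega>" "\<And>x. x \<notin> K \<Longrightarrow> \<phi> x = 0"
      by (auto simp: Cc_smooth_def compactly_supported_in_def)
    have \<phi>B: "\<phi> \<in> Cc_smooth (ball 0 r)" using \<phi> r(2) by (auto simp: Cc_smooth_def compactly_supported_in_def)
    have "jet \<phi> \<in> borel_measurable lebesgue"
      using Cck_jet(1)[OF Cc_smooth_Cck[OF \<phi>]] by (simp add: M_measurable)
    from borel_measurable_fst[OF this] borel_measurable_snd[OF this]
    have [measurable]: "\<phi> \<in> borel_measurable lebesgue" "grad \<phi> \<in> borel_measurable lebesgue"
      by (simp_all add: jet_def)
    define I where "I = (\<integral>x. \<bar>\<phi> x\<bar> powr q \<partial>M)"
    define J where "J = energy M p (grad \<phi>)"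
    have I0: "0 \<le> I" unfolding I_def by (intro Bochner_Integration.integral_nonneg) simp
    have J0: "0 \<le> J" by (simp add: J_def energy_nonneg)
    have "((1 / m) * I) powr (1 / q) \<le> C * r * ((1 / m) * J) powr (1 / p)"
    proof -
      have "waverage w B (\<lambda>x. \<bar>\<phi> x\<bar> powr q) = (1 / m) * I"
        unfolding I_def using K q by (intro avg) auto
      moreover have "waverage w B (\<lambda>x. norm (grad \<phi> x) powr p) = (1 / m) * J"
        unfolding J_def energy_def
      proof (rule avg)
        fix x assume "x \<notin> \<Omega>"
        then have "grad \<phi> x = 0" using grad_zero_outside[of K \<phi>, OF K(1) K(3)] K(2) by blast
        then show "norm (grad \<phi> x) powr p = 0" by simp
      qed measurable
      ultimately show ?thesis using sob[OF r(1) \<phi>B] by (simp add: B_def q_def)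
    qed
    then have "(((1 / m) * I) powr (1 / q)) powr q \<le> (C * r * ((1 / m) * J) powr (1 / p)) powr q"
      using q by (intro powr_mono2) auto
    also have "(((1 / m) * I) powr (1 / q)) powr q = (1 / m) * I"
      using q I0 m by (simp add: powr_powr)
    also have "(C * r * ((1 / m) * J) powr (1 / p)) powr q = (C * r) powr q * ((1 / m) * J) powr \<kappa>"
      using C r J0 m p_gt_1 by (simp add: powr_mult powr_powr q_def)
    also have "((1 / m) * J) powr \<kappa> = (1 / m) powr \<kappa> * J powr \<kappa>" using J0 m by (simp only: powr_mult)
    finally have "m * ((1 / m) * I) \<le> m * ((C * r) powr q * ((1 / m) powr \<kappa> * J powr \<kappa>))"
      using m by (intro mult_left_mono) auto
    then show "(\<integral>x. \<bar>\<phi> x\<bar> powr (\<kappa> * p) \<partial>M) \<le> S * energy M p (grad \<phi>) powr \<kappa>"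
      using m by (simp add: I_def[symmetric] J_def[symmetric] q_def[symmetric] S_def mult_ac)
  qed
qed

text \<open>The estimate passes from test functions to their limits by Fatou's lemma. The gradient
  energies of the approximants are bounded only up to the factor 2 powr p of the quasi-triangle
  inequality, whence the constant \<open>S'\<close>.\<close>

lemma sobolev_V:
  obtains \<kappa> S where "sobolev_lattice M p V \<kappa> S"
proof -
  obtain \<kappa> S where S: "1 < \<kappa>" "0 \<le> S" and
    sob: "\<And>\<phi>. \<phi> \<in> Cc_smooth \<Omega> \<Longrightarrow> (\<integral>x. \<bar>\<phi> x\<bar> powr (\<kappa> * p) \<partial>M) \<le> S * energy M p (grad \<phi>) powr \<kappa>"
    using sobolev_smooth by blast
  define q where "q = \<kappa> * p"
  have q: "q > 0" using S p_gt_1 by (simp add: q_def)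
  define S' where "S' = S * (2 powr p) powr \<kappa>"
  have main: "integrable M (\<lambda>x. \<bar>fst (U x)\<bar> powr q) \<and>
      (\<integral>x. \<bar>fst (U x)\<bar> powr q \<partial>M) \<le> S' * energy M p (\<lambda>x. snd (U x)) powr \<kappa>" if U: "U \<in> V" for U
  proof -
    have UL: "U \<in> Lspace M p" by (rule V_imp_Lspace[OF U])
    have [measurable]: "U \<in> borel_measurable M" by (rule Lspace_measurable[OF UL])
    have vL: "(\<lambda>x. snd (U x)) \<in> Lspace M p" by (rule Lspace_snd(1)[OF UL p_nonneg])
    define J where "J = energy M p (\<lambda>x. snd (U x))"
    have J0: "0 \<le> J" by (simp add: J_def energy_nonneg)
    obtain \<phi>0 where \<phi>0: "\<And>n::nat. \<phi>0 n \<in> Cc_smooth \<Omega>" "(\<lambda>n. energy M p (\<lambda>x. jet (\<phi>0 n) x - U x)) \<longlonglongrightarrow> 0"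
      using V_sequence[OF U] by blast
    obtain r :: "nat \<Rightarrow> nat" where r: "strict_mono r" "AE x in M. (\<lambda>n. jet (\<phi>0 (r n)) x) \<longlonglongrightarrow> U x"
      using AE_convergent_subsequence[OF Cck_jet(3)[OF Cc_smooth_Cck[OF \<phi>0(1)]] UL \<phi>0(2)] by blast
    define \<phi> where "\<phi> = (\<lambda>n. \<phi>0 (r n))"
    have \<phi>: "\<phi> n \<in> Cc_smooth \<Omega>" for n by (simp add: \<phi>_def \<phi>0)
    have \<phi>lim: "(\<lambda>n. energy M p (\<lambda>x. jet (\<phi> n) x - U x)) \<longlonglongrightarrow> 0"
      unfolding \<phi>_def using LIMSEQ_subseq_LIMSEQ[OF \<phi>0(2) r(1)] by (simp add: o_def)
    have [measurable]: "jet (\<phi> n) \<in> borel_measurable M" for n by (intro Cck_jet Cc_smooth_Cck \<phi>)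
    have [measurable]: "\<phi> n \<in> borel_measurable M" for n
      using borel_measurable_fst[of "jet (\<phi> n)" M] by (simp add: jet_def)
    have lim: "AE x in M. (\<lambda>n. \<bar>\<phi> n x\<bar> powr q) \<longlonglongrightarrow> \<bar>fst (U x)\<bar> powr q"
      using r(2)
    proof eventually_elim
      fix x assume "(\<lambda>n. jet (\<phi>0 (r n)) x) \<longlonglongrightarrow> U x"
      then have "(\<lambda>n. fst (jet (\<phi> n) x)) \<longlonglongrightarrow> fst (U x)" unfolding \<phi>_def by (intro tendsto_intros)
      then have "(\<lambda>n. \<bar>\<phi> n x\<bar>) \<longlonglongrightarrow> \<bar>fst (U x)\<bar>" unfolding jet_def by (intro tendsto_intros) simp
      then show "(\<lambda>n. \<bar>\<phi> n x\<bar> powr q) \<longlonglongrightarrow> \<bar>fst (U x)\<bar> powr q" using q by (intro tendsto_powr') auto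
    qed
    have int: "integrable M (\<lambda>x. \<bar>\<phi> n x\<bar> powr q)" for n
    proof -
      obtain B where B: "\<And>x. norm (jet (\<phi> n) x) \<le> B" using Cck_jet(2)[OF Cc_smooth_Cck[OF \<phi>]] by blast
      have "\<bar>\<phi> n x\<bar> \<le> B" for x
        using B[of x] norm_fst_le[of "\<phi> n x" "grad (\<phi> n) x"] by (simp add: jet_def)
      then show ?thesis using q by (intro integrable_const_bound[of _ "B powr q"]) (auto intro!: AE_I2 powr_mono2)
    qed
    have gbound: "energy M p (grad (\<phi> n)) \<le> 2 powr p * (energy M p (\<lambda>x. jet (\<phi> n) x - U x) + J)" for n
    proof -
      let ?D = "\<lambda>x. jet (\<phi> n) x - U x"
      have D: "?D \<in> Lspace M p" by (intro Lspace_diff Cck_jet Cc_smooth_Cck \<phi> UL p_nonneg)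
      note sD = Lspace_snd[OF D p_nonneg]
      have "energy M p (grad (\<phi> n)) = energy M p (\<lambda>x. snd (?D x) + snd (U x))" by (simp add: jet_def)
      also have "\<dots> \<le> 2 powr p * (energy M p (\<lambda>x. snd (?D x)) + J)"
        unfolding J_def by (rule Lspace_add(2)[OF sD(1) vL p_nonneg])
      also have "\<dots> \<le> 2 powr p * (energy M p ?D + J)" using sD(2) by (intro mult_left_mono) auto
      finally show ?thesis .
    qed
    have bd: "integrable M (\<lambda>x. \<bar>fst (U x)\<bar> powr q) \<and> (\<integral>x. \<bar>fst (U x)\<bar> powr q \<partial>M) \<le> S * (2 powr p * (e + J)) powr \<kappa>"
      if e: "e > 0" for e
    proof (rule integral_Fatou_bound[OF int _ _ _ lim])
      have "eventually (\<lambda>n. energy M p (\<lambda>x. jet (\<phi> n) x - U x) < e) sequentially"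
        using \<phi>lim e by (intro order_tendstoD(2)) auto
      then show "eventually (\<lambda>n. (\<integral>x. \<bar>\<phi> n x\<bar> powr q \<partial>M) \<le> S * (2 powr p * (e + J)) powr \<kappa>) sequentially"
      proof eventually_elim
        fix n assume n: "energy M p (\<lambda>x. jet (\<phi> n) x - U x) < e"
        have "(\<integral>x. \<bar>\<phi> n x\<bar> powr q \<partial>M) \<le> S * energy M p (grad (\<phi> n)) powr \<kappa>"
          unfolding q_def by (rule sob[OF \<phi>])
        also have "\<dots> \<le> S * (2 powr p * (e + J)) powr \<kappa>"
          using S n by (intro mult_left_mono powr_mono2 order_trans[OF gbound]) (auto simp: energy_nonneg)
        finally show "(\<integral>x. \<bar>\<phi> n x\<bar> powr q \<partial>M) \<le> S * (2 powr p * (e + J)) powr \<kappa>" .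
      qed
    qed auto
    define e where "e = (\<lambda>n. 1 / real (Suc n))"
    have "(\<lambda>n. S * (2 powr p * (e n + J)) powr \<kappa>) \<longlonglongrightarrow> S * (2 powr p * (0 + J)) powr \<kappa>"
    proof (intro tendsto_intros tendsto_powr')
      show "e \<longlonglongrightarrow> 0" unfolding e_def by (rule one_over_Suc_tendsto_0)
      show "2 powr p * (0 + J) \<noteq> 0 \<or> 0 < \<kappa> \<and> (\<forall>\<^sub>F n in sequentially. 0 \<le> 2 powr p * (e n + J))"
        using S J0 by (auto simp: e_def intro!: always_eventually)
    qed
    then have "(\<integral>x. \<bar>fst (U x)\<bar> powr q \<partial>M) \<le> S * (2 powr p * (0 + J)) powr \<kappa>"
      using bd by (intro LIMSEQ_le_const) (auto simp: e_def)
    also have "\<dots> = S' * J powr \<kappa>" using J0 by (simp add: S'_def powr_mult)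
    finally show ?thesis using bd[of 1] by (simp add: J_def)
  qed
  have "sobolev_lattice M p V \<kappa> S'"
  proof (unfold_locales)
    show "V \<subseteq> Lspace M p" by (auto intro: V_imp_Lspace)
    have "(\<lambda>x. 0) \<in> Cc_smooth \<Omega>"
      unfolding Cc_smooth_def compactly_supported_in_def smooth_on_def
      by (auto intro!: Ck_on_const exI[of _ "{}"])
    moreover have "grad (\<lambda>x::'a. 0) x = 0" for x by (rule grad_eqI) simp
    then have "jet (\<lambda>x. 0) = (\<lambda>x. 0)" by (auto simp: jet_def zero_prod_def)
    ultimately show "(\<lambda>x. 0) \<in> V" using jet_smooth_V by metis
    show "0 \<le> S'" using S by (simp add: S'_def)
  qed (use S main in \<open>auto intro: V_addition V_scaling V_limit V_truncation simp: q_def\<close>)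
  then show ?thesis by (rule that)
qed

section \<open>Translation into the weighted Sobolev spaces of the statement\<close>

lemma Lp_energy_le:
  assumes [measurable]: "u \<in> borel_measurable M" and u: "u \<in> Lspace M p" and D: "open D" "D \<subseteq> \<Omega>"
  shows "Lp_energy p w D u \<le> ennreal (energy M p u)"
proof -
  have [measurable]: "u \<in> borel_measurable lebesgue" "w \<in> borel_measurable lebesgue" "D \<in> sets lebesgue"
    "dens \<in> borel_measurable lebesgue"
    using assms(1) D w_measurable dens_measurable by (auto simp: M_measurable)
  have "Lp_energy p w D u = (\<integral>\<^sup>+x. ennreal (w x) * (ennreal (norm (u x) powr p) * indicator D x) \<partial>lebesgue)"
    unfolding Lp_energy_def wmeasure_def by (rule nn_integral_density) measurable
  also have "\<dots> \<le> (\<integral>\<^sup>+x. ennreal (dens x) * ennreal (norm (u x) powr p) \<partial>lebesgue)"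
  proof (rule nn_integral_mono_AE, use w_pos in eventually_elim)
    fix x assume "0 < w x"
    then show "ennreal (w x) * (ennreal (norm (u x) powr p) * indicator D x) \<le> ennreal (dens x) * ennreal (norm (u x) powr p)"
      using D by (cases "x \<in> D") (auto simp: dens_def)
  qed
  also have "\<dots> = (\<integral>\<^sup>+x. ennreal (norm (u x) powr p) \<partial>M)"
    unfolding M_def by (rule nn_integral_density[symmetric]) measurable
  also have "\<dots> = ennreal (energy M p u)"
    unfolding energy_def by (rule nn_integral_eq_integral[OF Lspace_integrable[OF u]]) simp
  finally show ?thesis .
qed

text \<open>One sequence of test functions serves twice: restricted to any open \<open>D\<close> it
  witnesses the gradient, and on \<open>\<Omega>\<close> it witnesses the zero boundary
  values.\<close>

lemma V_has_wgradient:
  assumes U: "U \<in> V" and D: "open D" "D \<subseteq> \<Omega>"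
  shows "has_wgradient p w D (\<lambda>x. fst (U x)) (\<lambda>x. snd (U x))"
    and "(\<lambda>x. fst (U x)) \<in> W1p_0 p w \<Omega>"
proof -
  have UL: "U \<in> Lspace M p" by (rule V_imp_Lspace[OF U])
  have [measurable]: "U \<in> borel_measurable M" by (rule Lspace_measurable[OF UL])
  have LpI: "u \<in> Lp p w D" if "u \<in> Lspace M p" "open D" "D \<subseteq> \<Omega>" for u :: "'a \<Rightarrow> 'b::euclidean_space" and D
  proof -
    have m: "u \<in> borel_measurable M" by (rule Lspace_measurable[OF that(1)])
    then have "u \<in> borel_measurable (lebesgue_on D)"
      by (simp add: M_measurable measurable_restrict_space1)
    moreover have "Lp_energy p w D u < \<infinity>"
      using Lp_energy_le[OF m that] by (simp add: le_less_trans)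
    ultimately show ?thesis by (simp add: Lp_def)
  qed
  obtain \<phi> where \<phi>: "\<And>n::nat. \<phi> n \<in> Cc_smooth \<Omega>" "(\<lambda>n. energy M p (\<lambda>x. jet (\<phi> n) x - U x)) \<longlonglongrightarrow> 0"
    using V_sequence[OF U] by blast
  have L: "(\<lambda>x. jet (\<phi> n) x - U x) \<in> Lspace M p" for n
    by (intro Lspace_diff Cck_jet Cc_smooth_Cck \<phi> UL p_nonneg)
  have e0: "(\<lambda>n. ennreal (energy M p (\<lambda>x. jet (\<phi> n) x - U x))) \<longlonglongrightarrow> 0"
    using tendsto_ennrealI[OF \<phi>(2)] by simp
  have le: "Lp_energy p w D (\<lambda>x. \<phi> n x - fst (U x)) \<le> ennreal (energy M p (\<lambda>x. jet (\<phi> n) x - U x))"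
    "Lp_energy p w D (\<lambda>x. grad (\<phi> n) x - snd (U x)) \<le> ennreal (energy M p (\<lambda>x. jet (\<phi> n) x - U x))"
    if "open D" "D \<subseteq> \<Omega>" for n D
  proof -
    note c = Lspace_fst[OF L[of n] p_nonneg] Lspace_snd[OF L[of n] p_nonneg]
    show "Lp_energy p w D (\<lambda>x. \<phi> n x - fst (U x)) \<le> ennreal (energy M p (\<lambda>x. jet (\<phi> n) x - U x))"
      using Lp_energy_le[OF Lspace_measurable[OF c(1)] c(1) that] c(2)
      by (simp add: jet_def) (meson ennreal_leI order_trans)
    show "Lp_energy p w D (\<lambda>x. grad (\<phi> n) x - snd (U x)) \<le> ennreal (energy M p (\<lambda>x. jet (\<phi> n) x - U x))"
      using Lp_energy_le[OF Lspace_measurable[OF c(3)] c(3) that] c(4)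
      by (simp add: jet_def) (meson ennreal_leI order_trans)
  qed
  have lim: "(\<lambda>n. Lp_energy p w D (\<lambda>x. \<phi> n x - fst (U x))) \<longlonglongrightarrow> 0"
    "(\<lambda>n. Lp_energy p w D (\<lambda>x. grad (\<phi> n) x - snd (U x))) \<longlonglongrightarrow> 0" if "open D" "D \<subseteq> \<Omega>" for D
    by (rule tendsto_sandwich[OF _ _ tendsto_const e0]; use le[OF that] in auto)+
  have wg: "has_wgradient p w D (\<lambda>x. fst (U x)) (\<lambda>x. snd (U x))" if D: "open D" "D \<subseteq> \<Omega>" for D
    unfolding has_wgradient_def
  proof (intro conjI LpI Lspace_fst Lspace_snd UL p_nonneg D exI[of _ \<phi>] lim allI)
    show "smooth_on D (\<phi> i)" for i
      using \<phi>(1)[of i] by (auto simp: Cc_smooth_def smooth_on_def intro: Ck_on_subset)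
  qed
  show "has_wgradient p w D (\<lambda>x. fst (U x)) (\<lambda>x. snd (U x))" by (rule wg[OF D])
  have "(\<lambda>n. Lp_energy p w \<Omega> (\<lambda>x. \<phi> n x - fst (U x)) + Lp_energy p w \<Omega> (\<lambda>x. grad (\<phi> n) x - snd (U x))) \<longlonglongrightarrow> 0 + 0"
    by (intro tendsto_add lim open_domain order_refl)
  then show "(\<lambda>x. fst (U x)) \<in> W1p_0 p w \<Omega>"
    unfolding W1p_0_def using wg[OF open_domain order_refl] \<phi>(1) by auto
qed

end

section \<open>The singular problem in a weighted domain\<close>

text \<open>Along a simple function only finitely many slices of \<open>f\<close> occur, each
  measurable; continuity in the second argument passes to the limit.\<close>

lemma caratheodory_measurable:
  fixes f :: "'a \<Rightarrow> 'b::euclidean_space \<Rightarrow> 'c::euclidean_space"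
  assumes f: "\<And>z. (\<lambda>x. f x z) \<in> borel_measurable M" and cont: "\<And>x. continuous_on UNIV (f x)"
    and Z: "Z \<in> borel_measurable M"
  shows "(\<lambda>x. f x (Z x)) \<in> borel_measurable M"
proof -
  obtain F where F: "\<And>i. simple_function M (F i)" "\<And>x. x \<in> space M \<Longrightarrow> (\<lambda>i. F i x) \<longlonglongrightarrow> Z x"
    using borel_measurable_implies_sequence_metric[OF Z, of 0] by blast
  show ?thesis
  proof (rule borel_measurable_LIMSEQ_metric)
    show "(\<lambda>x. f x (F i x)) \<in> borel_measurable M" for i
    proof (rule measurable_compose_countable'[of "F i ` space M" "\<lambda>z x. f x z" M borel "F i"])
      show "F i \<in> measurable M (count_space (F i ` space M))"
        using F(1)[of i] by (auto simp: simple_function_def measurable_count_space_eq2)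
      show "countable (F i ` space M)"
        using F(1)[of i] by (auto simp: simple_function_def intro: countable_finite)
    qed (rule f)
    fix x assume "x \<in> space M"
    then show "(\<lambda>i. f x (F i x)) \<longlonglongrightarrow> f x (Z x)"
      by (intro continuous_on_tendsto_compose[OF cont F(2)]) auto
  qed
qed

section \<open>Local positivity and reduction to the abstract problem\<close>

context weighted_domain
begin

text \<open>A bump equal to 1 at a point exceeds 3/4 nearby, where the hypothesis yields at least k
  / 4. Finitely many such neighborhoods cover the compact set.\<close>

lemma lower_bound_on_compact:
  assumes lower: "\<And>N L. N \<in> V \<Longrightarrow> AE x in M. norm (snd (N x)) \<le> L \<Longrightarrow> AE x in M. fst (N x) \<le> 1 \<Longrightarrow>
      \<exists>k>0. AE x in M. k * (fst (N x) - 1/2) \<le> u x"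
    and K: "compact K" "K \<subseteq> \<Omega>"
  shows "\<exists>c>0. AE x in M. x \<in> K \<longrightarrow> c \<le> u x"
proof -
  have "\<exists>G c. open G \<and> y \<in> G \<and> c > 0 \<and> (AE x in M. x \<in> G \<longrightarrow> c \<le> u x)" if y: "y \<in> K" for y
  proof -
    obtain r where r: "r > 0" "cball y r \<subseteq> \<Omega>"
      using open_domain y K by (meson open_contains_cball subsetD)
    obtain \<rho> where \<rho>: "smooth_on UNIV \<rho>" "\<And>x. 0 \<le> \<rho> x" "\<And>x. \<rho> x \<le> 1" "\<rho> y = 1" "\<And>x. x \<notin> cball y r \<Longrightarrow> \<rho> x = 0"
      using bump_exists[OF r(1)] by metis
    have sm: "\<rho> \<in> Cc_smooth \<Omega>"
      using \<rho> r by (auto simp: Cc_smooth_def compactly_supported_in_def intro!: exI[of _ "cball y r"])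
    obtain B where B: "\<And>x. norm (jet \<rho> x) \<le> B" using Cck_jet(2)[OF Cc_smooth_Cck[OF sm]] by blast
    have "norm (snd (jet \<rho> x)) \<le> B" for x
      using B[of x] norm_snd_le[of "snd (jet \<rho> x)" "fst (jet \<rho> x)"] by simp
    then obtain k where k: "k > 0" "AE x in M. k * (fst (jet \<rho> x) - 1/2) \<le> u x"
      using lower[OF jet_smooth_V[OF sm], of B] \<rho>(3) by (auto simp: jet_def)
    define G where "G = {x. 3 / 4 < \<rho> x}"
    have "open G" unfolding G_def
      by (intro open_Collect_less continuous_intros Ck_on_1_grad(3)[OF smooth_on_Ck1[OF \<rho>(1)]])
    moreover have "AE x in M. x \<in> G \<longrightarrow> k / 4 \<le> u x"
      using k(2)
    proof eventually_elim
      fix x assume *: "k * (fst (jet \<rho> x) - 1/2) \<le> u x"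
      show "x \<in> G \<longrightarrow> k / 4 \<le> u x"
      proof
        assume "x \<in> G"
        then have "k * (1/4) \<le> k * (fst (jet \<rho> x) - 1/2)"
          using k(1) by (intro mult_left_mono) (auto simp: G_def jet_def)
        then show "k / 4 \<le> u x" using * by simp
      qed
    qed
    ultimately show ?thesis using k(1) \<rho>(4) by (intro exI[of _ G] exI[of _ "k / 4"]) (auto simp: G_def)
  qed
  then obtain G c where G: "\<And>y. y \<in> K \<Longrightarrow> open (G y)" "\<And>y. y \<in> K \<Longrightarrow> y \<in> G y"
    "\<And>y. y \<in> K \<Longrightarrow> 0 < c y" "\<And>y. y \<in> K \<Longrightarrow> AE x in M. x \<in> G y \<longrightarrow> c y \<le> u x"
    by metis
  obtain Y where Y: "Y \<subseteq> K" "finite Y" "K \<subseteq> (\<Union>y\<in>Y. G y)"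
    by (rule compactE_image[OF K(1), of K G]) (use G in auto)
  \<comment> \<open>The inserted 1 keeps the minimum meaningful when the cover is empty.\<close>
  define d where "d = Min (insert 1 (c ` Y))"
  have d: "d > 0" unfolding d_def using Y G(3) by (subst Min_gr_iff) auto
  have "AE x in M. \<forall>y\<in>Y. x \<in> G y \<longrightarrow> c y \<le> u x"
    using Y G(4) by (intro AE_finite_allI) auto
  then have "AE x in M. x \<in> K \<longrightarrow> d \<le> u x"
  proof eventually_elim
    fix x assume *: "\<forall>y\<in>Y. x \<in> G y \<longrightarrow> c y \<le> u x"
    show "x \<in> K \<longrightarrow> d \<le> u x"
    proof
      assume "x \<in> K"
      then obtain y where y: "y \<in> Y" "x \<in> G y" using Y(3) by blast
      have "d \<le> c y" unfolding d_def using y Y(2) by (intro Min_le) auto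
      then show "d \<le> u x" using * y by force
    qed
  qed
  then show ?thesis using d by blast
qed

lemma compact_inner_region:
  assumes "0 < d"
  shows "compact {x \<in> closure \<Omega>. d \<le> infdist x (frontier \<Omega>)}" (is "compact ?K")
    and "{x \<in> closure \<Omega>. d \<le> infdist x (frontier \<Omega>)} \<subseteq> \<Omega>"
proof -
  have "closed {x. d \<le> infdist x (frontier \<Omega>)}" by (intro closed_Collect_le continuous_intros)
  then have "compact (closure \<Omega> \<inter> {x. d \<le> infdist x (frontier \<Omega>)})"
    using bounded_domain by (intro compact_Int_closed) auto
  then show "compact ?K" by (simp add: Int_def)
  show "?K \<subseteq> \<Omega>"
  proof
    fix x assume x: "x \<in> ?K"
    then have "x \<notin> frontier \<Omega>" using assms by auto
    then show "x \<in> \<Omega>" using x open_domain by (auto simp: frontier_def interior_open)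
  qed
qed

theorem weak_solution_exists:
  fixes A :: "'a \<Rightarrow> 'a \<Rightarrow> 'a" and f \<gamma> :: "'a \<Rightarrow> real"
  assumes ne: "\<Omega> \<noteq> {}" and A: "structural_hypotheses p w \<Omega> A"
    and f: "AE x in lebesgue. x \<in> \<Omega> \<longrightarrow> f x = w x"
    and \<gamma>c: "continuous_on (closure \<Omega>) \<gamma>" and \<gamma>0: "\<forall>x\<in>closure \<Omega>. \<gamma> x > 0"
    and \<delta>: "\<delta> > 0" and strip: "\<forall>x\<in>boundary_strip \<Omega> \<delta>. 0 < \<gamma> x \<and> \<gamma> x \<le> 1"
  shows "\<exists>u. weak_solution p w \<Omega> A f \<gamma> u \<and> u \<in> W1p_0 p w \<Omega>"
proof -
  from A obtain \<alpha> \<beta> where \<alpha>: "\<alpha> > 0" and \<beta>: "\<beta> > 0"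
    and Am: "\<And>z. (\<lambda>x. A x z) \<in> borel_measurable (lebesgue_on \<Omega>)"
    and Ac: "AE x in lebesgue. x \<in> \<Omega> \<longrightarrow> continuous_on UNIV (A x)"
    and Ag: "AE x in lebesgue. x \<in> \<Omega> \<longrightarrow> (\<forall>z. norm (A x z) \<le> \<beta> * w x * norm z powr (p - 1))"
    and Ae: "AE x in lebesgue. x \<in> \<Omega> \<longrightarrow> (\<forall>z. A x z \<bullet> z \<ge> \<alpha> * w x * norm z powr p)"
    and As: "AE x in lebesgue. x \<in> \<Omega> \<longrightarrow> (\<forall>y z. y \<noteq> z \<longrightarrow> (A x y - A x z) \<bullet> (y - z) > 0)"
    unfolding structural_hypotheses_def by blast
  define good where "good = (\<lambda>x. 0 < w x \<and> continuous_on UNIV (A x) \<and>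
     (\<forall>z. norm (A x z) \<le> \<beta> * w x * norm z powr (p - 1)) \<and>
     (\<forall>z. A x z \<bullet> z \<ge> \<alpha> * w x * norm z powr p) \<and>
     (\<forall>y z. y \<noteq> z \<longrightarrow> (A x y - A x z) \<bullet> (y - z) > 0))"
  have "AE x in lebesgue. x \<in> \<Omega> \<longrightarrow> good x"
    using Ac Ag Ae As w_pos by eventually_elim (auto simp: good_def)
  then obtain N where N: "{x \<in> space lebesgue. \<not> (x \<in> \<Omega> \<longrightarrow> good x)} \<subseteq> N" "N \<in> sets lebesgue" "emeasure lebesgue N = 0"
    by (rule AE_E)
  define G where "G = \<Omega> - N"
  have G: "good x" if "x \<in> G" for x using that N(1) by (auto simp: G_def)
  have [measurable]: "G \<in> sets lebesgue" unfolding G_def using N(2) domain_sets by auto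
  have GAE: "AE x in M. x \<in> G"
  proof -
    have "AE x in lebesgue. x \<notin> N" using N(2,3) by (intro AE_not_in) (auto simp: null_sets_def)
    then show ?thesis unfolding AE_M by eventually_elim (auto simp: G_def)
  qed
  have "G \<noteq> {}"
  proof
    assume "G = {}"
    then have "negligible \<Omega>"
      using N(2,3) negligible_subset[of N \<Omega>] by (auto simp: G_def negligible_iff_null_sets null_sets_def)
    then show False using open_not_negligible[OF open_domain ne] by blast
  qed
  then obtain x0 where x0: "x0 \<in> G" by blast
  \<comment> \<open>Points outside \<open>G\<close> borrow the operator of the fixed good point
    \<open>x0\<close>, so that the structural conditions hold everywhere.\<close>
  define c where "c = (\<lambda>x. if x \<in> G then x else x0)"
  have cG: "good (c x)" for x using x0 G by (simp add: c_def)
  \<comment> \<open>Division by the weight leaves the plain constants \<beta> and \<alpha> in the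
    growth and coercivity bounds; the density of \<open>M\<close> restores the weight in the
    integrals.\<close>
  define a where "a = (\<lambda>x z. (1 / w (c x)) *\<^sub>R A (c x) z)"
  have wc: "w (c x) > 0" for x using cG[of x] by (simp add: good_def)
  have [measurable]: "w \<in> borel_measurable lebesgue" "dens \<in> borel_measurable lebesgue"
    by (rule w_measurable, rule dens_measurable)
  have a_meas: "(\<lambda>x. a x z) \<in> borel_measurable M" for z
  proof -
    have [measurable]: "(\<lambda>x. if x \<in> \<Omega> then A x z else 0) \<in> borel_measurable lebesgue"
      by (rule borel_measurable_if_I[OF Am domain_sets])
    have "(\<lambda>x. a x z) = (\<lambda>x. if x \<in> G then (1 / w x) *\<^sub>R (if x \<in> \<Omega> then A x z else 0) else a x0 z)"
      using x0 by (auto simp: a_def c_def G_def)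
    moreover have "(\<lambda>x. if x \<in> G then (1 / w x) *\<^sub>R (if x \<in> \<Omega> then A x z else 0) else a x0 z) \<in> borel_measurable lebesgue"
      by measurable
    ultimately show ?thesis by (simp add: M_measurable)
  qed
  have a_cont: "continuous_on UNIV (a x)" for x
    unfolding a_def using cG[of x] by (auto simp: good_def intro!: continuous_intros)

  \<comment> \<open>Values of the exponent far from the domain are arbitrary; 0 keeps its bounds
    valid on the whole space.\<close>
  define \<gamma>' where "\<gamma>' = (\<lambda>x. if x \<in> \<Omega> then \<gamma> x else 0)"
  have \<gamma>m: "\<gamma>' \<in> borel_measurable M"
    unfolding M_measurable \<gamma>'_def
    by (intro borel_measurable_if_I continuous_imp_measurable_on_sets_lebesgue domain_sets
        continuous_on_subset[OF \<gamma>c closure_subset])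
  have "compact (\<gamma> ` closure \<Omega>)" using bounded_domain \<gamma>c by (intro compact_continuous_image) auto
  then obtain b where b: "\<And>x. x \<in> closure \<Omega> \<Longrightarrow> norm (\<gamma> x) \<le> b"
    using compact_imp_bounded by (fastforce simp: bounded_iff)
  define \<gamma>1 where "\<gamma>1 = max b 0"
  have \<gamma>b: "0 \<le> \<gamma>' x" "\<gamma>' x \<le> \<gamma>1" for x
    using b[of x] \<gamma>0 closure_subset[of \<Omega>] by (auto simp: \<gamma>'_def \<gamma>1_def less_imp_le)

  obtain \<kappa> S where sob: "sobolev_lattice M p V \<kappa> S" using sobolev_V by blast
  interpret P: singular_problem M p V \<kappa> S a \<alpha> \<beta> \<gamma>' \<gamma>1
  proof (intro singular_problem.intro[OF sob] singular_problem_axioms.intro)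
    fix Z :: "'a \<Rightarrow> 'a" assume "Z \<in> borel_measurable M"
    then show "(\<lambda>x. a x (Z x)) \<in> borel_measurable M"
      by (rule caratheodory_measurable[of a, OF a_meas a_cont])
  next
    fix x z
    have "norm (A (c x) z) \<le> \<beta> * w (c x) * norm z powr (p - 1)" using cG[of x] by (simp add: good_def)
    then show "norm (a x z) \<le> \<beta> * norm z powr (p - 1)"
      using wc[of x] by (simp add: a_def pos_divide_le_eq mult_ac)
    have "\<alpha> * w (c x) * norm z powr p \<le> A (c x) z \<bullet> z" using cG[of x] by (simp add: good_def)
    then show "\<alpha> * norm z powr p \<le> a x z \<bullet> z"
      using wc[of x] by (simp add: a_def pos_le_divide_eq mult_ac)
  next
    fix x and y z :: 'a assume "y \<noteq> z"
    then have "0 < (A (c x) y - A (c x) z) \<bullet> (y - z)" using cG[of x] by (simp add: good_def)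
    moreover have "(a x y - a x z) \<bullet> (y - z) = (1 / w (c x)) * ((A (c x) y - A (c x) z) \<bullet> (y - z))"
      by (simp add: a_def scaleR_diff_right[symmetric])
    ultimately show "0 < (a x y - a x z) \<bullet> (y - z)" using wc[of x] by simp
  qed (use a_cont \<alpha> \<beta> \<gamma>m \<gamma>b in auto)

  let ?s = "\<lambda>x. fst (P.sol 0 x)"
  have lower: "\<exists>k>0. AE x in M. x \<in> K \<longrightarrow> k \<le> ?s x" if "compact K" "K \<subseteq> \<Omega>" for K
  proof (rule lower_bound_on_compact[OF _ that])
    fix N :: "'a \<Rightarrow> real \<times> 'a" and L :: real
    assume "N \<in> V" "AE x in M. norm (snd (N x)) \<le> L" "AE x in M. fst (N x) \<le> 1"
    then obtain k where "0 < k" "AE x in M. k * (fst (N x) - 1/2) \<le> ?s x" by (rule P.sol_lower_bound)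
    then show "\<exists>k>0. AE x in M. k * (fst (N x) - 1/2) \<le> ?s x" by blast
  qed
  define In where "In = (\<lambda>d. {x \<in> closure \<Omega>. d \<le> infdist x (frontier \<Omega>)})"
  have spos: "AE x in M. 0 < ?s x"
  proof -
    \<comment> \<open>\<open>infdist\<close> to the empty set is 0, so the frontier must be nonempty
      for interior points to have positive distance from it.\<close>
    have fr: "frontier \<Omega> \<noteq> {}"
      using ne bounded_domain not_bounded_UNIV by (auto simp: frontier_eq_empty)
    \<comment> \<open>The compact sets \<open>In (1 / (n + 1))\<close> exhaust
      \<open>\<Omega>\<close>, so countably many local bounds give positivity almost
      everywhere.\<close>
    have "AE x in M. x \<in> In (1 / real (Suc n)) \<longrightarrow> 0 < ?s x" for n
    proof -
      obtain k where "k > 0" "AE x in M. x \<in> In (1 / real (Suc n)) \<longrightarrow> k \<le> ?s x"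
        using lower[OF compact_inner_region, of "1 / real (Suc n)"] unfolding In_def by auto
      then show ?thesis by (auto elim: eventually_mono)
    qed
    then have all: "AE x in M. \<forall>n. x \<in> In (1 / real (Suc n)) \<longrightarrow> 0 < ?s x" unfolding AE_all_countable by blast
    have "AE x in M. x \<in> \<Omega>" unfolding AE_M by simp
    with all show ?thesis
    proof eventually_elim
      fix x assume *: "\<forall>n. x \<in> In (1 / real (Suc n)) \<longrightarrow> 0 < ?s x" "x \<in> \<Omega>"
      have "x \<notin> frontier \<Omega>" using *(2) open_domain by (simp add: frontier_def interior_open)
      then have "infdist x (frontier \<Omega>) > 0" using fr by (intro infdist_pos_not_in_closed) auto
      then obtain n where "1 / real (Suc n) < infdist x (frontier \<Omega>)"
        using nat_approx_posE by blast
      then have "x \<in> In (1 / real (Suc n))" using *(2) closure_subset[of \<Omega>] by (auto simp: In_def)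
      then show "0 < ?s x" using * by blast
    qed
  qed
  \<comment> \<open>The points at distance at least \<open>\<delta>\<close> from the boundary form a
    compact set; within the domain, only there may the exponent exceed 1.\<close>
  obtain c1 where c1: "c1 > 0" "AE x in M. x \<in> In \<delta> \<longrightarrow> c1 \<le> ?s x"
    using lower[OF compact_inner_region[OF \<delta>]] unfolding In_def by blast
  have split: "AE x in M. \<gamma>' x \<le> 1 \<or> c1 \<le> ?s x"
  proof -
    have "AE x in M. x \<in> \<Omega>" unfolding AE_M by simp
    with c1(2) show ?thesis
    proof eventually_elim
      fix x assume *: "x \<in> In \<delta> \<longrightarrow> c1 \<le> ?s x" "x \<in> \<Omega>"
      show "\<gamma>' x \<le> 1 \<or> c1 \<le> ?s x"
      proof (cases "infdist x (frontier \<Omega>) < \<delta>")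
        case True
        then show ?thesis using *(2) strip by (auto simp: boundary_strip_def \<gamma>'_def)
      next
        case False
        then show ?thesis using * closure_subset[of \<Omega>] by (auto simp: In_def)
      qed
    qed
  qed
  obtain U where U: "U \<in> V" "AE x in M. ?s x \<le> fst (U x)"
    and eq: "\<And>N k B. N \<in> V \<Longrightarrow> 0 < k \<Longrightarrow> AE x in M. fst (N x) \<noteq> 0 \<longrightarrow> k \<le> ?s x \<Longrightarrow>
       AE x in M. \<bar>fst (N x)\<bar> \<le> B \<Longrightarrow>
       integrable M (\<lambda>x. fst (U x) powr (- \<gamma>' x) * fst (N x)) \<and>
       (\<integral>x. a x (snd (U x)) \<bullet> snd (N x) \<partial>M) = (\<integral>x. fst (U x) powr (- \<gamma>' x) * fst (N x) \<partial>M)"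
    by (rule P.singular_solution_exists[OF c1(1) split]) (rule that)

  text \<open>A weak solution must be positive at every point, not only almost everywhere.\<close>
  define u where "u = (\<lambda>x. if 0 < fst (U x) then fst (U x) else 1)"
  define v where "v = (\<lambda>x. snd (U x))"
  define U' where "U' = (\<lambda>x. (u x, v x))"
  have [measurable]: "U \<in> borel_measurable M" by (rule Lspace_measurable[OF V_imp_Lspace[OF U(1)]])
  have U'm [measurable]: "U' \<in> borel_measurable M" unfolding U'_def u_def v_def by measurable
  have uU: "AE x in M. u x = fst (U x)" using spos U(2) by eventually_elim (auto simp: u_def)
  have U'V: "U' \<in> V"
    by (rule V_AE_cong[OF U(1) U'm]) (use uU in \<open>auto simp: U'_def v_def elim!: eventually_mono\<close>)
  have wg: "has_wgradient p w D u v" if "open D" "D \<subseteq> \<Omega>" for D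
    using V_has_wgradient(1)[OF U'V that] by (simp add: U'_def)
  have W0: "u \<in> W1p_0 p w \<Omega>" using V_has_wgradient(2)[OF U'V open_domain] by (simp add: U'_def)
  have sub: "D \<subseteq> \<Omega>" if "D \<Subset> \<Omega>" for D using that closure_subset[of D] by (auto simp: compactly_inside_def)
  have upos: "u x > 0" for x by (simp add: u_def)
  have us: "AE x in M. ?s x \<le> u x" using uU U(2) by eventually_elim simp
  have [measurable]: "u \<in> borel_measurable lebesgue" "v \<in> borel_measurable lebesgue"
    using borel_measurable_fst[OF U'm] borel_measurable_snd[OF U'm] by (auto simp: U'_def M_measurable)

  have weak: "set_integrable lebesgue \<Omega> (\<lambda>x. A x (v x) \<bullet> grad \<phi> x) \<and>
      set_integrable lebesgue \<Omega> (\<lambda>x. f x * u x powr (- \<gamma> x) * \<phi> x) \<and>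
      (LINT x:\<Omega>|lebesgue. A x (v x) \<bullet> grad \<phi> x) = (LINT x:\<Omega>|lebesgue. f x * u x powr (- \<gamma> x) * \<phi> x)"
    if \<phi>: "\<phi> \<in> Cck 1 \<Omega>" for \<phi>
  proof -
    obtain K where K: "compact K" "K \<subseteq> \<Omega>" "\<And>x. x \<notin> K \<Longrightarrow> \<phi> x = 0"
      using \<phi> by (auto simp: Cck_def compactly_supported_in_def)
    obtain k where k: "k > 0" "AE x in M. x \<in> K \<longrightarrow> k \<le> ?s x" using lower[OF K(1,2)] by blast
    obtain B where B: "\<And>x. norm (jet \<phi> x) \<le> B" using Cck_jet(2)[OF \<phi>] by blast
    have fstB: "\<bar>\<phi> x\<bar> \<le> B" for x
      using B[of x] norm_fst_le[of "\<phi> x" "grad \<phi> x"] by (simp add: jet_def)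
    have N: "jet \<phi> \<in> V" by (rule jet_Cck_V[OF \<phi>])
    have "AE x in M. fst (jet \<phi> x) \<noteq> 0 \<longrightarrow> k \<le> ?s x"
      using k(2) by eventually_elim (use K(3) in \<open>auto simp: jet_def\<close>)
    moreover have "AE x in M. \<bar>fst (jet \<phi> x)\<bar> \<le> B" using fstB by (auto simp: jet_def intro: AE_I2)
    ultimately have *: "integrable M (\<lambda>x. fst (U x) powr (- \<gamma>' x) * fst (jet \<phi> x))"
      "(\<integral>x. a x (snd (U x)) \<bullet> snd (jet \<phi> x) \<partial>M) = (\<integral>x. fst (U x) powr (- \<gamma>' x) * fst (jet \<phi> x) \<partial>M)"
      using eq[OF N k(1)] by blast+
    have jm: "jet \<phi> \<in> borel_measurable M" by (rule Cck_jet(1)[OF \<phi>])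
    have [measurable]: "\<phi> \<in> borel_measurable lebesgue" "grad \<phi> \<in> borel_measurable lebesgue" "\<gamma>' \<in> borel_measurable lebesgue"
      using borel_measurable_fst[OF jm] borel_measurable_snd[OF jm] \<gamma>m by (auto simp: jet_def M_measurable)
    define F1 where "F1 = (\<lambda>x. a x (v x) \<bullet> grad \<phi> x)"
    define F2 where "F2 = (\<lambda>x. fst (U x) powr (- \<gamma>' x) * \<phi> x)"
    have [measurable]: "U \<in> borel_measurable lebesgue"
      using Lspace_measurable[OF V_imp_Lspace[OF U(1)]] by (simp add: M_measurable)
    have "(\<lambda>x. a x (v x)) \<in> borel_measurable M"
      by (rule P.a_measurable) (simp add: M_measurable)
    then have [measurable]: "(\<lambda>x. a x (v x)) \<in> borel_measurable lebesgue" by (simp add: M_measurable)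
    have Fm: "F1 \<in> borel_measurable lebesgue" "F2 \<in> borel_measurable lebesgue"
      unfolding F1_def F2_def by measurable
    have i1: "integrable M F1"
      using P.a_integrable[OF P.V_snd[OF U(1)] P.V_snd[OF N]] by (simp add: F1_def v_def jet_def)
    have i2: "integrable M F2" using *(1) by (simp add: F2_def jet_def)
    have eqF: "(\<integral>x. F1 x \<partial>M) = (\<integral>x. F2 x \<partial>M)" using *(2) by (simp add: F1_def F2_def v_def jet_def)
    have GL: "AE x in lebesgue. x \<in> \<Omega> \<longrightarrow> x \<in> G" using GAE by (simp add: AE_M)
    have uL: "AE x in lebesgue. x \<in> \<Omega> \<longrightarrow> u x = fst (U x)" using uU by (simp add: AE_M)
    \<comment> \<open>On \<open>G\<close> the density equals the weight up to a null set and cancels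
      the division in \<open>a\<close>.\<close>
    have e1: "AE x in lebesgue. dens x *\<^sub>R F1 x = indicator \<Omega> x *\<^sub>R (A x (v x) \<bullet> grad \<phi> x)"
      using GL dens_eq
    proof eventually_elim
      fix x assume *: "x \<in> \<Omega> \<longrightarrow> x \<in> G" "dens x = indicator \<Omega> x * w x"
      show "dens x *\<^sub>R F1 x = indicator \<Omega> x *\<^sub>R (A x (v x) \<bullet> grad \<phi> x)"
      proof (cases "x \<in> \<Omega>")
        case True
        then have "c x = x" using * by (simp add: c_def)
        then show ?thesis using True * wc[of x] by (simp add: F1_def a_def)
      qed (use * in simp)
    qed
    have e2: "AE x in lebesgue. dens x *\<^sub>R F2 x = indicator \<Omega> x *\<^sub>R (f x * u x powr (- \<gamma> x) * \<phi> x)"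
      using uL dens_eq f
      by eventually_elim (auto simp: F2_def \<gamma>'_def indicator_def)
    have m: "(\<lambda>x. dens x *\<^sub>R F1 x) \<in> borel_measurable lebesgue" "(\<lambda>x. dens x *\<^sub>R F2 x) \<in> borel_measurable lebesgue"
      using Fm by measurable
    note m1 = borel_measurable_AE[OF m(1) e1] and m2 = borel_measurable_AE[OF m(2) e2]
    have j: "integrable lebesgue (\<lambda>x. dens x *\<^sub>R F1 x)" "integrable lebesgue (\<lambda>x. dens x *\<^sub>R F2 x)"
      using i1 i2 integral_M(1)[OF Fm(1)] integral_M(1)[OF Fm(2)] by auto
    show ?thesis
      unfolding set_integrable_def set_lebesgue_integral_def
    proof (intro conjI)
      show "integrable lebesgue (\<lambda>x. indicator \<Omega> x *\<^sub>R (A x (v x) \<bullet> grad \<phi> x))"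
        by (rule integrable_cong_AE_imp[OF j(1) m1 e1])
      show "integrable lebesgue (\<lambda>x. indicator \<Omega> x *\<^sub>R (f x * u x powr (- \<gamma> x) * \<phi> x))"
        by (rule integrable_cong_AE_imp[OF j(2) m2 e2])
      have "(\<integral>x. indicator \<Omega> x *\<^sub>R (A x (v x) \<bullet> grad \<phi> x) \<partial>lebesgue) = (\<integral>x. dens x *\<^sub>R F1 x \<partial>lebesgue)"
        by (rule integral_cong_AE[OF m(1) m1 e1, symmetric])
      also have "\<dots> = (\<integral>x. dens x *\<^sub>R F2 x \<partial>lebesgue)"
        using eqF integral_M(2)[OF Fm(1)] integral_M(2)[OF Fm(2)] by simp
      also have "\<dots> = (\<integral>x. indicator \<Omega> x *\<^sub>R (f x * u x powr (- \<gamma> x) * \<phi> x) \<partial>lebesgue)"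
        by (rule integral_cong_AE[OF m(2) m2 e2])
      finally show "(\<integral>x. indicator \<Omega> x *\<^sub>R (A x (v x) \<bullet> grad \<phi> x) \<partial>lebesgue)
        = (\<integral>x. indicator \<Omega> x *\<^sub>R (f x * u x powr (- \<gamma> x) * \<phi> x) \<partial>lebesgue)" .
    qed
  qed
  have "weak_solution p w \<Omega> A f \<gamma> u"
    unfolding weak_solution_def
  proof (intro conjI)
    show "u \<in> W1p_loc p w \<Omega>" unfolding W1p_loc_def W1p_def using wg sub by blast
    show "\<forall>x\<in>\<Omega>. u x > 0" using upos by blast
    show "\<forall>D. D \<Subset> \<Omega> \<longrightarrow> (\<exists>c>0. AE x in lebesgue. x \<in> D \<longrightarrow> u x \<ge> c)"
    proof (intro allI impI)
      fix D assume D: "D \<Subset> \<Omega>"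
      then obtain k where k: "k > 0" "AE x in M. x \<in> closure D \<longrightarrow> k \<le> ?s x"
        using lower[of "closure D"] by (auto simp: compactly_inside_def)
      have "AE x in M. x \<in> D \<longrightarrow> k \<le> u x"
        using k(2) us by eventually_elim (use closure_subset[of D] in auto)
      then have "AE x in lebesgue. x \<in> D \<longrightarrow> u x \<ge> k"
        unfolding AE_M by eventually_elim (use sub[OF D] in auto)
      then show "\<exists>c>0. AE x in lebesgue. x \<in> D \<longrightarrow> u x \<ge> c" using k(1) by blast
    qed
    show "\<exists>v. has_wgradient_loc p w \<Omega> u v \<and>
        (\<forall>\<phi>\<in>Cck 1 \<Omega>.
           set_integrable lebesgue \<Omega> (\<lambda>x. A x (v x) \<bullet> grad \<phi> x) \<and>
           set_integrable lebesgue \<Omega> (\<lambda>x. f x * u x powr (- \<gamma> x) * \<phi> x) \<and>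
           (LINT x:\<Omega>|lebesgue. A x (v x) \<bullet> grad \<phi> x)
             = (LINT x:\<Omega>|lebesgue. f x * u x powr (- \<gamma> x) * \<phi> x))"
      using wg sub weak unfolding has_wgradient_loc_def by (intro exI[of _ v]) blast
    \<comment> \<open>The solution itself lies in the space with zero boundary values, so the
      exponent 1 suffices.\<close>
    show "\<exists>\<theta>\<ge>1. (\<lambda>x. u x powr \<theta>) \<in> W1p_0 p w \<Omega>"
      using W0 upos by (intro exI[of _ 1]) (simp add: less_imp_le)
  qed
  then show ?thesis using W0 by blast
qed

end

theorem theorem2p6:
  fixes \<Omega> :: "'a::euclidean_space set"
    and p \<delta> :: real
    and w f \<gamma> :: "'a \<Rightarrow> real"
    and A :: "'a \<Rightarrow> 'a \<Rightarrow> 'a"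
  assumes "DIM('a) \<ge> 2"
    and "bounded_smooth_domain \<Omega>"
    and "1 < p"
    and "p_admissible p w"
    and "structural_hypotheses p w \<Omega> A"
    and "AE x in lebesgue. x \<in> \<Omega> \<longrightarrow> f x = w x"
    and "continuous_on (closure \<Omega>) \<gamma>"
    and "\<forall>x\<in>closure \<Omega>. \<gamma> x > 0"
    and "\<delta> > 0"
    and "\<forall>x\<in>boundary_strip \<Omega> \<delta>. 0 < \<gamma> x \<and> \<gamma> x \<le> 1"
  shows "\<exists>u. weak_solution p w \<Omega> A f \<gamma> u \<and> u \<in> W1p_0 p w \<Omega>"
proof -
  interpret weighted_domain \<Omega> p w
    using assms(2-4) by unfold_locales (auto simp: bounded_smooth_domain_def p_admissible_def)
  have "\<Omega> \<noteq> {}" using assms(2) by (simp add: bounded_smooth_domain_def)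
  then show ?thesis using assms(5-10) by (rule weak_solution_exists)
qed

end
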